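(* Let $N\ge 1$ and let the global parameter be $a=\exp(i\pi/3)$. Then: (1) the function $Z_{\mathrm{HT}}(2N;x_1,\dots,x_{N-1},(x_N,x_N),y_1,\dots,y_N)$, i.e. the even-size half-turn partition function $Z_{\mathrm{HT}}(2N;x_1,\dots,x_{N-1},(x,y),y_1,\dots,y_N)$ specialized at $x=y=x_N$, is symmetric with respect to all its $2N$ variables $x_1,\dots,x_N,y_1,\dots,y_N$; (2) the function $Z_{\mathrm{HT}}(2N+1;x_1,\dots,x_N,(x,y),y_1,\dots,y_N)$ is symmetric with respect to the $2N$ variables $x_1,\dots,x_N,y_1,\dots,y_N$ (with $x$ and $y$ kept fixed).
   Context: All spectral parameters ($x_i,y_i,x,y$) are nonzero complex numbers (or indeterminates). Write $\overline{t}=1/t$ and $\sigma(t)=t-\overline{t}$. The number $a\neq 0$ is a global parameter. **Ice states and weights.** In a graph whose vertices all have degree four (with some edges having a free end on the boundary), an ice state is an orientation of the edges such that every vertex has exactly two incoming and two outgoing edges, and such that the prescribed boundary orientations hold. Each vertex has a left, right, bottom and top edge and carries a parameter $t\ne0$. Its weight in a state is: - $\sigma(a^2)$ if both the left and right edges are incoming (so top and bottom are outgoing), or if both the left and right edges are outgoing (so top and bottom are incoming); - $\sigma(at)$ if the horizontal flow goes left and the vertical flow goes up, or the horizontal flow goes right and the vertical flow goes down; - $\sigma(a\overline{t})$ if the horizontal flow goes right and the vertical flow goes up, or the horizontal flow goes left and the vertical flow goes down. Here "horizontal flow goes right" means that the left edge is incoming and the right edge is outgoing, and similarly for the other directions.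 The partition function of a model is the sum over all its ice states of the product of the weights of all vertices. **Even-size model** $Z_{\mathrm{HT}}(2N;x_1,\dots,x_{N-1},(x,y),y_1,\dots,y_N)$. The vertices are $(j,k)$ with column $1\le j\le N$ and row $1\le k\le 2N$ (rows numbered from bottom to top). Horizontally and vertically neighbouring vertices are joined by an edge. The left edge of each $(1,k)$ is a boundary edge oriented to the right (into the vertex). The bottom edge of each $(j,1)$ is a boundary edge oriented downwards (out of the vertex). The top edge of each $(j,2N)$ is a boundary edge oriented upwards (out of the vertex). For $1\le k\le N$, the right edge of $(N,k)$ and the right edge of $(N,2N+1-k)$ are one and the same edge, so it is outgoing at one of these two vertices and incoming at the other. Vertex $(j,k)$ has parameter $r_k\overline{y_j}$, where $r_k=r_{2N+1-k}=x_k$ for $1\le k\le N-1$, $r_N=x$ and $r_{N+1}=y$. **Odd-size model** $Z_{\mathrm{HT}}(2N+1;x_1,\dots,x_N,(x,y),y_1,\dots,y_N)$. The vertices are $(j,k)$ with $1\le j\le N$, $1\le k\le 2N+1$, together with $(N+1,k)$ for $1\le k\le N$. Horizontally and vertically neighbouring vertices are joined by an edge. The left edge of each $(1,k)$ is a boundary edge oriented to the right (into the vertex). The bottom edge of each $(j,1)$, $1\le j\le N+1$, is a boundary edge oriented downwards (out of the vertex). The top edge of each $(j,2N+1)$, $1\le j\le N$, is a boundary edge oriented upwards (out of the vertex). For $1\le k\le N$, the right edge of $(N+1,k)$ and the right edge of $(N,2N+2-k)$ are one and the same edge. The top edge of $(N+1,N)$ and the right edge of $(N,N+1)$ are one and the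 same edge. For $j\le N$ the vertex $(j,k)$ has parameter $r_k\overline{y_j}$, where $r_k=r_{2N+2-k}=x_k$ for $1\le k\le N$ and $r_{N+1}=x$. The vertex $(N+1,k)$, $1\le k\le N$, has parameter $x_k\overline{y}$. *)

theory Defs
  imports Complex_Main "HOL-Combinatorics.Permutations"
begin

definition sigma :: "complex \<Rightarrow> complex" where
  "sigma t = t - 1 / t"

type_synonym vertex = "nat \<times> nat"

datatype side = LeftS | RightS | BottomS | TopS

text \<open>
  An edge is described by its ends at the vertices. An internal edge is a pair of half-edges
  (it may join two right sides, or a top and a right side), a boundary edge is a single half-edge.
  The boundary edges are listed by their prescribed orientation, into or out of the vertex.
\<close>

type_synonym half_edge = "vertex \<times> side"

record ice_graph =
  vertices :: "vertex set"
  internal_edges :: "(half_edge \<times> half_edge) set"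
  boundary_in :: "half_edge set"
  boundary_out :: "half_edge set"

text \<open>
  An orientation of the edges is represented by the set \<open>S\<close> of the half-edges that are incoming at
  their vertex; an internal edge is incoming at exactly one of its two ends.
\<close>

definition incoming_sides :: "half_edge set \<Rightarrow> vertex \<Rightarrow> side set" where
  "incoming_sides S v = {d. (v, d) \<in> S}"

definition ice_states :: "ice_graph \<Rightarrow> half_edge set set" where
  "ice_states G = {S. S \<subseteq> vertices G \<times> UNIV
     \<and> (\<forall>(e, e') \<in> internal_edges G. e \<in> S \<longleftrightarrow> e' \<notin> S)
     \<and> boundary_in G \<subseteq> S
     \<and> boundary_out G \<inter> S = {}
     \<and> (\<forall>v \<in> vertices G. card (incoming_sides S v) = 2)}"

text \<open>
  The flow goes left iff the right edge is incoming and the left one is outgoing, and it goes up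
  iff the bottom edge is incoming and the top one is outgoing. The last case of the following
  definition does not occur in an ice state.
\<close>

definition vertex_weight :: "complex \<Rightarrow> complex \<Rightarrow> side set \<Rightarrow> complex" where
  "vertex_weight a t A =
    (if A = {LeftS, RightS} \<or> A = {BottomS, TopS} then sigma (a^2)
     else if A = {RightS, BottomS} \<or> A = {LeftS, TopS} then sigma (a * t)
     else if A = {LeftS, BottomS} \<or> A = {RightS, TopS} then sigma (a * (1 / t))
     else 0)"

definition partition_function :: "complex \<Rightarrow> ice_graph \<Rightarrow> (vertex \<Rightarrow> complex) \<Rightarrow> complex" where
  "partition_function a G t =
    (\<Sum>S \<in> ice_states G. \<Prod>v \<in> vertices G. vertex_weight a (t v) (incoming_sides S v))"

definition grid_edges :: "vertex set \<Rightarrow> (half_edge \<times> half_edge) set" where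
  "grid_edges V =
     {(((j, k), RightS), ((j + 1, k), LeftS)) | j k. (j, k) \<in> V \<and> (j + 1, k) \<in> V}
   \<union> {(((j, k), TopS), ((j, k + 1), BottomS)) | j k. (j, k) \<in> V \<and> (j, k + 1) \<in> V}"

definition even_vertices :: "nat \<Rightarrow> vertex set" where
  "even_vertices N = {1..N} \<times> {1..2*N}"

definition even_graph :: "nat \<Rightarrow> ice_graph" where
  "even_graph N = \<lparr>
     vertices = even_vertices N,
     internal_edges = grid_edges (even_vertices N)
       \<union> {(((N, k), RightS), ((N, 2*N + 1 - k), RightS)) | k. k \<in> {1..N}},
     boundary_in = {((1, k), LeftS) | k. k \<in> {1..2*N}},
     boundary_out = {((j, 1), BottomS) | j. j \<in> {1..N}}
       \<union> {((j, 2*N), TopS) | j. j \<in> {1..N}} \<rparr>"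

definition even_row :: "nat \<Rightarrow> (nat \<Rightarrow> complex) \<Rightarrow> complex \<Rightarrow> complex \<Rightarrow> nat \<Rightarrow> complex" where
  "even_row N xs x y k =
    (if k = N then x else if k = N + 1 then y
     else if k < N then xs k else xs (2*N + 1 - k))"

text \<open>
  Only \<open>xs 1, \<dots>, xs (N - 1)\<close> and \<open>ys 1, \<dots>, ys N\<close> are used.
\<close>

definition ZHT_even ::
  "complex \<Rightarrow> nat \<Rightarrow> (nat \<Rightarrow> complex) \<Rightarrow> complex \<times> complex \<Rightarrow> (nat \<Rightarrow> complex) \<Rightarrow> complex" where
  "ZHT_even a N xs xy ys = partition_function a (even_graph N)
     (\<lambda>(j, k). even_row N xs (fst xy) (snd xy) k * (1 / ys j))"

definition odd_vertices :: "nat \<Rightarrow> vertex set" where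
  "odd_vertices N = {1..N} \<times> {1..2*N + 1} \<union> {N + 1} \<times> {1..N}"

definition odd_graph :: "nat \<Rightarrow> ice_graph" where
  "odd_graph N = \<lparr>
     vertices = odd_vertices N,
     internal_edges = grid_edges (odd_vertices N)
       \<union> {(((N + 1, k), RightS), ((N, 2*N + 2 - k), RightS)) | k. k \<in> {1..N}}
       \<union> {(((N + 1, N), TopS), ((N, N + 1), RightS))},
     boundary_in = {((1, k), LeftS) | k. k \<in> {1..2*N + 1}},
     boundary_out = {((j, 1), BottomS) | j. j \<in> {1..N + 1}}
       \<union> {((j, 2*N + 1), TopS) | j. j \<in> {1..N}} \<rparr>"

definition odd_row :: "nat \<Rightarrow> (nat \<Rightarrow> complex) \<Rightarrow> complex \<Rightarrow> nat \<Rightarrow> complex" where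
  "odd_row N xs x k =
    (if k = N + 1 then x else if k \<le> N then xs k else xs (2*N + 2 - k))"

definition ZHT_odd ::
  "complex \<Rightarrow> nat \<Rightarrow> (nat \<Rightarrow> complex) \<Rightarrow> complex \<times> complex \<Rightarrow> (nat \<Rightarrow> complex) \<Rightarrow> complex" where
  "ZHT_odd a N xs xy ys = partition_function a (odd_graph N)
     (\<lambda>(j, k). if j \<le> N then odd_row N xs (fst xy) k * (1 / ys j)
               else xs k * (1 / snd xy))"

text \<open>
  A function of the \<open>n\<close> nonzero variables \<open>z 1, \<dots>, z n\<close> is symmetric.
\<close>

definition symmetric_in :: "nat \<Rightarrow> ((nat \<Rightarrow> complex) \<Rightarrow> complex) \<Rightarrow> bool" where
  "symmetric_in n F \<longleftrightarrow>
    (\<forall>z p. (\<forall>i \<in> {1..n}. z i \<noteq> 0) \<and> p permutes {1..n} \<longrightarrow> F (z \<circ> p) = F z)"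

end

theory Submission
  imports Defs "HOL-Computational_Algebra.Polynomial"
begin

text \<open>
  Write \<open>E(x\<^sub>1,\<dots>,x\<^bsub>N-1\<^esub>,(x,y),y\<^sub>1,\<dots>,y\<^sub>N)\<close> for the
  even-size partition function. The idea is to find it in closed form at a primitive sixth root of unity
  \<open>a\<close>, by Lagrange interpolation and induction on \<open>N\<close>; the closed form is
  visibly symmetric. The odd-size function is then read off from a specialization of the even one, and a
  limit removes the assumption that the parameters are generic.

  \<^bold>\<open>Interpolation.\<close> Both models are products of column transfer matrices
  (\<open>ZHT_even_eq\<close>, \<open>ZHT_odd_eq\<close>). By the Yang-Baxter equation these matrices
  commute on the states that matter (\<open>column_commute\<close>), so \<open>E\<close> is symmetric in
  the \<open>y\<^sub>j\<close>. The line that consists of the bottom and the top row enters from the left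
  at both ends, so its direction changes an odd number of times; hence
  \<open>x\<^sub>1\<^bsup>2N-1\<^esup> E\<close> is a polynomial in \<open>x\<^sub>1\<^sup>2\<close> of
  degree at most \<open>2N - 1\<close> (\<open>laurent_width_half_turn_even\<close>). If \<open>x\<^sub>1
  = y\<^sub>j / a\<close> or \<open>x\<^sub>1 = a y\<^sub>j\<close>, a corner vertex is forced, and then a
  whole column and the two outer rows are frozen: \<open>E\<close> becomes an explicit product times the
  function of size \<open>N - 1\<close> (\<open>half_turn_even_freeze\<close> and
  \<open>half_turn_even_reflect\<close>). For generic parameters these are \<open>2N\<close> values of
  \<open>x\<^sub>1\<^sup>2\<close>, so they determine \<open>E\<close>.

  \<^bold>\<open>The solution.\<close> Let \<open>s\<^sub>1\<close> and \<open>s\<^sub>2\<close> be the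
  Schur functions in \<open>2N\<close> variables of the partitions
  \<open>(N-1,N-1,\<dots>,1,1,0,0)\<close> and \<open>(N,N-1,N-1,\<dots>,1,1,0)\<close>. Their numerators
  are alternants whose exponents lie in two residue classes modulo 3; a Laplace expansion along the two
  classes gives a sum over subsets in which the variables occur through Vandermonde products of their
  cubes. If \<open>w' = \<zeta> w\<close> with \<open>\<zeta>\<close> a primitive cube root of unity, then
  the cubes agree and the terms collapse to the same function without \<open>w\<close> and
  \<open>w'\<close> (\<open>schur_polynomial\<close>). Since \<open>a\<^sup>2\<close> is a cube root of
  unity, this is the recursion satisfied by \<open>E\<close>, and one finds, up to an explicit factor
  which is symmetric in the \<open>x\<^sub>i\<close> and \<open>y\<^sub>j\<close>, \<open>(x + y) E = (x +
  a y) (x s\<^sub>1(z,x) s\<^sub>2(z,y) + y s\<^sub>2(z,x) s\<^sub>1(z,y))\<close>, where \<open>z =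
  (x\<^sub>1,\<dots>,x\<^bsub>N-1\<^esub>,y\<^sub>1,\<dots>,y\<^sub>N)\<close> and the Schur functions are
  taken at the squares (\<open>half_turn_even_schur\<close>). So \<open>E\<close> is symmetric in
  \<open>z\<close> for all \<open>x\<close> and \<open>y\<close>, and for \<open>x = y\<close> the
  right-hand side is, up to a factor, \<open>s\<^sub>1 s\<^sub>2\<close> at the squares of all
  \<open>2N\<close> variables. This is the even case.

  \<^bold>\<open>The odd model.\<close> In the even model with \<open>N + 1\<close> columns and
  \<open>(x,y)\<close> replaced by \<open>(y/a,x)\<close>, where \<open>y\<close> is also the parameter of
  the first column, the upper half of that column is frozen, and its lower half is joined to the row with
  parameter \<open>y/a\<close>. The Yang-Baxter equation moves the resulting line, which turns once, from
  the left to the right of the lower rows, and there it is the extra column of the odd model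
  (\<open>half_turn_even_turn\<close>). The prefactor is symmetric at a sixth root of unity, so the
  symmetry of \<open>E\<close> in all its variables except \<open>(x,y)\<close> gives the odd case.
\<close>

section \<open>Products of transfer matrices\<close>

text \<open>
  Entry \<open>(s, t)\<close> of the product of the matrices \<open>f x\<close>, for \<open>x\<close>
  running through a list, with rows and columns indexed by \<open>S\<close>. Both a column of vertices and
  a sequence of columns are of this form.
\<close>

fun transfer :: "('x \<Rightarrow> 's \<Rightarrow> 's \<Rightarrow> complex) \<Rightarrow> 's set \<Rightarrow> 'x list \<Rightarrow> 's \<Rightarrow> 's \<Rightarrow> complex" where
  "transfer f S [] s t = (if s = t then 1 else 0)"
| "transfer f S (x # xs) s t = (\<Sum>m\<in>S. f x s m * transfer f S xs m t)"

lemma transfer_append: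
  assumes "finite S" "s \<in> S"
  shows "transfer f S (xs @ ys) s t = (\<Sum>m\<in>S. transfer f S xs s m * transfer f S ys m t)"
  using assms(2)
proof (induction xs arbitrary: s)
  case Nil
  have "(\<Sum>m\<in>S. (if s = m then 1 else 0) * transfer f S ys m t)
      = (\<Sum>m\<in>S. if s = m then transfer f S ys m t else 0)"
    by (intro sum.cong) auto
  then show ?case using Nil assms(1) by (simp add: sum.delta)
next
  case (Cons x xs)
  have "transfer f S ((x # xs) @ ys) s t
      = (\<Sum>k\<in>S. \<Sum>m\<in>S. f x s k * transfer f S xs k m * transfer f S ys m t)"
    using Cons.IH by (simp add: sum_distrib_left mult.assoc)
  also have "\<dots> = (\<Sum>m\<in>S. \<Sum>k\<in>S. f x s k * transfer f S xs k m * transfer f S ys m t)"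
    by (rule sum.swap)
  finally show ?case by (simp add: sum_distrib_right)
qed

lemma transfer_snoc:
  assumes "finite S" "s \<in> S" "t \<in> S"
  shows "transfer f S (xs @ [x]) s t = (\<Sum>m\<in>S. transfer f S xs s m * f x m t)"
proof -
  have "(\<Sum>k\<in>S. f x m k * (if k = t then 1 else 0)) = f x m t" for m
    using assms by (simp add: if_distrib sum.delta' cong: if_cong)
  then show ?thesis using assms by (simp add: transfer_append)
qed

text \<open>
  The abstract form of the train argument: if \<open>R\<close> can be carried past each factor, it can be
  carried past the whole product.
\<close>

lemma transfer_intertwine:
  assumes "finite S"
    and "\<And>x s t. x \<in> set xs \<Longrightarrow> s \<in> S \<Longrightarrow> t \<in> S \<Longrightarrow>
           (\<Sum>m\<in>S. f x s m * R m t) = (\<Sum>m\<in>S. R s m * g x m t)"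
    and "s \<in> S" "t \<in> S"
  shows "(\<Sum>m\<in>S. transfer f S xs s m * R m t) = (\<Sum>m\<in>S. R s m * transfer g S xs m t)"
  using assms(2,3)
proof (induction xs arbitrary: s)
  case Nil
  then show ?case using assms(1,4)
    by (simp add: if_distrib if_distribR sum.delta sum.delta' cong: if_cong)
next
  case (Cons x xs)
  have IH: "(\<Sum>m\<in>S. transfer f S xs k m * R m t) = (\<Sum>m\<in>S. R k m * transfer g S xs m t)"
    if "k \<in> S" for k
    using Cons that by simp
  have "(\<Sum>m\<in>S. transfer f S (x # xs) s m * R m t)
      = (\<Sum>m\<in>S. \<Sum>k\<in>S. f x s k * (transfer f S xs k m * R m t))"
    by (simp add: sum_distrib_right mult.assoc)
  also have "\<dots> = (\<Sum>k\<in>S. \<Sum>m\<in>S. f x s k * (transfer f S xs k m * R m t))"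
    by (rule sum.swap)
  also have "\<dots> = (\<Sum>k\<in>S. f x s k * (\<Sum>m\<in>S. R k m * transfer g S xs m t))"
    by (simp add: sum_distrib_left [symmetric] IH)
  also have "\<dots> = (\<Sum>m\<in>S. (\<Sum>k\<in>S. f x s k * R k m) * transfer g S xs m t)"
    unfolding sum_distrib_left sum_distrib_right by (subst sum.swap) (simp add: mult.assoc)
  also have "\<dots> = (\<Sum>m\<in>S. (\<Sum>k\<in>S. R s k * g x k m) * transfer g S xs m t)"
    by (intro sum.cong) (auto simp: Cons.prems)
  also have "\<dots> = (\<Sum>k\<in>S. \<Sum>m\<in>S. R s k * g x k m * transfer g S xs m t)"
    unfolding sum_distrib_right by (subst sum.swap) simp
  finally show ?case by (simp add: sum_distrib_left mult.assoc)
qed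

lemma transfer_invariant:
  assumes "\<And>x s m. x \<in> set xs \<Longrightarrow> s \<in> A \<Longrightarrow> s \<in> S \<Longrightarrow> m \<in> S \<Longrightarrow> m \<notin> A \<Longrightarrow> f x s m = 0"
    and "s \<in> S" "s \<in> A" "t \<notin> A"
  shows "transfer f S xs s t = 0"
  using assms(1-3)
proof (induction xs arbitrary: s)
  case (Cons x xs)
  have "f x s m * transfer f S xs m t = 0" if "m \<in> S" for m
    using Cons that by (cases "m \<in> A") auto
  then show ?case by (auto intro!: sum.neutral)
qed (use assms in auto)

lemma sum_bool: "(\<Sum>b\<in>(UNIV::bool set). f b) = f True + (f False :: complex)"
  by (simp add: UNIV_bool add.commute)

text \<open>
  The states of the horizontal edges between two neighbouring columns, from bottom to top;
  \<open>True\<close> means that the flow goes to the right.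
\<close>

definition bool_lists :: "nat \<Rightarrow> bool list set" where
  "bool_lists n = {bs. length bs = n}"

lemma finite_bool_lists [simp, intro]: "finite (bool_lists n)"
  using finite_lists_length_eq [of "UNIV :: bool set" n] by (simp add: bool_lists_def)

lemma bool_lists_iff [simp]: "bs \<in> bool_lists n \<longleftrightarrow> length bs = n"
  by (simp add: bool_lists_def)

lemma bool_lists_0 [simp]: "bool_lists 0 = {[]}"
  by (auto simp: bool_lists_def)

lemma sum_bool_lists_append:
  "(\<Sum>bs\<in>bool_lists (m + n). f bs) = (\<Sum>bs\<in>bool_lists m. \<Sum>cs\<in>bool_lists n. (f (bs @ cs) :: complex))"
  unfolding sum.cartesian_product
  by (rule sum.reindex_bij_witness [where i = "\<lambda>(bs, cs). bs @ cs" and j = "\<lambda>bs. (take m bs, drop m bs)"]) auto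

lemma sum_bool_lists_1:
  "(\<Sum>bs\<in>bool_lists (Suc 0). f bs) = (\<Sum>b\<in>UNIV. (f [b] :: complex))"
  by (rule sum.reindex_bij_witness [where i = "\<lambda>b. [b]" and j = hd]) (auto simp: length_Suc_conv)

lemma sum_bool_lists_Cons:
  "(\<Sum>bs\<in>bool_lists (Suc n). f bs) = (\<Sum>b\<in>UNIV. \<Sum>bs\<in>bool_lists n. (f (b # bs) :: complex))"
  using sum_bool_lists_append [where m = "Suc 0" and n = n and f = f] by (simp add: sum_bool_lists_1)

lemma sum_bool_lists_Cons_snoc:
  "(\<Sum>bs\<in>bool_lists (Suc (Suc n)). f bs)
   = (\<Sum>b\<in>UNIV. \<Sum>bs\<in>bool_lists n. \<Sum>c\<in>UNIV. (f (b # bs @ [c]) :: complex))"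
proof -
  have "(\<Sum>bs\<in>bool_lists (Suc n). g bs) = (\<Sum>bs\<in>bool_lists n. \<Sum>c\<in>UNIV. (g (bs @ [c]) :: complex))" for g
    using sum_bool_lists_append [where m = n and n = "Suc 0" and f = g] by (simp add: sum_bool_lists_1)
  then show ?thesis by (simp only: sum_bool_lists_Cons [where n = "Suc n"])
qed

section \<open>Vertex weights and the Yang-Baxter equation\<close>

text \<open>
  The vertex weight in terms of flows. The flags say that the left and the right edge flow to the right
  and that the bottom and the top edge flow upwards. Configurations that violate the ice rule have weight
  zero, so that sums may run over all flags.
\<close>

definition ice_weight :: "complex \<Rightarrow> complex \<Rightarrow> bool \<Rightarrow> bool \<Rightarrow> bool \<Rightarrow> bool \<Rightarrow> complex" where
  "ice_weight a t l r b u =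
    (if l = r \<and> b = u then (if l = b then sigma (a / t) else sigma (a * t))
     else if l \<noteq> r \<and> r = b \<and> u = l then sigma (a\<^sup>2) else 0)"

definition column :: "complex \<Rightarrow> complex \<Rightarrow> complex list \<Rightarrow> bool list \<Rightarrow> bool list \<Rightarrow> bool \<Rightarrow> bool \<Rightarrow> complex" where
  "column a y rs ls hs = transfer (\<lambda>(r, l, h). ice_weight a (r / y) l h) UNIV (zip rs (zip ls hs))"

lemma column_Nil [simp]: "column a y [] ls hs b u = (if b = u then 1 else 0)"
  by (simp add: column_def)

lemma column_Cons [simp]:
  "column a y (r # rs) (l # ls) (h # hs) b u
   = (\<Sum>v\<in>UNIV. ice_weight a (r / y) l h b v * column a y rs ls hs v u)"
  by (simp add: column_def)

lemma column_append:
  assumes "length ls = length rs" "length hs = length rs"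
  shows "column a y (rs @ rs') (ls @ ls') (hs @ hs') b u
    = (\<Sum>v\<in>UNIV. column a y rs ls hs b v * column a y rs' ls' hs' v u)"
  using assms by (simp add: column_def transfer_append)

lemma sum_UNIV_pair:
  "(\<Sum>p\<in>UNIV. f p) = (\<Sum>x\<in>UNIV. \<Sum>y\<in>UNIV. f (x, y))"
  by (simp add: sum.cartesian_product)

text \<open>
  Two neighbouring columns, summed over the horizontal edges between them, form a product of matrices that
  act on pairs of vertical states. In this form the Yang-Baxter equation is a local intertwining relation.
\<close>

lemma column_pair_transfer:
  assumes "length ls = length rs" "length hs = length rs"
  shows "(\<Sum>ms\<in>bool_lists (length rs). column a y rs ls ms b v * column a y' rs ms hs b' v')
    = transfer (\<lambda>(r, l, h) (b, b') (v, v'). \<Sum>m\<in>UNIV. ice_weight a (r / y) l m b v * ice_weight a (r / y') m h b' v')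
        UNIV (zip rs (zip ls hs)) (b, b') (v, v')"
  using assms
proof (induction rs arbitrary: ls hs b b')
  case (Cons r rs)
  obtain l ls' h hs' where [simp]: "ls = l # ls'" "hs = h # hs'"
    using Cons.prems by (cases ls; cases hs) auto
  let ?w = "ice_weight a"
  have "(\<Sum>ms\<in>bool_lists (length (r # rs)). column a y (r # rs) ls ms b v * column a y' (r # rs) ms hs b' v')
     = (\<Sum>m\<in>UNIV. \<Sum>ms\<in>bool_lists (length rs). \<Sum>c\<in>UNIV. \<Sum>c'\<in>UNIV.
          (?w (r / y) l m b c * ?w (r / y') m h b' c') * (column a y rs ls' ms c v * column a y' rs ms hs' c' v'))"
    by (simp add: sum_bool_lists_Cons sum_product mult_ac)
  also have "\<dots> = (\<Sum>m\<in>UNIV. \<Sum>c\<in>UNIV. \<Sum>c'\<in>UNIV. \<Sum>ms\<in>bool_lists (length rs).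
          (?w (r / y) l m b c * ?w (r / y') m h b' c') * (column a y rs ls' ms c v * column a y' rs ms hs' c' v'))"
    by (simp add: sum_bool sum.distrib)
  also have "\<dots> = (\<Sum>m\<in>UNIV. \<Sum>c\<in>UNIV. \<Sum>c'\<in>UNIV.
          (?w (r / y) l m b c * ?w (r / y') m h b' c') * 
      transfer (\<lambda>(r, l, h) (b, b') (v, v'). \<Sum>m\<in>UNIV. ?w (r / y) l m b v * ?w (r / y') m h b' v')
        UNIV (zip rs (zip ls' hs')) (c, c') (v, v'))"
    using Cons by (simp add: sum_distrib_left [symmetric])
  also have "\<dots> = (\<Sum>c\<in>UNIV. \<Sum>c'\<in>UNIV. (\<Sum>m\<in>UNIV. ?w (r / y) l m b c * ?w (r / y') m h b' c') * 
      transfer (\<lambda>(r, l, h) (b, b') (v, v'). \<Sum>m\<in>UNIV. ?w (r / y) l m b v * ?w (r / y') m h b' v')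
        UNIV (zip rs (zip ls' hs')) (c, c') (v, v'))"
    by (simp add: sum_bool algebra_simps)
  finally show ?case
    by (simp add: sum_UNIV_pair)
qed auto

text \<open>
  The tilted vertex, at which the lines with parameters \<open>y\<close> and \<open>y'\<close> cross, has
  parameter \<open>y / (a y')\<close>. On the left-hand side it stands above the row \<open>r\<close>,
  with the line of \<open>y\<close> as its left and that of \<open>y'\<close> as its bottom edge; on the
  right-hand side it stands below. The equation is a finite check of the \<open>2\<^sup>6\<close> boundary
  conditions.
\<close>

lemma yang_baxter:
  assumes "a \<noteq> 0" "r \<noteq> 0" "y \<noteq> 0" "y' \<noteq> 0"
  shows "(\<Sum>v\<in>UNIV. \<Sum>v'\<in>UNIV. (\<Sum>m\<in>UNIV. ice_weight a (r / y) l m b v * ice_weight a (r / y') m h b' v')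
            * ice_weight a (y / (a * y')) v c v' c')
       = (\<Sum>v\<in>UNIV. \<Sum>v'\<in>UNIV. ice_weight a (y / (a * y')) b v' b' v
            * (\<Sum>m\<in>UNIV. ice_weight a (r / y') l m v c' * ice_weight a (r / y) m h v' c))"
  using assms
  apply (cases l; cases h; cases b; cases b'; cases c; cases c';
      simp add: sum_bool ice_weight_def)
  apply (simp_all add: sigma_def field_simps power2_eq_square)
  done

section \<open>Commuting columns and the even model\<close>

lemma column_exchange:
  assumes "a \<noteq> 0" "y \<noteq> 0" "y' \<noteq> 0" "0 \<notin> set rs"
    and "length ls = length rs" "length hs = length rs"
  shows "(\<Sum>v\<in>UNIV. \<Sum>v'\<in>UNIV. (\<Sum>ms\<in>bool_lists (length rs). column a y rs ls ms b v * column a y' rs ms hs b' v')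
            * ice_weight a (y / (a * y')) v c v' c')
       = (\<Sum>v\<in>UNIV. \<Sum>v'\<in>UNIV. ice_weight a (y / (a * y')) b v' b' v
            * (\<Sum>ms\<in>bool_lists (length rs). column a y' rs ls ms v c' * column a y rs ms hs v' c))"
proof -
  define T where "T = (\<lambda>y y' (r, l, h) (b, b') (v, v'). \<Sum>m\<in>UNIV. ice_weight a (r / y) l m b v * ice_weight a (r / y') m h b' v')"
  define R where "R = (\<lambda>(b, b') (v, v'). ice_weight a (y / (a * y')) b v' b' v)"
  define qs where "qs = zip rs (zip ls hs)"
  have "(\<Sum>m\<in>UNIV. T y y' q s m * R m t) = (\<Sum>m\<in>UNIV. R s m * T y' y q m t)"
    if "q \<in> set qs" for q s t
  proof -
    obtain r l h where q: "q = (r, l, h)" by (cases q)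
    then have "r \<noteq> 0" using that assms(4) by (auto simp: qs_def dest: set_zip_leftD)
    then show ?thesis
      using yang_baxter [OF assms(1) _ assms(2,3), where r = r and l = l and h = h
          and b = "fst s" and b' = "snd s" and c = "snd t" and c' = "fst t"]
      by (simp add: q T_def R_def sum_UNIV_pair split_beta)
  qed
  then have "(\<Sum>m\<in>UNIV. transfer (T y y') UNIV qs (b, b') m * R m (c', c))
      = (\<Sum>m\<in>UNIV. R (b, b') m * transfer (T y' y) UNIV qs m (c', c))"
    by (intro transfer_intertwine) auto
  then show ?thesis
    unfolding column_pair_transfer [OF assms(5,6)]
    by (simp add: sum_UNIV_pair R_def T_def qs_def)
qed

text \<open>
  If both columns start with an outgoing bottom edge, both edges below the tilted vertex flow downwards
  and the ice rule leaves one state for it; the same holds with upward flows at the top. The two states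
  have the same weight, which can therefore be cancelled.
\<close>

lemma column_commute:
  assumes "a \<noteq> 0" "y \<noteq> 0" "y' \<noteq> 0" "0 \<notin> set rs" "sigma (a\<^sup>2 * y' / y) \<noteq> 0"
    and "length ls = length rs" "length hs = length rs"
  shows "(\<Sum>ms\<in>bool_lists (length rs). column a y rs ls ms False True * column a y' rs ms hs False True)
       = (\<Sum>ms\<in>bool_lists (length rs). column a y' rs ls ms False True * column a y rs ms hs False True)"
proof -
  have "sigma (a / (y / (a * y'))) \<noteq> 0"
    using assms(5) by (simp add: power2_eq_square mult_ac)
  then show ?thesis
    \<comment> \<open>the weight of both surviving states of the tilted vertex is \<open>sigma (a\<^sup>2 y' / y)\<close>\<close>
    using column_exchange [OF assms(1-4,6,7), of False False True True]
    by (simp add: sum_bool ice_weight_def)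
qed

definition columns :: "complex \<Rightarrow> complex list \<Rightarrow> complex list \<Rightarrow> bool list \<Rightarrow> bool list \<Rightarrow> complex" where
  "columns a rs = transfer (\<lambda>y ls hs. column a y rs ls hs False True) (bool_lists (length rs))"

lemma columns_Nil [simp]: "columns a rs [] ls hs = (if ls = hs then 1 else 0)"
  by (simp add: columns_def)

lemma columns_Cons [simp]:
  "columns a rs (y # ys) ls hs
   = (\<Sum>ms\<in>bool_lists (length rs). column a y rs ls ms False True * columns a rs ys ms hs)"
  by (simp add: columns_def)

lemma columns_move_to_front:
  assumes "a \<noteq> 0" "0 \<notin> set rs" "0 \<notin> set (us @ [v])" "\<And>u. u \<in> set us \<Longrightarrow> sigma (a\<^sup>2 * v / u) \<noteq> 0"
    and "length ls = length rs"
  shows "columns a rs (us @ v # ys) ls hs = columns a rs (v # us @ ys) ls hs"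
  using assms(3-5)
proof (induction us arbitrary: ls)
  case (Cons u us)
  let ?B = "bool_lists (length rs)"
  have "columns a rs ((u # us) @ v # ys) ls hs
      = (\<Sum>ms\<in>?B. \<Sum>ns\<in>?B. column a u rs ls ms False True * column a v rs ms ns False True * columns a rs (us @ ys) ns hs)"
    using Cons by (simp add: sum_distrib_left mult.assoc)
  also have "\<dots> = (\<Sum>ns\<in>?B. (\<Sum>ms\<in>?B. column a u rs ls ms False True * column a v rs ms ns False True) * columns a rs (us @ ys) ns hs)"
    by (subst sum.swap) (simp add: sum_distrib_right)
  also have "\<dots> = (\<Sum>ns\<in>?B. (\<Sum>ms\<in>?B. column a v rs ls ms False True * column a u rs ms ns False True) * columns a rs (us @ ys) ns hs)"
    using Cons.prems assms(1,2) by (intro sum.cong refl arg_cong2 [where f = "(*)"] column_commute) auto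
  also have "\<dots> = (\<Sum>ms\<in>?B. \<Sum>ns\<in>?B. column a v rs ls ms False True * column a u rs ms ns False True * columns a rs (us @ ys) ns hs)"
    by (subst sum.swap) (simp add: sum_distrib_right)
  finally show ?case by (simp add: sum_distrib_left mult.assoc)
qed auto

text \<open>
  The even model. The rows from bottom to top have the parameters \<open>xs @ [x, y] @ rev xs\<close>. The
  list \<open>g\<close> gives the flows that leave the lower half on the right; each of them enters the
  upper half in the row reflected about the middle, hence the negation and the reversal.
\<close>

definition half_turn_even :: "complex \<Rightarrow> complex list \<Rightarrow> complex \<Rightarrow> complex \<Rightarrow> complex list \<Rightarrow> complex" where
  "half_turn_even a xs x y ys =
     (\<Sum>g\<in>bool_lists (length ys).
        columns a (xs @ [x, y] @ rev xs) ys (replicate (2 * length ys) True) (g @ rev (map Not g)))"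

lemma half_turn_even_move_to_front:
  assumes "a \<noteq> 0" "x \<noteq> 0" "y \<noteq> 0" "0 \<notin> set xs" "0 \<notin> set (us @ [v])"
    and "\<And>u. u \<in> set us \<Longrightarrow> sigma (a\<^sup>2 * v / u) \<noteq> 0" "length (us @ v # ys) = Suc (length xs)"
  shows "half_turn_even a xs x y (us @ v # ys) = half_turn_even a xs x y (v # us @ ys)"
  unfolding half_turn_even_def
  using assms by (subst columns_move_to_front) (auto simp: simp del: columns_Cons)

text \<open>
  A reflection in a horizontal axis reverses the direction of vertical flows and exchanges the two kinds
  of non-turning vertices, which amounts to inverting the parameter.
\<close>

lemma ice_weight_reflect:
  "ice_weight a (inverse r / inverse y) l h b u = ice_weight a (r / y) l h (\<not> u) (\<not> b)"
  by (cases l; cases h; cases b; cases u; simp add: ice_weight_def field_simps)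

lemma column_reflect:
  assumes "length ls = length rs" "length hs = length rs"
  shows "column a (inverse y) (rev (map inverse rs)) (rev ls) (rev hs) b u = column a y rs ls hs (\<not> u) (\<not> b)"
  using assms
proof (induction rs arbitrary: ls hs b u)
  case (Cons r rs)
  obtain l ls' h hs' where [simp]: "ls = l # ls'" "hs = h # hs'"
    using Cons.prems by (cases ls; cases hs) auto
  have "column a (inverse y) (rev (map inverse (r # rs))) (rev ls) (rev hs) b u
     = (\<Sum>v\<in>UNIV. column a y rs ls' hs' (\<not> v) (\<not> b) * ice_weight a (r / y) l h (\<not> u) (\<not> v))"
    using Cons by (cases u) (simp_all add: column_append sum_bool ice_weight_reflect)
  then show ?case by (simp add: sum_bool mult_ac add_ac)
qed auto

lemma sum_bool_lists_rev: "(\<Sum>bs\<in>bool_lists n. f (rev bs)) = (\<Sum>bs\<in>bool_lists n. (f bs :: complex))"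
  by (rule sum.reindex_bij_witness [where i = rev and j = rev]) auto

lemma sum_bool_lists_Not: "(\<Sum>bs\<in>bool_lists n. f (map Not bs)) = (\<Sum>bs\<in>bool_lists n. (f bs :: complex))"
  by (rule sum.reindex_bij_witness [where i = "map Not" and j = "map Not"]) (auto simp: comp_def)

lemma columns_reflect:
  assumes "length ls = length rs" "length hs = length rs"
  shows "columns a (rev (map inverse rs)) (map inverse ys) (rev ls) (rev hs) = columns a rs ys ls hs"
  using assms(1)
proof (induction ys arbitrary: ls)
  case (Cons y ys)
  have "columns a (rev (map inverse rs)) (map inverse (y # ys)) (rev ls) (rev hs)
     = (\<Sum>ms\<in>bool_lists (length rs). column a (inverse y) (rev (map inverse rs)) (rev ls) (rev ms) False True
          * columns a (rev (map inverse rs)) (map inverse ys) (rev ms) (rev hs))"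
    by (simp add: sum_bool_lists_rev [where f = "\<lambda>ms. column a (inverse y) (rev (map inverse rs)) (rev ls) ms False True
          * columns a (rev (map inverse rs)) (map inverse ys) ms (rev hs)"])
  also have "\<dots> = columns a rs (y # ys) ls hs"
    unfolding columns_Cons using Cons by (intro sum.cong) (auto simp: column_reflect)
  finally show ?case .
qed auto

text \<open>
  Turning the model upside down exchanges the roles of \<open>x\<close> and \<open>y\<close>. It
  transports the specialization \<open>x\<^sub>1 = y\<^sub>1 / a\<close> to \<open>x\<^sub>1 = a
  y\<^sub>1\<close>.
\<close>

lemma half_turn_even_reflect:
  assumes "length ys = Suc (length xs)"
  shows "half_turn_even a (map inverse xs) (inverse y) (inverse x) (map inverse ys) = half_turn_even a xs x y ys"
proof -
  let ?rs = "xs @ [x, y] @ rev xs"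
  have "half_turn_even a (map inverse xs) (inverse y) (inverse x) (map inverse ys)
     = (\<Sum>g\<in>bool_lists (length ys). columns a (rev (map inverse ?rs)) (map inverse ys)
          (rev (replicate (2 * length ys) True)) (rev (map Not g @ rev (map Not (map Not g)))))"
    by (simp add: half_turn_even_def rev_map comp_def)
  also have "\<dots> = (\<Sum>g\<in>bool_lists (length ys). columns a ?rs ys
          (replicate (2 * length ys) True) (map Not g @ rev (map Not (map Not g))))"
    using assms by (intro sum.cong refl columns_reflect) auto
  finally show ?thesis
    unfolding half_turn_even_def sum_bool_lists_Not [where f = "\<lambda>g. columns a ?rs ys
          (replicate (2 * length ys) True) (g @ rev (map Not g))"] .
qed

section \<open>Frozen lines\<close>

text \<open>
  Above the point where an upward flow enters a column whose left edges are all incoming, the ice rule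
  forces every vertex.
\<close>

lemma column_frozen_up:
  assumes "length m = length rs"
  shows "column a y rs (replicate (length rs) True) m True u
    = (if m = replicate (length rs) True \<and> u then prod_list (map (\<lambda>r. sigma (a * y / r)) rs) else 0)"
  using assms
proof (induction rs arbitrary: m)
  case (Cons r rs)
  then show ?case by (cases m) (auto simp: sum_bool ice_weight_def)
qed auto

text \<open>
  The bottom vertex cannot be passed straight on by a line from the left, since this weight vanishes; so
  it turns, and the rest of the column is forced.
\<close>

lemma column_frozen:
  assumes "sigma (a * (x / y)) = 0" "length m = length rs"
  shows "column a y (x # rs) (replicate (Suc (length rs)) True) (h # m) False u
    = (if \<not> h \<and> m = replicate (length rs) True \<and> u
       then sigma (a\<^sup>2) * prod_list (map (\<lambda>r. sigma (a * y / r)) rs) else 0)"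
  using assms by (auto simp: sum_bool ice_weight_def column_frozen_up)

lemma column_bottom_left_flow:
  assumes "b"
  shows "column a y (x # rs) (False # l) (b # m) False u = 0"
  using assms by (simp add: sum_bool ice_weight_def)

lemma column_top_left_flow:
  assumes "b" "length l = length rs" "length m = length rs"
  shows "column a y (rs @ [x]) (l @ [False]) (m @ [b]) c True = 0"
  using assms by (simp add: column_append sum_bool ice_weight_def)

lemma column_peel:
  assumes "length l = length rs" "length m = length rs"
  shows "column a y (x # rs @ [x]) (False # l @ [True]) (False # m @ [True]) False True
    = (sigma (a * y / x))\<^sup>2 * column a y rs l m False True"
  using assms by (simp add: column_append sum_bool ice_weight_def power2_eq_square)

lemma columns_bottom_left_flow:
  assumes "length l = length rs" "b"
  shows "columns a (x # rs) ys (False # l) (b # h) = 0"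
  unfolding columns_def
  by (rule transfer_invariant [where A = "{h. \<not> hd h}"])
     (use assms in \<open>auto simp: length_Suc_conv sum_bool ice_weight_def\<close>)

lemma columns_top_left_flow:
  assumes "length l = length rs" "b"
  shows "columns a (rs @ [x]) ys (l @ [False]) (h @ [b]) = 0"
  unfolding columns_def
proof (rule transfer_invariant [where A = "{h. \<not> last h}"])
  fix y s m
  assume *: "s \<in> {h. \<not> last h}" "s \<in> bool_lists (length (rs @ [x]))" "m \<in> bool_lists (length (rs @ [x]))"
    "m \<notin> {h. \<not> last h}"
  obtain s' c where s: "s = s' @ [c]" using *(2) by (cases s rule: rev_cases) auto
  obtain m' d where m: "m = m' @ [d]" using *(3) by (cases m rule: rev_cases) auto
  show "column a y (rs @ [x]) s m False True = 0"
    using * column_top_left_flow [of d s' rs m'] by (simp add: s m)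
qed (use assms in auto)

text \<open>
  The outer two rows are frozen. A leftward flow in the bottom row stays leftward, because the bottom
  edges are all outgoing. A leftward flow in the top row also stays leftward, for the same reason at the
  top, so it would not match the right boundary; hence the top row flows to the right throughout.
\<close>

lemma columns_peel:
  assumes "length l = length rs" "length h = length rs"
  shows "columns a (x # rs @ [x]) ys (False # l @ [True]) (False # h @ [True])
    = (prod_list (map (\<lambda>y. sigma (a * y / x)) ys))\<^sup>2 * columns a rs ys l h"
  using assms(1)
proof (induction ys arbitrary: l)
  case (Cons y ys)
  let ?B = "bool_lists (length rs)" and ?rs = "x # rs @ [x]"
  have bottom: "column a y ?rs (False # l @ [True]) (True # m @ [c]) False True = 0" for m c
    by (rule column_bottom_left_flow) simp
  \<comment> \<open>once the top row flows to the left, it cannot flow to the right at the end\<close>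
  have top: "columns a ?rs ys (False # m @ [False]) (False # h @ [True]) = 0" if "m \<in> ?B" for m
    using columns_top_left_flow [of "False # m" "x # rs" True a x ys "False # h"] that by simp
  have "columns a ?rs (y # ys) (False # l @ [True]) (False # h @ [True])
     = (\<Sum>ms\<in>?B. column a y ?rs (False # l @ [True]) (False # ms @ [True]) False True
          * columns a ?rs ys (False # ms @ [True]) (False # h @ [True]))"
    unfolding columns_Cons
    by (simp add: sum_bool_lists_Cons_snoc sum_bool bottom top
          del: column_Cons columns_Cons)
  also have "\<dots> = (\<Sum>ms\<in>?B. (sigma (a * y / x))\<^sup>2 * column a y rs l ms False True
          * ((prod_list (map (\<lambda>y. sigma (a * y / x)) ys))\<^sup>2 * columns a rs ys ms h))"
    using Cons by (intro sum.cong) (auto simp: column_peel simp del: column_Cons)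
  finally show ?case
    by (simp add: sum_distrib_left power_mult_distrib mult_ac)
qed auto

text \<open>
  At \<open>x\<^sub>1 = y\<^sub>1 / a\<close> the first column is frozen and after it the bottom row flows
  to the left and the top row to the right. What remains is the model without the first column and the two
  outer rows.
\<close>

lemma half_turn_even_freeze:
  assumes "length ys = Suc (length xs)" "a \<noteq> 0" "v \<noteq> 0"
  shows "half_turn_even a ((v / a) # xs) x y (v # ys)
    = (sigma (a\<^sup>2))\<^sup>2 * sigma (a * v / x) * sigma (a * v / y)
      * (prod_list (map (\<lambda>z. sigma (a * v / z)) xs))\<^sup>2 * (prod_list (map (\<lambda>z. sigma (a\<^sup>2 * z / v)) ys))\<^sup>2
      * half_turn_even a xs x y ys"
proof -
  let ?x = "v / a" and ?n = "2 * length ys"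
  let ?rs = "xs @ [x, y] @ rev xs"
  let ?Rs = "?x # ?rs @ [?x]"
  let ?B = "bool_lists ?n"
  define c where "c = (sigma (a\<^sup>2))\<^sup>2 * sigma (a * v / x) * sigma (a * v / y)
      * (prod_list (map (\<lambda>z. sigma (a * v / z)) xs))\<^sup>2"
  have n: "length ?rs = ?n" using assms by simp
  have col: "column a v ?Rs (replicate (Suc (Suc ?n)) True) (b # m @ [d]) False True
      = (if \<not> b \<and> m = replicate ?n True \<and> d then c else 0)" if "m \<in> ?B" for b m d
  proof -
    have zero: "sigma (a * (?x / v)) = 0" using assms by (simp add: sigma_def)
    have len: "length (m @ [d]) = length (?rs @ [?x])"
      using that n by simp
    have rep: "replicate (length (?rs @ [?x])) True = replicate ?n True @ [True]"
      using n by (simp add: replicate_append_same)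
    have rep': "replicate (Suc (length (?rs @ [?x]))) True = replicate (Suc (Suc ?n)) True"
      using n by simp
    have "column a v ?Rs (replicate (Suc (Suc ?n)) True) (b # m @ [d]) False True
       = (if \<not> b \<and> m @ [d] = replicate ?n True @ [True] \<and> True
          then sigma (a\<^sup>2) * prod_list (map (\<lambda>r. sigma (a * v / r)) (?rs @ [?x])) else 0)"
      using column_frozen [OF zero len, of b True, unfolded rep rep'] .
    moreover have "sigma (a\<^sup>2) * prod_list (map (\<lambda>r. sigma (a * v / r)) (?rs @ [?x])) = c"
      using assms(2,3)
      by (simp add: c_def power2_eq_square mult_ac rev_map [symmetric] prod_list.rev)
    ultimately show ?thesis by auto
  qed
  have sum_col: "columns a ?Rs (v # ys) (replicate (Suc (Suc ?n)) True) hs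
      = c * columns a ?Rs ys (False # replicate ?n True @ [True]) hs" for hs
  proof -
    have len: "length ?Rs = Suc (Suc ?n)" using n by simp
    have "columns a ?Rs (v # ys) (replicate (Suc (Suc ?n)) True) hs
       = (\<Sum>b\<in>UNIV. \<Sum>m\<in>?B. \<Sum>d\<in>UNIV. column a v ?Rs (replicate (Suc (Suc ?n)) True) (b # m @ [d]) False True
            * columns a ?Rs ys (b # m @ [d]) hs)"
      by (simp only: columns_Cons len sum_bool_lists_Cons_snoc)
    also have "\<dots> = (\<Sum>b\<in>UNIV. \<Sum>m\<in>?B. \<Sum>d\<in>UNIV. (if \<not> b \<and> m = replicate ?n True \<and> d then c else 0)
            * columns a ?Rs ys (b # m @ [d]) hs)"
      by (intro sum.cong refl arg_cong2 [where f = "(*)"] col)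
    also have "\<dots> = (\<Sum>m\<in>?B. if m = replicate ?n True then c * columns a ?Rs ys (False # m @ [True]) hs else 0)"
      unfolding sum_bool sum.distrib [symmetric] by (intro sum.cong) auto
    finally show ?thesis by simp
  qed
  have "half_turn_even a (?x # xs) x y (v # ys)
     = (\<Sum>g\<in>bool_lists (length ys). \<Sum>b\<in>UNIV. columns a ?Rs (v # ys) (replicate (Suc (Suc ?n)) True)
           (b # (g @ rev (map Not g)) @ [\<not> b]))"
    unfolding half_turn_even_def
    by (simp add: sum_bool_lists_Cons sum_bool sum.distrib del: columns_Cons replicate_Suc)
  also have "\<dots> = (\<Sum>g\<in>bool_lists (length ys). c * columns a ?Rs ys (False # replicate ?n True @ [True])
           (False # (g @ rev (map Not g)) @ [True]))"
  proof (intro sum.cong refl)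
    fix g assume "g \<in> bool_lists (length ys)"
    \<comment> \<open>a leftward flow in the bottom row cannot turn, so only the states with a leftward bottom row remain\<close>
    have "columns a ?Rs ys (False # replicate ?n True @ [True]) (True # (g @ rev (map Not g)) @ [False]) = 0"
      by (rule columns_bottom_left_flow) (use n in auto)
    then show "(\<Sum>b\<in>UNIV. columns a ?Rs (v # ys) (replicate (Suc (Suc ?n)) True)
           (b # (g @ rev (map Not g)) @ [\<not> b])) = c * columns a ?Rs ys (False # replicate ?n True @ [True])
           (False # (g @ rev (map Not g)) @ [True])"
      by (simp only: sum_bool sum_col) simp
  qed
  also have "\<dots> = (\<Sum>g\<in>bool_lists (length ys). c * ((prod_list (map (\<lambda>z. sigma (a * z / ?x)) ys))\<^sup>2
      * columns a ?rs ys (replicate ?n True) (g @ rev (map Not g))))"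
    using assms n by (intro sum.cong arg_cong2 [where f = "(*)"] refl columns_peel) auto
  finally show ?thesis
    using n assms by (simp add: c_def half_turn_even_def sum_distrib_left mult_ac power2_eq_square)
qed

section \<open>The odd model as a specialization of the even one\<close>

text \<open>
  The odd model. Here \<open>g\<close> gives the flows from the lower rows into the short column,
  \<open>h\<close> the flows that leave it on the right, and \<open>c\<close> the flow through its top
  edge, which enters the middle row from the right. So the states to the right of the long columns are
  \<open>g\<close>, then \<open>\<not> c\<close>, and then the flows of \<open>h\<close> coming back.
\<close>

definition half_turn_odd :: "complex \<Rightarrow> complex list \<Rightarrow> complex \<Rightarrow> complex \<Rightarrow> complex list \<Rightarrow> complex" where
  "half_turn_odd a xs x y ys =
     (\<Sum>h\<in>bool_lists (length xs). \<Sum>c\<in>UNIV. \<Sum>g\<in>bool_lists (length xs).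
        columns a (xs @ [x] @ rev xs) ys (replicate (Suc (2 * length xs)) True) (g @ [\<not> c] @ rev (map Not h))
        * column a y xs g h False c)"

lemma sum_reorder7:
  "(\<Sum>g\<in>G. \<Sum>v\<in>V. \<Sum>m\<in>M. \<Sum>d\<in>D. \<Sum>k\<in>K. \<Sum>w\<in>W. \<Sum>u\<in>U. f g v m d k w u)
   = (\<Sum>k\<in>K. \<Sum>m\<in>M. \<Sum>d\<in>D. \<Sum>u\<in>U. \<Sum>v\<in>V. \<Sum>w\<in>W. \<Sum>g\<in>G. (f g v m d k w u :: complex))"
  unfolding sum.cartesian_product
  by (rule sum.reindex_bij_witness [where i = "\<lambda>(k, m, d, u, v, w, g). (g, v, m, d, k, w, u)"
        and j = "\<lambda>(g, v, m, d, k, w, u). (k, m, d, u, v, w, g)"]) auto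

lemma sum_reorder5:
  "(\<Sum>k\<in>K. \<Sum>m\<in>M. \<Sum>d\<in>D. \<Sum>u\<in>U. \<Sum>g\<in>G. f g m d k u)
   = (\<Sum>g\<in>G. \<Sum>k\<in>K. \<Sum>m\<in>M. \<Sum>d\<in>D. \<Sum>u\<in>U. (f g m d k u :: complex))"
  unfolding sum.cartesian_product
  by (rule sum.reindex_bij_witness [where i = "\<lambda>(g, k, m, d, u). (k, m, d, u, g)"
        and j = "\<lambda>(k, m, d, u, g). (g, k, m, d, u)"]) auto

lemma sum_reorder3:
  "(\<Sum>g\<in>G. \<Sum>k\<in>K. \<Sum>m\<in>M. f g k m) = (\<Sum>m\<in>M. \<Sum>g\<in>G. \<Sum>k\<in>K. (f g k m :: complex))"
  unfolding sum.cartesian_product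
  by (rule sum.reindex_bij_witness [where i = "\<lambda>(m, g, k). (g, k, m)" and j = "\<lambda>(g, k, m). (m, g, k)"]) auto

lemma column_append3:
  assumes "length g = length rs" "length m = length rs"
  shows "column a u (rs @ [x] @ rest) (g @ [v] @ l) (m @ [d] @ k) False True
    = (\<Sum>w\<in>UNIV. \<Sum>w'\<in>UNIV. column a u rs g m False w * ice_weight a (x / u) v d w w' * column a u rest l k w' True)"
  using assms by (simp add: column_append sum_distrib_left mult.assoc)

text \<open>
  The exchange relation below a row whose parameter \<open>y / a\<close> makes its crossing with the
  column \<open>u\<close> a tilted vertex.
\<close>

lemma column_pass:
  assumes "a \<noteq> 0" "y \<noteq> 0" "u \<noteq> 0" "0 \<notin> set rs"
    and "length l = length rs" "length m = length rs"
  shows "(\<Sum>v\<in>UNIV. \<Sum>w\<in>UNIV. \<Sum>g\<in>bool_lists (length rs).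
            column a y rs l g False v * (column a u rs g m False w * ice_weight a (y / a / u) v d w w'))
       = sigma (a\<^sup>2 * u / y) * (\<Sum>g\<in>bool_lists (length rs). column a u rs l g False w' * column a y rs g m False d)"
proof -
  have "(\<Sum>v\<in>UNIV. \<Sum>w\<in>UNIV. \<Sum>g\<in>bool_lists (length rs).
            column a y rs l g False v * (column a u rs g m False w * ice_weight a (y / a / u) v d w w'))
     = (\<Sum>v\<in>UNIV. \<Sum>v'\<in>UNIV. (\<Sum>ms\<in>bool_lists (length rs). column a y rs l ms False v * column a u rs ms m False v')
            * ice_weight a (y / (a * u)) v d v' w')"
    by (simp add: sum_distrib_right mult.assoc)
  also have "\<dots> = sigma (a\<^sup>2 * u / y) * (\<Sum>g\<in>bool_lists (length rs). column a u rs l g False w' * column a y rs g m False d)"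
    unfolding column_exchange [OF assms]
    by (simp add: sum_bool ice_weight_def power2_eq_square mult_ac)
  finally show ?thesis .
qed

text \<open>
  On the left-hand side a line with parameter \<open>y\<close> climbs along the left side of the rows
  \<open>rs\<close> and then turns to the right, where its parameter \<open>y / a\<close> lets each
  crossing with a column serve as the tilted vertex of the Yang-Baxter equation. On the right-hand side
  the line has been carried across all columns: it climbs on the right of the rows \<open>rs\<close>.
\<close>

lemma columns_pass:
  assumes "a \<noteq> 0" "y \<noteq> 0" "0 \<notin> set ys" "0 \<notin> set rs" "length l = length rs" "length h = length rs"
    and "length k = length rest" "length h' = length rest"
  shows "(\<Sum>g\<in>bool_lists (length rs). \<Sum>v\<in>UNIV. column a y rs l g False v
            * columns a (rs @ [y / a] @ rest) ys (g @ [v] @ k) (h @ [c] @ h'))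
       = prod_list (map (\<lambda>u. sigma (a\<^sup>2 * u / y)) ys)
         * (\<Sum>g\<in>bool_lists (length rs). columns a (rs @ rest) ys (l @ k) (g @ h') * column a y rs g h False c)"
  using assms(3,5,7)
proof (induction ys arbitrary: l k)
  case Nil
  have "(\<Sum>g\<in>bool_lists (length rs). \<Sum>v\<in>UNIV. column a y rs l g False v
            * columns a (rs @ [y / a] @ rest) [] (g @ [v] @ k) (h @ [c] @ h'))
      = (\<Sum>g\<in>bool_lists (length rs). if g = h then (if k = h' then column a y rs l h False c else 0) else 0)"
    using assms(6) by (intro sum.cong) (auto simp: sum_bool)
  also have "\<dots> = (\<Sum>g\<in>bool_lists (length rs). if g = l then (if k = h' then column a y rs l h False c else 0) else 0)"
    using assms(6) Nil.prems by simp
  also have "\<dots> = (\<Sum>g\<in>bool_lists (length rs). columns a (rs @ rest) [] (l @ k) (g @ h') * column a y rs g h False c)"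
    using Nil.prems by (intro sum.cong) auto
  finally show ?case by simp
next
  case (Cons u ys)
  let ?B = "bool_lists (length rs)" and ?K = "bool_lists (length rest)"
  let ?R = "rs @ [y / a] @ rest" and ?h = "h @ [c] @ h'"
  let ?\<kappa> = "sigma (a\<^sup>2 * u / y)" and ?\<pi> = "prod_list (map (\<lambda>u. sigma (a\<^sup>2 * u / y)) ys)"
  have split: "(\<Sum>ms\<in>bool_lists (length ?R). f ms) = (\<Sum>m\<in>?B. \<Sum>d\<in>UNIV. \<Sum>k'\<in>?K. f (m @ [d] @ k'))" for f :: "_ \<Rightarrow> complex"
    using sum_bool_lists_append [where m = "length rs" and n = "Suc (length rest)" and f = f]
    by (simp add: sum_bool_lists_Cons)
  have "(\<Sum>g\<in>?B. \<Sum>v\<in>UNIV. column a y rs l g False v * columns a ?R (u # ys) (g @ [v] @ k) ?h)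
     = (\<Sum>g\<in>?B. \<Sum>v\<in>UNIV. \<Sum>m\<in>?B. \<Sum>d\<in>UNIV. \<Sum>k'\<in>?K. \<Sum>w\<in>UNIV. \<Sum>w'\<in>UNIV.
          column a y rs l g False v * (column a u rs g m False w * ice_weight a (y / a / u) v d w w')
          * (column a u rest k k' w' True * columns a ?R ys (m @ [d] @ k') ?h))"
    unfolding columns_Cons split sum_distrib_left
    by (intro sum.cong refl) (simp add: column_append3 sum_distrib_left sum_distrib_right mult_ac
          del: append_Cons append_Nil)
  also have "\<dots> = (\<Sum>k'\<in>?K. \<Sum>m\<in>?B. \<Sum>d\<in>UNIV. \<Sum>w'\<in>UNIV. \<Sum>v\<in>UNIV. \<Sum>w\<in>UNIV. \<Sum>g\<in>?B.
          column a y rs l g False v * (column a u rs g m False w * ice_weight a (y / a / u) v d w w')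
          * (column a u rest k k' w' True * columns a ?R ys (m @ [d] @ k') ?h))"
    by (rule sum_reorder7)
  also have "\<dots> = (\<Sum>k'\<in>?K. \<Sum>m\<in>?B. \<Sum>d\<in>UNIV. \<Sum>w'\<in>UNIV.
          ?\<kappa> * (\<Sum>g\<in>?B. column a u rs l g False w' * column a y rs g m False d)
          * (column a u rest k k' w' True * columns a ?R ys (m @ [d] @ k') ?h))"
    using Cons.prems assms
    by (intro sum.cong refl, simp only: sum_distrib_right [symmetric] bool_lists_iff,
        intro arg_cong2 [where f = "(*)"] refl column_pass) auto
  also have "\<dots> = ?\<kappa> * (\<Sum>k'\<in>?K. \<Sum>m\<in>?B. \<Sum>d\<in>UNIV. \<Sum>w'\<in>UNIV. \<Sum>g\<in>?B.
          column a u rs l g False w' * column a u rest k k' w' True * (column a y rs g m False d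
          * columns a ?R ys (m @ [d] @ k') ?h))"
    by (simp add: sum_distrib_left sum_distrib_right mult_ac del: append_Cons append_Nil)
  also have "\<dots> = ?\<kappa> * (\<Sum>g\<in>?B. \<Sum>k'\<in>?K. \<Sum>m\<in>?B. \<Sum>d\<in>UNIV. \<Sum>w'\<in>UNIV.
          column a u rs l g False w' * column a u rest k k' w' True * (column a y rs g m False d
          * columns a ?R ys (m @ [d] @ k') ?h))"
    by (intro arg_cong2 [where f = "(*)"] refl sum_reorder5)
  also have "\<dots> = ?\<kappa> * (\<Sum>g\<in>?B. \<Sum>k'\<in>?K. column a u (rs @ rest) (l @ k) (g @ k') False True
          * (\<Sum>m\<in>?B. \<Sum>d\<in>UNIV. column a y rs g m False d * columns a ?R ys (m @ [d] @ k') ?h))"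
    using Cons.prems
    by (intro sum.cong refl arg_cong2 [where f = "(*)"])
       (simp only: column_append bool_lists_iff sum_distrib_left sum_distrib_right)
  also have "\<dots> = ?\<kappa> * (\<Sum>g\<in>?B. \<Sum>k'\<in>?K. column a u (rs @ rest) (l @ k) (g @ k') False True
          * (?\<pi> * (\<Sum>g'\<in>?B. columns a (rs @ rest) ys (g @ k') (g' @ h') * column a y rs g' h False c)))"
    using Cons.prems by (intro sum.cong refl arg_cong2 [where f = "(*)"] Cons.IH) auto
  also have "\<dots> = ?\<kappa> * ?\<pi> * (\<Sum>g\<in>?B. \<Sum>k'\<in>?K. \<Sum>g'\<in>?B. column a u (rs @ rest) (l @ k) (g @ k') False True
          * columns a (rs @ rest) ys (g @ k') (g' @ h') * column a y rs g' h False c)"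
    by (simp add: sum_distrib_left mult_ac)
  also have "(\<Sum>g\<in>?B. \<Sum>k'\<in>?K. \<Sum>g'\<in>?B. column a u (rs @ rest) (l @ k) (g @ k') False True
          * columns a (rs @ rest) ys (g @ k') (g' @ h') * column a y rs g' h False c)
     = (\<Sum>g'\<in>?B. columns a (rs @ rest) (u # ys) (l @ k) (g' @ h') * column a y rs g' h False c)"
    by (subst sum_reorder3) (simp add: sum_bool_lists_append sum_distrib_right)
  finally show ?case by (simp add: mult.assoc)
qed

text \<open>
  At the vertex where the row \<open>y / a\<close> meets its own column one of the weights vanishes. As
  the left edge is incoming, the flow of the bottom edge is handed on to the right edge, with weight
  \<open>sigma (a\<^sup>2)\<close> for both directions, and the top edge flows upwards. Above it, the
  column is frozen.
\<close>

lemma column_turn: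
  assumes "a \<noteq> 0" "y \<noteq> 0" "length g = length rs" "length m = length rs'"
  shows "column a y (rs @ [y / a] @ rs') (replicate (length rs) True @ [True] @ replicate (length rs') True) (g @ [v] @ m) False True
    = (if m = replicate (length rs') True
       then sigma (a\<^sup>2) * prod_list (map (\<lambda>r. sigma (a * y / r)) rs') * column a y rs (replicate (length rs) True) g False v else 0)"
proof -
  have "sigma 1 = 0" by (simp add: sigma_def)
  then have "ice_weight a (y / a / y) True v w w' = (if w' \<and> v = w then sigma (a\<^sup>2) else 0)" for w w'
    using assms by (auto simp: ice_weight_def power2_eq_square)
  then show ?thesis
    unfolding column_append3 [OF length_replicate assms(3)]
    using assms column_frozen_up [of m rs' a y] by (cases v) (auto simp: sum_bool)
qed

text \<open>
  In the even model with one more column, the first column below the row \<open>v / a\<close> and this row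
  form a line that turns once. Carried to the right of the lower rows it becomes the short column of the
  odd model.
\<close>

lemma half_turn_even_turn:
  assumes "length ys = length xs" "a \<noteq> 0" "v \<noteq> 0" "0 \<notin> set xs" "0 \<notin> set ys"
  shows "half_turn_even a xs (v / a) y (v # ys)
    = sigma (a\<^sup>2) * sigma (a * v / y) * prod_list (map (\<lambda>z. sigma (a * v / z)) xs)
      * prod_list (map (\<lambda>z. sigma (a\<^sup>2 * z / v)) ys) * half_turn_odd a xs y v ys"
proof -
  let ?n = "length xs"
  let ?rs' = "[y] @ rev xs"
  let ?R = "xs @ [v / a] @ ?rs'"
  let ?B = "bool_lists ?n" and ?K = "bool_lists (Suc ?n)"
  let ?T = "\<lambda>n. replicate n True"
  define c where "c = sigma (a\<^sup>2) * prod_list (map (\<lambda>r. sigma (a * v / r)) ?rs')"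
  define \<pi> where "\<pi> = prod_list (map (\<lambda>z. sigma (a\<^sup>2 * z / v)) ys)"
  have T: "?T (2 * length (v # ys)) = ?T ?n @ [True] @ ?T (length ?rs')"
    using assms(1) by (simp add: replicate_add [symmetric] replicate_app_Cons_same mult_2)
  have split: "(\<Sum>ms\<in>bool_lists (length ?R). f ms) = (\<Sum>m\<in>?B. \<Sum>d\<in>UNIV. \<Sum>k'\<in>?K. f (m @ [d] @ k'))" for f :: "_ \<Rightarrow> complex"
    using sum_bool_lists_append [where m = ?n and n = "Suc (Suc ?n)" and f = f]
      sum_bool_lists_Cons [where n = "Suc ?n"]
    by simp
  have cols: "columns a ?R (v # ys) (?T ?n @ [True] @ ?T (length ?rs')) (h @ [d] @ [\<not> d] @ rev (map Not h))
     = c * (\<pi> * (\<Sum>g\<in>?B. columns a (xs @ [y] @ rev xs) ys (?T (Suc (2 * ?n))) (g @ [\<not> d] @ rev (map Not h)) * column a v xs g h False d))"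
    if "h \<in> ?B" for h d
  proof -
    let ?h = "h @ [d] @ [\<not> d] @ rev (map Not h)"
    have "columns a ?R (v # ys) (?T ?n @ [True] @ ?T (length ?rs')) ?h
      = (\<Sum>g\<in>?B. \<Sum>w\<in>UNIV. \<Sum>m\<in>?K. (if m = ?T (length ?rs') then c * column a v xs (?T ?n) g False w else 0)
           * columns a ?R ys (g @ [w] @ m) ?h)"
      unfolding columns_Cons split c_def
      by (intro sum.cong refl arg_cong2 [where f = "(*)"] column_turn assms) auto
    also have "\<dots> = (\<Sum>g\<in>?B. \<Sum>w\<in>UNIV. \<Sum>m\<in>?K. if m = ?T (length ?rs') then c * (column a v xs (?T ?n) g False w
           * columns a ?R ys (g @ [w] @ ?T (length ?rs')) ?h) else 0)"
      by (intro sum.cong) auto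
    also have "\<dots> = c * (\<Sum>g\<in>?B. \<Sum>w\<in>UNIV. column a v xs (?T ?n) g False w
           * columns a ?R ys (g @ [w] @ ?T (length ?rs')) ?h)"
      by (simp add: sum_distrib_left)
    also have "\<dots> = c * (\<pi> * (\<Sum>g\<in>?B. columns a (xs @ ?rs') ys (?T ?n @ ?T (length ?rs')) (g @ [\<not> d] @ rev (map Not h)) * column a v xs g h False d))"
      unfolding \<pi>_def using that assms by (subst columns_pass) auto
    also have "?T ?n @ ?T (length ?rs') = ?T (Suc (2 * ?n))"
      by (simp add: replicate_add [symmetric] replicate_app_Cons_same mult_2)
    finally show ?thesis by simp
  qed
  have "half_turn_even a xs (v / a) y (v # ys)
     = (\<Sum>h\<in>?B. \<Sum>d\<in>UNIV. columns a ?R (v # ys) (?T ?n @ [True] @ ?T (length ?rs')) (h @ [d] @ [\<not> d] @ rev (map Not h)))"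
    unfolding half_turn_even_def T
    using assms(1) sum_bool_lists_append [where m = ?n and n = "Suc 0"]
    by (simp add: sum_bool_lists_1 del: columns_Cons)
  also have "\<dots> = (\<Sum>h\<in>?B. \<Sum>d\<in>UNIV. c * (\<pi> * (\<Sum>g\<in>?B. columns a (xs @ [y] @ rev xs) ys (?T (Suc (2 * ?n))) (g @ [\<not> d] @ rev (map Not h)) * column a v xs g h False d)))"
    by (intro sum.cong refl cols)
  also have "\<dots> = c * \<pi> * half_turn_odd a xs y v ys"
    by (simp add: half_turn_odd_def sum_distrib_left mult.assoc)
  finally show ?thesis
    by (simp add: c_def \<pi>_def mult_ac rev_map [symmetric] prod_list.rev)
qed

section \<open>Dependence on one row parameter\<close>

text \<open>
  A Laurent polynomial in \<open>t\<close> with exponents between \<open>-n\<close> and \<open>n\<close>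
  and of the parity of \<open>n\<close>. For negative \<open>n\<close> only the zero function qualifies;
  this case is needed because the bounds below become negative for impossible boundary conditions.
\<close>

definition laurent_width :: "int \<Rightarrow> (complex \<Rightarrow> complex) \<Rightarrow> bool" where
  "laurent_width n f \<longleftrightarrow>
     (\<exists>p. (p \<noteq> 0 \<longrightarrow> int (degree p) \<le> n) \<and> (\<forall>t. t \<noteq> 0 \<longrightarrow> t powi n * f t = poly p (t\<^sup>2)))"

lemma laurent_width_0: "laurent_width n (\<lambda>_. 0)"
  by (auto simp: laurent_width_def intro!: exI [of _ 0])

lemma laurent_width_const: "laurent_width 0 (\<lambda>_. c)"
  by (auto simp: laurent_width_def intro!: exI [of _ "[:c:]"])

lemma laurent_width_mult:
  assumes "laurent_width m f" "laurent_width n g"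
  shows "laurent_width (m + n) (\<lambda>t. f t * g t)"
proof -
  obtain p q where p: "p \<noteq> 0 \<longrightarrow> int (degree p) \<le> m" "\<And>t. t \<noteq> 0 \<Longrightarrow> t powi m * f t = poly p (t\<^sup>2)"
    and q: "q \<noteq> 0 \<longrightarrow> int (degree q) \<le> n" "\<And>t. t \<noteq> 0 \<Longrightarrow> t powi n * g t = poly q (t\<^sup>2)"
    using assms by (auto simp: laurent_width_def)
  have "p * q \<noteq> 0 \<longrightarrow> int (degree (p * q)) \<le> m + n"
    using p(1) q(1) degree_mult_le [of p q] by auto
  moreover have "t powi (m + n) * (f t * g t) = poly (p * q) (t\<^sup>2)" if "t \<noteq> 0" for t
    using that by (simp add: p(2) [symmetric] q(2) [symmetric] power_int_add)
  ultimately show ?thesis unfolding laurent_width_def by blast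
qed

lemma laurent_width_add:
  assumes "laurent_width n f" "laurent_width n g"
  shows "laurent_width n (\<lambda>t. f t + g t)"
proof -
  obtain p q where p: "p \<noteq> 0 \<longrightarrow> int (degree p) \<le> n" "\<And>t. t \<noteq> 0 \<Longrightarrow> t powi n * f t = poly p (t\<^sup>2)"
    and q: "q \<noteq> 0 \<longrightarrow> int (degree q) \<le> n" "\<And>t. t \<noteq> 0 \<Longrightarrow> t powi n * g t = poly q (t\<^sup>2)"
    using assms by (auto simp: laurent_width_def)
  have "p + q \<noteq> 0 \<longrightarrow> int (degree (p + q)) \<le> n"
    using p(1) q(1) degree_add_le_max [of p q] by (cases "p = 0"; cases "q = 0") auto
  moreover have "t powi n * (f t + g t) = poly (p + q) (t\<^sup>2)" if "t \<noteq> 0" for t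
    using that by (simp add: p(2) [symmetric] q(2) [symmetric] distrib_left)
  ultimately show ?thesis unfolding laurent_width_def by blast
qed

lemma laurent_width_sum:
  assumes "\<And>i. i \<in> I \<Longrightarrow> laurent_width n (f i)"
  shows "laurent_width n (\<lambda>t. \<Sum>i\<in>I. f i t)"
  using assms
  by (induction I rule: infinite_finite_induct) (auto intro: laurent_width_0 laurent_width_add)

lemma laurent_width_weaken:
  assumes "laurent_width m f" "n = m + 2 * int k"
  shows "laurent_width n f"
proof -
  have "laurent_width (2 * int k) (\<lambda>t. 1)"
    unfolding laurent_width_def
  proof (intro exI [of _ "monom 1 k"] conjI allI impI)
    show "int (degree (monom (1::complex) k)) \<le> 2 * int k"
      by (simp add: degree_monom_eq)
    show "t powi (2 * int k) * 1 = poly (monom 1 k) (t\<^sup>2)" for t :: complex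
      by (simp add: poly_monom power_int_mult)
  qed
  from laurent_width_mult [OF assms(1) this] show ?thesis by (simp add: assms(2))
qed

text \<open>
  Turning vertices have a constant weight; the others have width one.
\<close>

lemma laurent_width_ice_weight:
  assumes "a \<noteq> 0" "y \<noteq> 0"
  shows "laurent_width (if l = r then 1 else 0) (\<lambda>t. ice_weight a (t / y) l r b u)"
proof -
  have "laurent_width 1 (\<lambda>t. sigma (a * (t / y)))"
    unfolding laurent_width_def
  proof (intro exI [of _ "[:- (y / a), a / y:]"] conjI allI impI)
    fix t :: complex assume "t \<noteq> 0"
    then show "t powi 1 * sigma (a * (t / y)) = poly [:- (y / a), a / y:] (t\<^sup>2)"
      using assms by (simp add: sigma_def field_simps power2_eq_square)
  qed auto
  moreover have "laurent_width 1 (\<lambda>t. sigma (a / (t / y)))"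
    unfolding laurent_width_def
  proof (intro exI [of _ "[:a * y, - 1 / (a * y):]"] conjI allI impI)
    fix t :: complex assume "t \<noteq> 0"
    then show "t powi 1 * sigma (a / (t / y)) = poly [:a * y, - 1 / (a * y):] (t\<^sup>2)"
      using assms by (simp add: sigma_def field_simps power2_eq_square)
  qed auto
  ultimately show ?thesis
    by (cases l; cases r; cases b; cases u)
       (simp_all add: ice_weight_def laurent_width_const laurent_width_0)
qed

lemma laurent_width_cmult:
  assumes "laurent_width n f" shows "laurent_width n (\<lambda>t. c * f t)"
  using laurent_width_mult [OF laurent_width_const assms] by simp

lemma laurent_width_column:
  assumes "a \<noteq> 0" "y \<noteq> 0" "length l = length rs" "length m = length rs"
  shows "laurent_width ((if l0 = m0 then 1 else 0) + (if l1 = m1 then 1 else 0))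
    (\<lambda>t. column a y (t # rs @ [t]) (l0 # l @ [l1]) (m0 # m @ [m1]) b u)"
proof -
  have eq: "column a y (t # rs @ [t]) (l0 # l @ [l1]) (m0 # m @ [m1]) b u
      = (\<Sum>v\<in>UNIV. \<Sum>w\<in>UNIV. ice_weight a (t / y) l0 m0 b v * (column a y rs l m v w * ice_weight a (t / y) l1 m1 w u))" for t
    using assms(3,4) by (cases u) (simp_all add: column_append sum_bool algebra_simps)
  show ?thesis
    unfolding eq
    by (intro laurent_width_sum laurent_width_mult laurent_width_cmult laurent_width_ice_weight assms)
qed

text \<open>
  Along a row, the number of turning vertices is at least 1 if the two ends differ, and its parity is
  determined by the ends; by the parity, larger numbers only lower the width by even amounts.
\<close>

lemma laurent_width_columns:
  assumes "a \<noteq> 0" "0 \<notin> set ys" "length l = length rs" "length h = length rs"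
  shows "laurent_width (2 * int (length ys) - (if l0 = h0 then 0 else 1) - (if l1 = h1 then 0 else 1))
    (\<lambda>t. columns a (t # rs @ [t]) ys (l0 # l @ [l1]) (h0 # h @ [h1]))"
  using assms(2,3)
proof (induction ys arbitrary: l0 l l1)
  case Nil
  show ?case
    by (cases "l0 # l @ [l1] = h0 # h @ [h1]") (auto intro: laurent_width_0 laurent_width_const)
next
  case (Cons y ys)
  have eq: "columns a (t # rs @ [t]) (y # ys) (l0 # l @ [l1]) hs
      = (\<Sum>m0\<in>UNIV. \<Sum>m\<in>bool_lists (length rs). \<Sum>m1\<in>UNIV. column a y (t # rs @ [t]) (l0 # l @ [l1]) (m0 # m @ [m1]) False True
           * columns a (t # rs @ [t]) ys (m0 # m @ [m1]) hs)" for t hs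
  proof -
    have "length (t # rs @ [t]) = Suc (Suc (length rs))" by simp
    then show ?thesis by (simp only: columns_Cons sum_bool_lists_Cons_snoc)
  qed
  show ?case
    unfolding eq
  proof (intro laurent_width_sum)
    fix m0 m m1 assume m: "m \<in> bool_lists (length rs)"
    show "laurent_width (2 * int (length (y # ys)) - (if l0 = h0 then 0 else 1) - (if l1 = h1 then 0 else 1))
        (\<lambda>t. column a y (t # rs @ [t]) (l0 # l @ [l1]) (m0 # m @ [m1]) False True
           * columns a (t # rs @ [t]) ys (m0 # m @ [m1]) (h0 # h @ [h1]))"
      \<comment> \<open>\<open>k\<close> counts the rows that change direction in this column and change back later\<close>
      by (rule laurent_width_weaken [OF laurent_width_mult [OF laurent_width_column Cons.IH],
            where k = "(if l0 \<noteq> m0 \<and> m0 \<noteq> h0 then 1 else 0) + (if l1 \<noteq> m1 \<and> m1 \<noteq> h1 then 1 else 0)"])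
         (use assms(1) Cons.prems m in auto)
  qed
qed

text \<open>
  The two outer rows have opposite flows at the right end and equal ones at the left end, so exactly one
  of them has different flows at its two ends.
\<close>

lemma laurent_width_half_turn_even:
  assumes "a \<noteq> 0" "0 \<notin> set ys" "length ys = Suc (Suc (length xs))"
  shows "laurent_width (2 * int (length ys) - 1) (\<lambda>t. half_turn_even a (t # xs) x y ys)"
proof -
  let ?rs = "xs @ [x, y] @ rev xs" and ?n = "2 * Suc (length xs)"
  have eq: "half_turn_even a (t # xs) x y ys
     = (\<Sum>b\<in>UNIV. \<Sum>g\<in>bool_lists (Suc (length xs)). columns a (t # ?rs @ [t]) ys (True # replicate ?n True @ [True])
           (b # (g @ rev (map Not g)) @ [\<not> b]))" for t
    using assms(3) unfolding half_turn_even_def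
    by (simp add: sum_bool_lists_Cons replicate_append_same)
  have w: "laurent_width (2 * int (length ys) - (if True = b then 0 else 1) - (if True = (\<not> b) then 0 else 1))
      (\<lambda>t. columns a (t # ?rs @ [t]) ys (True # replicate ?n True @ [True])
           (b # (g @ rev (map Not g)) @ [\<not> b]))" if "g \<in> bool_lists (Suc (length xs))" for b g
    by (rule laurent_width_columns) (use assms that in auto)
  show ?thesis
    unfolding eq
  proof (intro laurent_width_sum)
    fix b g assume "g \<in> bool_lists (Suc (length xs))"
    from w [OF this, of b] show "laurent_width (2 * int (length ys) - 1)
      (\<lambda>t. columns a (t # ?rs @ [t]) ys (True # replicate ?n True @ [True]) (b # (g @ rev (map Not g)) @ [\<not> b]))"
      by (cases b) (simp_all del: replicate_Suc)
  qed
qed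

section \<open>Two families of Schur functions\<close>

lemma sum_subsets_insert:
  fixes f :: "'a set \<Rightarrow> complex"
  assumes "finite J" "k \<notin> J"
  shows "(\<Sum>S | S \<subseteq> insert k J \<and> card S = Suc n. f S)
    = (\<Sum>S | S \<subseteq> J \<and> card S = n. f (insert k S)) + (\<Sum>S | S \<subseteq> J \<and> card S = Suc n. f S)"
proof -
  let ?A = "{S. S \<subseteq> J \<and> card S = n}" and ?B = "{S. S \<subseteq> J \<and> card S = Suc n}"
  have fin: "finite S" if "S \<subseteq> J" for S using assms(1) that finite_subset by blast
  have eq: "{S. S \<subseteq> insert k J \<and> card S = Suc n} = insert k ` ?A \<union> ?B"
  proof (intro subset_antisym subsetI)
    fix S assume S: "S \<in> {S. S \<subseteq> insert k J \<and> card S = Suc n}"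
    show "S \<in> insert k ` ?A \<union> ?B"
    proof (cases "k \<in> S")
      case True
      then have "S = insert k (S - {k})" "S - {k} \<in> ?A"
        using S by (auto simp: card_Diff_singleton)
      then show ?thesis by blast
    qed (use S in auto)
  next
    fix S assume "S \<in> insert k ` ?A \<union> ?B"
    then show "S \<in> {S. S \<subseteq> insert k J \<and> card S = Suc n}"
      using assms fin by (auto simp: card_insert_if subset_iff)
  qed
  have "inj_on (insert k) ?A"
    using assms(2) by (auto simp: inj_on_def)
  moreover have "insert k ` ?A \<inter> ?B = {}" using assms(2) by auto
  ultimately show ?thesis
    unfolding eq using assms(1) by (simp add: sum.union_disjoint sum.reindex)
qed

lemma prod_subsets_insert2:
  fixes f :: "'a set \<Rightarrow> complex"
  assumes "finite J" "k \<notin> J"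
  shows "(\<Prod>S | S \<subseteq> insert k J \<and> card S = 2. f S)
    = (\<Prod>S | S \<subseteq> J \<and> card S = 2. f S) * (\<Prod>j\<in>J. f {k, j})"
proof -
  let ?B = "{S. S \<subseteq> J \<and> card S = 2}"
  have fin: "finite ?B" using assms(1) by simp
  have eq: "{S. S \<subseteq> insert k J \<and> card S = 2} = ?B \<union> (\<lambda>j. {k, j}) ` J"
    using assms(2) by (auto simp: card_2_iff)
  have "inj_on (\<lambda>j. {k, j}) J"
    using assms(2) by (auto simp: inj_on_def doubleton_eq_iff)
  moreover have "?B \<inter> (\<lambda>j. {k, j}) ` J = {}" using assms(2) by auto
  ultimately show ?thesis
    unfolding eq using assms(1) fin by (simp add: prod.union_disjoint prod.reindex)
qed

text \<open>
  The Laplace expansion, divided by the Vandermonde product of the cubes, of the alternant with exponents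
  \<open>0, 3, 6, \<dots>\<close> and \<open>e, e + 3, e + 6, \<dots>\<close>, up to sign. The subset
  \<open>S\<close> takes the exponents divisible by 3. Working with a set of values makes the symmetry in
  these values evident.
\<close>

definition schur_sum :: "nat \<Rightarrow> nat \<Rightarrow> complex set \<Rightarrow> complex" where
  "schur_sum e n W = (\<Sum>S | S \<subseteq> W \<and> card S = n. \<Prod>j\<in>W - S. j ^ e * (\<Prod>i\<in>S. inverse (j ^ 3 - i ^ 3)))"

text \<open>
  The product of \<open>w\<^sup>2 + w w' + w'\<^sup>2 = (w + w')\<^sup>2 - w w'\<close> over all pairs,
  that is, the quotient of the Vandermonde products of the cubes and of the variables.
\<close>

definition pair_product :: "complex set \<Rightarrow> complex" where
  "pair_product W = (\<Prod>P | P \<subseteq> W \<and> card P = 2. (\<Sum>P)\<^sup>2 - \<Prod>P)"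

text \<open>
  For a set of \<open>2 n\<close> values, up to sign, the Schur function of \<open>(n-1, n-1, \<dots>, 1,
  1, 0, 0)\<close> for \<open>e = 1\<close>, and of \<open>(n, n-1, n-1, \<dots>, 1, 1, 0)\<close> for
  \<open>e = 2\<close>.
\<close>

definition schur :: "nat \<Rightarrow> nat \<Rightarrow> complex set \<Rightarrow> complex" where
  "schur e n W = pair_product W * schur_sum e n W"

lemma pair_product_insert:
  assumes "finite J" "t \<notin> J"
  shows "pair_product (insert t J) = pair_product J * (\<Prod>k\<in>J. t\<^sup>2 + t * k + k\<^sup>2)"
proof -
  have "(\<Sum>{t, k})\<^sup>2 - \<Prod>{t, k} = t\<^sup>2 + t * k + k\<^sup>2" if "k \<in> J" for k
    using that assms by (cases "t = k") (auto simp: power2_eq_square algebra_simps)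
  then show ?thesis
    using assms by (simp add: pair_product_def prod_subsets_insert2 cong: prod.cong)
qed

text \<open>
  The two sums collect the subsets with and without \<open>t\<close>.
\<close>

lemma schur_sum_insert:
  fixes e n J t
  defines "A \<equiv> \<lambda>S. \<Prod>j\<in>J - S. j ^ e * (\<Prod>i\<in>S. inverse (j ^ 3 - i ^ 3))"
  assumes "finite J" "t \<notin> J"
  shows "schur_sum e (Suc n) (insert t J)
    = (\<Sum>S | S \<subseteq> J \<and> card S = n. A S * (\<Prod>j\<in>J - S. inverse (j ^ 3 - t ^ 3)))
      + (\<Sum>S | S \<subseteq> J \<and> card S = Suc n. A S * (t ^ e * (\<Prod>i\<in>S. inverse (t ^ 3 - i ^ 3))))"
proof -
  have fin: "finite S" if "S \<subseteq> J" for S using assms(2) that finite_subset by blast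
  have 1: "(\<Prod>j\<in>insert t J - insert t S. j ^ e * (\<Prod>i\<in>insert t S. inverse (j ^ 3 - i ^ 3)))
        = A S * (\<Prod>j\<in>J - S. inverse (j ^ 3 - t ^ 3))" if "S \<subseteq> J" for S
  proof -
    have "insert t J - insert t S = J - S" "t \<notin> S" using assms(3) that by auto
    then show ?thesis using fin [OF that] by (simp add: A_def prod.distrib mult_ac)
  qed
  have 2: "(\<Prod>j\<in>insert t J - S. j ^ e * (\<Prod>i\<in>S. inverse (j ^ 3 - i ^ 3)))
        = A S * (t ^ e * (\<Prod>i\<in>S. inverse (t ^ 3 - i ^ 3)))" if "S \<subseteq> J" for S
  proof -
    have "insert t J - S = insert t (J - S)" using assms(3) that by auto
    then show ?thesis using assms(2,3) by (simp add: A_def mult_ac)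
  qed
  show ?thesis
    unfolding schur_sum_def sum_subsets_insert [OF assms(2,3)]
    by (intro arg_cong2 [where f = "(+)"] sum.cong refl) (use 1 2 in auto)
qed

lemma inverse_diff_mult:
  assumes "x \<noteq> y"
  shows "inverse (x - y) * (y - x) = (- 1 :: complex)"
proof -
  have "inverse (x - y) * (y - x) = - (inverse (x - y) * (x - y))"
    by (simp only: mult_minus_right [symmetric] minus_diff_eq)
  then show ?thesis using assms by simp
qed

text \<open>
  Clearing the denominators in \<open>t\<close> gives a polynomial \<open>Q\<close>. At \<open>t = \<zeta>
  k\<close> with \<open>\<zeta>\<^sup>3 = 1\<close>, only those subsets contribute that separate
  \<open>t\<close> from \<open>k\<close>. Exchanging the two changes the sign and the factor
  \<open>\<zeta>\<^sup>e\<close>, so the contributions combine to the factor \<open>\<zeta>\<^sup>e -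
  1\<close> times the same sum without \<open>t\<close> and \<open>k\<close>. For \<open>\<zeta> =
  1\<close> this says that \<open>Q\<close> vanishes at all points of \<open>J\<close>.
\<close>

lemma schur_sum_polynomial:
  assumes "finite J" "card J = 2 * n + 1" "inj_on (\<lambda>w. w ^ 3) J"
  obtains Q where "degree Q \<le> 3 * n + e"
    "\<And>t. t ^ 3 \<notin> (\<lambda>w. w ^ 3) ` J \<Longrightarrow> schur_sum e (Suc n) (insert t J) * (\<Prod>k\<in>J. t ^ 3 - k ^ 3) = poly Q t"
    "\<And>k \<zeta>. k \<in> J \<Longrightarrow> \<zeta> ^ 3 = 1 \<Longrightarrow> poly Q (\<zeta> * k) = (-1) ^ n * (\<zeta> ^ e - 1) * k ^ e * schur_sum e n (J - {k})"
proof
  define A where "A = (\<lambda>S. \<Prod>j\<in>J - S. j ^ e * (\<Prod>i\<in>S. inverse (j ^ 3 - i ^ 3)))"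
  define c where "c = (\<lambda>k. monom 1 3 - [:k ^ 3:] :: complex poly)"
  have c: "poly (c k) t = t ^ 3 - k ^ 3" for k t by (simp add: c_def poly_monom)
  have deg_c: "degree (c k) \<le> 3" for k
    unfolding c_def by (rule degree_diff_le) (auto simp: degree_monom_eq)
  have fin: "finite S" if "S \<subseteq> J" for S using assms(1) that finite_subset by blast
  have deg_prod: "degree (\<Prod>k\<in>S. c k) \<le> 3 * card S" if "S \<subseteq> J" for S
  proof -
    have "degree (\<Prod>k\<in>S. c k) \<le> sum (degree \<circ> c) S" by (rule degree_prod_sum_le) (use fin that in auto)
    also have "\<dots> \<le> sum (\<lambda>_. 3) S" using deg_c by (intro sum_mono) auto
    finally show ?thesis by simp
  qed
  \<comment> \<open>the first sum comes from the subsets containing \<open>t\<close>, where \<open>n + 1\<close> factors \<open>j\<^sup>3 - t\<^sup>3\<close> have to be turned round\<close>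
  define Q where "Q = (-1) ^ Suc n * (\<Sum>S | S \<subseteq> J \<and> card S = n. smult (A S) (\<Prod>k\<in>S. c k))
     + monom 1 e * (\<Sum>S | S \<subseteq> J \<and> card S = Suc n. smult (A S) (\<Prod>k\<in>J - S. c k))"
  have card_compl: "card (J - S) = 2 * n + 1 - card S" if "S \<subseteq> J" for S
    using assms(1,2) that by (simp add: card_Diff_subset fin)
  show "degree Q \<le> 3 * n + e"
  proof -
    have "degree (\<Sum>S | S \<subseteq> J \<and> card S = n. smult (A S) (\<Prod>k\<in>S. c k)) \<le> 3 * n"
      by (rule degree_sum_le)
        (use assms(1) deg_prod in \<open>auto intro!: order_trans [OF degree_smult_le]\<close>)
    moreover have "degree ((-1) ^ Suc n * p) = degree p" for p :: "complex poly"
      by (cases "even n") auto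
    moreover have "degree (\<Sum>S | S \<subseteq> J \<and> card S = Suc n. smult (A S) (\<Prod>k\<in>J - S. c k)) \<le> 3 * n"
    proof (rule degree_sum_le)
      fix S assume "S \<in> {S. S \<subseteq> J \<and> card S = Suc n}"
      then show "degree (smult (A S) (\<Prod>k\<in>J - S. c k)) \<le> 3 * n"
        using deg_prod [of "J - S"] card_compl [of S] by (auto intro!: order_trans [OF degree_smult_le])
    qed (use assms(1) in simp)
    moreover have "degree (monom 1 e * p) \<le> 3 * n + e" if "degree p \<le> 3 * n" for p :: "complex poly"
      using that degree_mult_le [of "monom 1 e" p] by (simp add: degree_monom_eq)
    ultimately show ?thesis unfolding Q_def
      by (intro degree_add_le) auto
  qed
  have Q: "poly Q t = (-1) ^ Suc n * (\<Sum>S | S \<subseteq> J \<and> card S = n. A S * (\<Prod>k\<in>S. t ^ 3 - k ^ 3))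
     + t ^ e * (\<Sum>S | S \<subseteq> J \<and> card S = Suc n. A S * (\<Prod>k\<in>J - S. t ^ 3 - k ^ 3))" for t
    by (simp add: Q_def poly_sum poly_prod c poly_monom)
  show "schur_sum e (Suc n) (insert t J) * (\<Prod>k\<in>J. t ^ 3 - k ^ 3) = poly Q t"
    if t: "t ^ 3 \<notin> (\<lambda>w. w ^ 3) ` J" for t
  proof -
    have "t \<notin> J" using t by auto
    have nz: "t ^ 3 - k ^ 3 \<noteq> 0" if "k \<in> J" for k using t that by auto
    have split: "(\<Prod>k\<in>J. t ^ 3 - k ^ 3) = (\<Prod>k\<in>S. t ^ 3 - k ^ 3) * (\<Prod>k\<in>J - S. t ^ 3 - k ^ 3)" if "S \<subseteq> J" for S
      using prod.subset_diff [OF that assms(1)] by (simp add: mult.commute)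
    have 1: "A S * (\<Prod>j\<in>J - S. inverse (j ^ 3 - t ^ 3)) * (\<Prod>k\<in>J. t ^ 3 - k ^ 3)
         = (-1) ^ Suc n * (A S * (\<Prod>k\<in>S. t ^ 3 - k ^ 3))" if "S \<subseteq> J" "card S = n" for S
    proof -
      have "(\<Prod>j\<in>J - S. inverse (j ^ 3 - t ^ 3)) * (\<Prod>k\<in>J - S. t ^ 3 - k ^ 3) = (\<Prod>j\<in>J - S. - 1)"
        unfolding prod.distrib [symmetric]
      proof (rule prod.cong [OF refl])
        fix x assume "x \<in> J - S"
        then have "x ^ 3 \<noteq> t ^ 3" using t by (metis DiffD1 imageI)
        then show "inverse (x ^ 3 - t ^ 3) * (t ^ 3 - x ^ 3) = - 1" by (rule inverse_diff_mult)
      qed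
      also have "\<dots> = (-1) ^ Suc n" using card_compl [OF that(1)] that(2) by simp
      finally have eq: "(\<Prod>j\<in>J - S. inverse (j ^ 3 - t ^ 3)) * (\<Prod>k\<in>J - S. t ^ 3 - k ^ 3) = (-1) ^ Suc n" .
      show ?thesis
        unfolding split [OF that(1)] eq [symmetric] by (simp only: mult_ac)
    qed
    have 2: "A S * (t ^ e * (\<Prod>i\<in>S. inverse (t ^ 3 - i ^ 3))) * (\<Prod>k\<in>J. t ^ 3 - k ^ 3)
         = t ^ e * (A S * (\<Prod>k\<in>J - S. t ^ 3 - k ^ 3))" if "S \<subseteq> J" for S
    proof -
      have eq: "(\<Prod>i\<in>S. inverse (t ^ 3 - i ^ 3)) * (\<Prod>k\<in>S. t ^ 3 - k ^ 3) = 1"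
        unfolding prod.distrib [symmetric]
        by (rule prod.neutral) (use nz that in auto)
      have "A S * (t ^ e * (\<Prod>i\<in>S. inverse (t ^ 3 - i ^ 3))) * (\<Prod>k\<in>J. t ^ 3 - k ^ 3)
         = ((\<Prod>i\<in>S. inverse (t ^ 3 - i ^ 3)) * (\<Prod>k\<in>S. t ^ 3 - k ^ 3)) * (t ^ e * (A S * (\<Prod>k\<in>J - S. t ^ 3 - k ^ 3)))"
        unfolding split [OF that] by (simp only: mult_ac)
      then show ?thesis by (simp only: eq mult_1)
    qed
    have ins: "schur_sum e (Suc n) (insert t J)
      = (\<Sum>S | S \<subseteq> J \<and> card S = n. A S * (\<Prod>j\<in>J - S. inverse (j ^ 3 - t ^ 3)))
        + (\<Sum>S | S \<subseteq> J \<and> card S = Suc n. A S * (t ^ e * (\<Prod>i\<in>S. inverse (t ^ 3 - i ^ 3))))"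
      unfolding A_def by (rule schur_sum_insert [OF assms(1) \<open>t \<notin> J\<close>])
    show ?thesis
      unfolding Q ins sum_distrib_left sum_distrib_right distrib_right
      by (intro arg_cong2 [where f = "(+)"] sum.cong refl; elim CollectE conjE; (rule 1 | rule 2); assumption)
  qed
  show "poly Q (\<zeta> * k) = (-1) ^ n * (\<zeta> ^ e - 1) * k ^ e * schur_sum e n (J - {k})"
    if k: "k \<in> J" and \<zeta>: "\<zeta> ^ 3 = 1" for k \<zeta>
  proof -
    define K where "K = J - {k}"
    have J: "J = insert k K" "k \<notin> K" "finite K" "card K = 2 * n" using k assms(1,2) by (auto simp: K_def)
    define B where "B = (\<lambda>S. \<Prod>j\<in>K - S. j ^ e * (\<Prod>i\<in>S. inverse (j ^ 3 - i ^ 3)))"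
    have nz: "k ^ 3 - j ^ 3 \<noteq> 0" if "j \<in> K" for j
      using assms(3) that k by (auto simp: K_def inj_on_def)
    have nz': "j ^ 3 \<noteq> k ^ 3" if "j \<in> K" for j using nz [OF that] by auto
    have cube: "(\<zeta> * k) ^ 3 = k ^ 3" by (simp add: power_mult_distrib \<zeta>)
    have 1: "A S * (\<Prod>i\<in>S. k ^ 3 - i ^ 3) = k ^ e * B S" if "S \<subseteq> K" for S
    proof -
      have "J - S = insert k (K - S)" using J that by auto
      then have "A S = k ^ e * (\<Prod>i\<in>S. inverse (k ^ 3 - i ^ 3)) * B S"
        using J by (simp add: A_def B_def)
      moreover have "(\<Prod>i\<in>S. inverse (k ^ 3 - i ^ 3)) * (\<Prod>i\<in>S. k ^ 3 - i ^ 3) = 1"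
        unfolding prod.distrib [symmetric] by (rule prod.neutral) (use nz that in auto)
      ultimately show ?thesis by (simp add: mult_ac)
    qed
    have 2: "A (insert k S) * (\<Prod>j\<in>J - insert k S. k ^ 3 - j ^ 3) = (-1) ^ n * B S" if "S \<subseteq> K" "card S = n" for S
    proof -
      have finS: "finite S" and kS: "k \<notin> S" using J that finite_subset by auto
      have KS: "J - insert k S = K - S" using J by auto
      have "A (insert k S) = (\<Prod>j\<in>K - S. inverse (j ^ 3 - k ^ 3)) * B S"
        using finS kS by (simp add: A_def B_def KS prod.distrib mult_ac)
      moreover have "(\<Prod>j\<in>K - S. inverse (j ^ 3 - k ^ 3)) * (\<Prod>j\<in>K - S. k ^ 3 - j ^ 3) = (\<Prod>j\<in>K - S. - 1)"
        unfolding prod.distrib [symmetric] by (intro prod.cong refl inverse_diff_mult nz') auto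
      moreover have "card (K - S) = n" using J that finS by (simp add: card_Diff_subset)
      ultimately show ?thesis unfolding KS by (simp add: mult_ac)
    qed
    have "(\<Sum>S | S \<subseteq> J \<and> card S = n. A S * (\<Prod>i\<in>S. k ^ 3 - i ^ 3))
        = (\<Sum>S | S \<subseteq> K \<and> card S = n. A S * (\<Prod>i\<in>S. k ^ 3 - i ^ 3))"
    proof (rule sum.mono_neutral_right)
      show "\<forall>S\<in>{S. S \<subseteq> J \<and> card S = n} - {S. S \<subseteq> K \<and> card S = n}. A S * (\<Prod>i\<in>S. k ^ 3 - i ^ 3) = 0"
      proof
        fix S assume "S \<in> {S. S \<subseteq> J \<and> card S = n} - {S. S \<subseteq> K \<and> card S = n}"
        then have "k \<in> S" "finite S" using J fin by auto
        then show "A S * (\<Prod>i\<in>S. k ^ 3 - i ^ 3) = 0" by auto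
      qed
    qed (use J assms(1) in auto)
    also have "\<dots> = k ^ e * schur_sum e n K"
      unfolding schur_sum_def B_def [symmetric] sum_distrib_left by (rule sum.cong) (use 1 in auto)
    finally have first: "(\<Sum>S | S \<subseteq> J \<and> card S = n. A S * (\<Prod>i\<in>S. k ^ 3 - i ^ 3)) = k ^ e * schur_sum e n K" .
    have "(\<Sum>S | S \<subseteq> J \<and> card S = Suc n. A S * (\<Prod>j\<in>J - S. k ^ 3 - j ^ 3))
        = (\<Sum>S | S \<subseteq> K \<and> card S = n. A (insert k S) * (\<Prod>j\<in>J - insert k S. k ^ 3 - j ^ 3))
          + (\<Sum>S | S \<subseteq> K \<and> card S = Suc n. A S * (\<Prod>j\<in>J - S. k ^ 3 - j ^ 3))"
      using sum_subsets_insert [OF J(3,2), where f = "\<lambda>S. A S * (\<Prod>j\<in>J - S. k ^ 3 - j ^ 3)"] by (simp add: J(1) [symmetric])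
    also have "(\<Sum>S | S \<subseteq> K \<and> card S = Suc n. A S * (\<Prod>j\<in>J - S. k ^ 3 - j ^ 3)) = 0"
    proof (rule sum.neutral, rule ballI)
      fix S assume "S \<in> {S. S \<subseteq> K \<and> card S = Suc n}"
      then have "k \<in> J - S" using J k by auto
      then have "(\<Prod>j\<in>J - S. k ^ 3 - j ^ 3) = 0" using assms(1) by (intro prod_zero) auto
      then show "A S * (\<Prod>j\<in>J - S. k ^ 3 - j ^ 3) = 0" by simp
    qed
    also have "(\<Sum>S | S \<subseteq> K \<and> card S = n. A (insert k S) * (\<Prod>j\<in>J - insert k S. k ^ 3 - j ^ 3)) = (-1) ^ n * schur_sum e n K"
      unfolding schur_sum_def B_def [symmetric] sum_distrib_left by (rule sum.cong) (use 2 in auto)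
    finally have second: "(\<Sum>S | S \<subseteq> J \<and> card S = Suc n. A S * (\<Prod>j\<in>J - S. k ^ 3 - j ^ 3)) = (-1) ^ n * schur_sum e n K"
      by simp
    show ?thesis
      unfolding Q cube first second K_def [symmetric] by (simp add: power_mult_distrib algebra_simps)
  qed
qed

lemma poly_dvd_roots:
  fixes Q :: "complex poly"
  assumes "finite J" "\<And>k. k \<in> J \<Longrightarrow> poly Q k = 0"
  shows "(\<Prod>k\<in>J. [:- k, 1:]) dvd Q"
  using assms
proof (induction J rule: finite_induct)
  case (insert k J)
  then obtain q where q: "Q = (\<Prod>k\<in>J. [:- k, 1:]) * q" by (auto elim: dvdE)
  have "poly (\<Prod>k\<in>J. [:- k, 1:]) k \<noteq> 0"
    using insert.hyps by (auto simp: poly_prod)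
  then have "poly q k = 0" using insert.prems [of k] q by simp
  then have "[:- k, 1:] dvd q" by (simp add: poly_eq_0_iff_dvd)
  then have "[:- k, 1:] * (\<Prod>k\<in>J. [:- k, 1:]) dvd q * (\<Prod>k\<in>J. [:- k, 1:])"
    by (rule mult_dvd_mono) simp
  then show ?case
    unfolding q prod.insert [OF insert.hyps] by (simp only: mult.commute [of _ q])
qed simp

text \<open>
  The roots of \<open>Q\<close> in \<open>J\<close> remove the remaining denominators and lower the degree
  to that of a Schur function. The value at \<open>\<zeta> k\<close> for a primitive cube root of unity
  \<open>\<zeta>\<close> is the recursion that is to be matched with the freezing of the model.
\<close>

lemma schur_polynomial:
  assumes "finite J" "card J = 2 * n + 1" "inj_on (\<lambda>w. w ^ 3) J"
  obtains q where "degree q \<le> n + e - 1"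
    "\<And>t. t ^ 3 \<notin> (\<lambda>w. w ^ 3) ` J \<Longrightarrow> schur e (Suc n) (insert t J) = poly q t"
    "\<And>k \<zeta>. k \<in> J \<Longrightarrow> \<zeta>\<^sup>2 + \<zeta> + 1 = 0 \<Longrightarrow> (\<zeta> - 1) * k * poly q (\<zeta> * k)
       = (-1) ^ n * (\<zeta> ^ e - 1) * k ^ e * (\<Prod>j\<in>J - {k}. \<zeta>\<^sup>2 * k - j) * schur e n (J - {k})"
proof -
  obtain Q where Q: "degree Q \<le> 3 * n + e"
    "\<And>t. t ^ 3 \<notin> (\<lambda>w. w ^ 3) ` J \<Longrightarrow> schur_sum e (Suc n) (insert t J) * (\<Prod>k\<in>J. t ^ 3 - k ^ 3) = poly Q t"
    "\<And>k \<zeta>. k \<in> J \<Longrightarrow> \<zeta> ^ 3 = 1 \<Longrightarrow> poly Q (\<zeta> * k) = (-1) ^ n * (\<zeta> ^ e - 1) * k ^ e * schur_sum e n (J - {k})"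
    using schur_sum_polynomial [OF assms] by blast
  have "poly Q k = 0" if "k \<in> J" for k using Q(3) [OF that, of 1] by simp
  from poly_dvd_roots [OF assms(1) this] obtain q where q: "Q = (\<Prod>k\<in>J. [:- k, 1:]) * q"
    by (auto elim: dvdE)
  have "degree q \<le> n + e - 1"
  proof (cases "q = 0")
    case False
    have "degree (\<Prod>k\<in>J. [:- k, 1:]) = card J"
      by (subst degree_prod_eq_sum_degree) auto
    moreover have "(\<Prod>k\<in>J. [:- k, 1:]) \<noteq> 0" using assms(1) by auto
    ultimately have "degree Q = card J + degree q"
      using False by (simp add: q degree_mult_eq)
    then show ?thesis using Q(1) assms(2) by simp
  qed simp
  have poly_q: "poly Q t = (\<Prod>k\<in>J. t - k) * poly q t" for t
    by (simp add: q poly_prod)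
  show ?thesis
  proof (rule that [of "smult (pair_product J) q"])
    show "degree (smult (pair_product J) q) \<le> n + e - 1"
      using \<open>degree q \<le> n + e - 1\<close> degree_smult_le order_trans by blast
    show "schur e (Suc n) (insert t J) = poly (smult (pair_product J) q) t"
      if t: "t ^ 3 \<notin> (\<lambda>w. w ^ 3) ` J" for t
    proof -
      have "t \<notin> J" using t by auto
      have nz: "(\<Prod>k\<in>J. t - k) \<noteq> 0" using t assms(1) by auto
      have "(\<Prod>k\<in>J. t ^ 3 - k ^ 3) = (\<Prod>k\<in>J. t - k) * (\<Prod>k\<in>J. t\<^sup>2 + t * k + k\<^sup>2)"
        unfolding prod.distrib [symmetric]
        by (rule prod.cong) (auto simp: power2_eq_square power3_eq_cube algebra_simps)
      then have "(\<Prod>k\<in>J. t - k) * (schur_sum e (Suc n) (insert t J) * (\<Prod>k\<in>J. t\<^sup>2 + t * k + k\<^sup>2))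
          = (\<Prod>k\<in>J. t - k) * poly q t"
        using Q(2) [OF t] by (simp add: poly_q mult_ac)
      then have "schur_sum e (Suc n) (insert t J) * (\<Prod>k\<in>J. t\<^sup>2 + t * k + k\<^sup>2) = poly q t"
        using nz by simp
      then show ?thesis
        by (simp add: schur_def pair_product_insert [OF assms(1) \<open>t \<notin> J\<close>] mult_ac)
    qed
    show "(\<zeta> - 1) * k * poly (smult (pair_product J) q) (\<zeta> * k)
       = (-1) ^ n * (\<zeta> ^ e - 1) * k ^ e * (\<Prod>j\<in>J - {k}. \<zeta>\<^sup>2 * k - j) * schur e n (J - {k})"
      if k: "k \<in> J" and \<zeta>: "\<zeta>\<^sup>2 + \<zeta> + 1 = 0" for k \<zeta>
    proof -
      define K where "K = J - {k}"
      have J: "J = insert k K" "k \<notin> K" "finite K" using k assms(1) by (auto simp: K_def)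
      have \<zeta>2: "\<zeta>\<^sup>2 = - \<zeta> - 1" using \<zeta> by (metis add.assoc add_eq_0_iff2 minus_add_distrib diff_conv_add_uminus)
      have \<zeta>3: "\<zeta> ^ 3 = 1"
      proof -
        have "\<zeta> ^ 3 - 1 = (\<zeta> - 1) * (\<zeta>\<^sup>2 + \<zeta> + 1)" by (simp add: power2_eq_square power3_eq_cube algebra_simps)
        then show ?thesis using \<zeta> by simp
      qed
      have "k\<^sup>2 + k * j + j\<^sup>2 = (\<zeta> * k - j) * (\<zeta>\<^sup>2 * k - j)" for j
      proof -
        have "(\<zeta> * k - j) * (\<zeta>\<^sup>2 * k - j) = \<zeta> ^ 3 * k\<^sup>2 - (\<zeta> + \<zeta>\<^sup>2) * k * j + j\<^sup>2"
          by (simp add: power2_eq_square power3_eq_cube algebra_simps)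
        then show ?thesis by (simp add: \<zeta>2 \<zeta>3)
      qed
      then have "pair_product J = pair_product K * ((\<Prod>j\<in>K. \<zeta> * k - j) * (\<Prod>j\<in>K. \<zeta>\<^sup>2 * k - j))"
        unfolding J(1) pair_product_insert [OF J(3,2)] by (simp add: prod.distrib)
      moreover have "(\<Prod>j\<in>J. \<zeta> * k - j) = (\<zeta> - 1) * k * (\<Prod>j\<in>K. \<zeta> * k - j)"
        using J by (simp add: algebra_simps)
      ultimately have "(\<zeta> - 1) * k * poly (smult (pair_product J) q) (\<zeta> * k)
         = pair_product K * (\<Prod>j\<in>K. \<zeta>\<^sup>2 * k - j) * poly Q (\<zeta> * k)"
        by (simp add: poly_q mult_ac)
      then show ?thesis
        by (simp add: Q(3) [OF k \<zeta>3] schur_def K_def mult_ac)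
    qed
  qed
qed

section \<open>The even model at a sixth root of unity\<close>

text \<open>
  The part of the closed formula that depends on the variables other than \<open>x\<close> and
  \<open>y\<close>, given by the set \<open>W\<close> of their squares.
\<close>

definition schur_pair :: "nat \<Rightarrow> complex \<Rightarrow> complex \<Rightarrow> complex set \<Rightarrow> complex" where
  "schur_pair n x y W =
     x * (schur 1 n (insert (x\<^sup>2) W) * schur 2 n (insert (y\<^sup>2) W))
   + y * (schur 2 n (insert (x\<^sup>2) W) * schur 1 n (insert (y\<^sup>2) W))"

lemma schur_doubleton:
  assumes "x ^ 3 \<noteq> w ^ 3"
  shows "schur 1 1 {x, w} = 1" "schur 2 1 {x, w} = x + w"
proof -
  have "x \<noteq> w" using assms by auto
  have S: "{S. S \<subseteq> {w} \<and> card S = 0} = {{}}" "{S. S \<subseteq> {w} \<and> card S = 1} = {{w}}"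
    by (auto simp: card_eq_0_iff finite_subset subset_singleton_iff)
  have P: "{P. P \<subseteq> {w} \<and> card P = 2} = {}"
    by (auto simp: subset_singleton_iff)
  have "schur_sum e 1 {x, w} = w ^ e * inverse (w ^ 3 - x ^ 3) + x ^ e * inverse (x ^ 3 - w ^ 3)" for e
    using schur_sum_insert [of "{w}" x e 0] \<open>x \<noteq> w\<close> S by simp
  moreover have "inverse (w ^ 3 - x ^ 3) = - inverse (x ^ 3 - w ^ 3)"
    by (simp only: inverse_minus_eq [symmetric] minus_diff_eq)
  ultimately have sum: "schur_sum e 1 {x, w} = (x ^ e - w ^ e) * inverse (x ^ 3 - w ^ 3)" for e
    by (simp add: algebra_simps)
  have pp: "pair_product {x, w} = x\<^sup>2 + x * w + w\<^sup>2"
    using pair_product_insert [of "{w}" x] \<open>x \<noteq> w\<close> by (simp add: pair_product_def P)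
  have nz: "x ^ 3 - w ^ 3 \<noteq> 0" using assms by simp
  have "(x\<^sup>2 + x * w + w\<^sup>2) * (x - w) = x ^ 3 - w ^ 3"
    by (simp add: power2_eq_square power3_eq_cube algebra_simps)
  then have *: "(x\<^sup>2 + x * w + w\<^sup>2) * ((x - w) * inverse (x ^ 3 - w ^ 3)) = 1"
    using nz by (simp add: mult.assoc [symmetric])
  show "schur 1 1 {x, w} = 1"
    unfolding schur_def sum pp using * by simp
  have "schur 2 1 {x, w} = (x\<^sup>2 + x * w + w\<^sup>2) * ((x - w) * inverse (x ^ 3 - w ^ 3)) * (x + w)"
    unfolding schur_def sum pp by (simp add: power2_eq_square algebra_simps)
  then show "schur 2 1 {x, w} = x + w" by (simp add: *)
qed

text \<open>
  The equation \<open>a\<^sup>2 = a - 1\<close> characterizes the two primitive sixth roots of unity,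
  \<open>exp (i \<pi> / 3)\<close> and its inverse. This form of the hypothesis lets statements be used
  for \<open>a\<close> and \<open>1 / a\<close> alike.
\<close>

lemma sixth_root_facts:
  fixes a :: complex
  assumes "a\<^sup>2 = a - 1"
  shows "a \<noteq> 0" "a ^ 3 = - 1" "inverse a = 1 - a" "(inverse a)\<^sup>2 = inverse a - 1"
    "(sigma (a\<^sup>2))\<^sup>2 = - 3" "sigma (a\<^sup>2) \<noteq> 0" "a ^ 6 = 1"
proof -
  show a0: "a \<noteq> 0" using assms by auto
  show a3: "a ^ 3 = - 1" using assms by (simp add: power3_eq_cube power2_eq_square left_diff_distrib)
  have "(a ^ 3) ^ 2 = a ^ 6" by (simp only: power_mult [symmetric]) simp
  then show "a ^ 6 = 1" by (simp add: a3)
  have "a * (1 - a) = 1" using assms by (simp add: power2_eq_square algebra_simps)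
  then show inv: "inverse a = 1 - a" by (rule inverse_unique)
  show "(inverse a)\<^sup>2 = inverse a - 1" unfolding inv using assms by (simp add: power2_eq_square algebra_simps)
  have "1 / a\<^sup>2 = - a" using a0 a3 by (simp add: field_simps power2_eq_square power3_eq_cube)
  then have s: "sigma (a\<^sup>2) = 2 * a - 1" using assms by (simp add: sigma_def)
  show "(sigma (a\<^sup>2))\<^sup>2 = - 3"
    unfolding s power2_diff using assms by (simp add: power_mult_distrib)
  then show "sigma (a\<^sup>2) \<noteq> 0" by auto
qed

lemma sigma_inverse: "sigma (inverse t) = - sigma t"
  by (simp add: sigma_def field_simps)

lemma sigma_uminus: "sigma (- t) = - sigma t"
  by (simp add: sigma_def)

text \<open>
  This identity is the reason for the choice of \<open>a\<close>: it makes the factors that come from the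
  columns and from the rows of the same shape.
\<close>

lemma sigma_sixth_root:
  assumes "a\<^sup>2 = a - 1"
  shows "sigma (a\<^sup>2 * z / v) = sigma (a * v / z)"
proof -
  have "a\<^sup>2 = - inverse a"
    using sixth_root_facts(3) [OF assms] assms by simp
  then have "a\<^sup>2 * z / v = - inverse (a * v / z)" by (simp add: divide_inverse mult_ac)
  then show ?thesis by (simp only: sigma_uminus sigma_inverse minus_minus)
qed

text \<open>
  Both freezing points in one formula: \<open>b = a\<close> is \<open>half_turn_even_freeze\<close>, and
  \<open>b = 1 / a\<close> is its mirror image. All signs cancel because every factor occurs twice.
\<close>

lemma half_turn_even_freeze_sixth_root:
  assumes "a\<^sup>2 = a - 1" "length ys = Suc (length xs)" "v \<noteq> 0" "b = a \<or> b = inverse a"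
  shows "half_turn_even a ((v / b) # xs) x y (v # ys)
    = - 3 * (sigma (b * v / x) * sigma (b * v / y)) * (prod_list (map (\<lambda>z. sigma (b * v / z)) (xs @ ys)))\<^sup>2
      * half_turn_even a xs x y ys"
  using assms(4)
proof
  note a = sixth_root_facts [OF assms(1)]
  assume "b = a"
  then show ?thesis
    using half_turn_even_freeze [OF assms(2) a(1) assms(3), of x y]
    by (simp only: a(5) sigma_sixth_root [OF assms(1)]) (simp add: power_mult_distrib mult_ac)
next
  note a = sixth_root_facts [OF assms(1)]
  assume b: "b = inverse a"
  have neg: "(prod_list (map (\<lambda>z. - f z) zs))\<^sup>2 = (prod_list (map f zs))\<^sup>2" for f :: "complex \<Rightarrow> complex" and zs
    by (induction zs) (simp_all add: power_mult_distrib)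
  have s: "sigma (a * inverse v / inverse z) = - sigma (b * v / z)" for z
    unfolding sigma_inverse [symmetric] b by (simp add: field_simps)
  have "half_turn_even a ((v / b) # xs) x y (v # ys)
     = half_turn_even a ((inverse v / a) # map inverse xs) (inverse y) (inverse x) (inverse v # map inverse ys)"
    using half_turn_even_reflect [of "v # ys" "(v / b) # xs" a y x] assms(2)
    by (simp add: b divide_inverse mult_ac)
  also have "\<dots> = - 3 * (sigma (b * v / x) * sigma (b * v / y)) * (prod_list (map (\<lambda>z. sigma (b * v / z)) (xs @ ys)))\<^sup>2
      * half_turn_even a (map inverse xs) (inverse y) (inverse x) (map inverse ys)"
    using half_turn_even_freeze [of "map inverse ys" "map inverse xs" a "inverse v" "inverse y" "inverse x"] assms(2,3) a(1)
    by (simp only: length_map a(5) sigma_sixth_root [OF assms(1)] list.map map_map comp_def s neg)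
       (simp add: a(5) power_mult_distrib mult_ac)
  also have "half_turn_even a (map inverse xs) (inverse y) (inverse x) (map inverse ys) = half_turn_even a xs x y ys"
    by (rule half_turn_even_reflect [OF assms(2)])
  finally show ?thesis .
qed

text \<open>
  The two states of the model of size 1, compared with Schur functions in two variables.
\<close>

lemma half_turn_even_base:
  assumes "a\<^sup>2 = a - 1" "x \<noteq> 0" "y \<noteq> 0" "v \<noteq> 0" "(x\<^sup>2) ^ 3 \<noteq> (v\<^sup>2) ^ 3" "(y\<^sup>2) ^ 3 \<noteq> (v\<^sup>2) ^ 3"
  shows "(x + y) * v * (x * y) * half_turn_even a [] x y [v]
     = sigma (a\<^sup>2) * a * (x + a * y) * schur_pair 1 x y {v\<^sup>2}"
proof -
  note a = sixth_root_facts [OF assms(1)]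
  have e: "half_turn_even a [] x y [v] = sigma (a\<^sup>2) * (sigma (a * x / v) + sigma (a * v / y))"
    by (simp add: half_turn_even_def numeral_2_eq_2 sum_bool_lists_Cons sum_bool_lists_1 sum_bool ice_weight_def algebra_simps)
  have "(x + y) * v * (x * y) * (sigma (a * x / v) + sigma (a * v / y)) = a * (x + a * y) * schur_pair 1 x y {v\<^sup>2}"
  proof -
    have "1 / a = 1 - a" using a(3) by (simp add: inverse_eq_divide)
    then have s: "sigma (a * x / v) = a * x / v - (1 - a) * v / x" "sigma (a * v / y) = a * v / y - (1 - a) * y / v"
      by (simp_all add: sigma_def) (metis divide_divide_eq_left times_divide_eq_left mult_1)+
    have "(x + y) * v * (x * y) * (sigma (a * x / v) + sigma (a * v / y))
       = (x + y) * (a * x\<^sup>2 * y - (1 - a) * v\<^sup>2 * y + a * v\<^sup>2 * x - (1 - a) * y\<^sup>2 * x)"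
      using assms(2-4) by (simp add: s field_simps power2_eq_square)
    also have "\<dots> = a * (x + a * y) * (x * (y\<^sup>2 + v\<^sup>2) + y * (x\<^sup>2 + v\<^sup>2))"
    proof -
      have aa: "a * a = a - 1" using assms(1) by (simp add: power2_eq_square)
      have "a * (x + a * y) = a * x + (a - 1) * y" by (simp add: aa [symmetric] algebra_simps)
      then show ?thesis by (simp add: power2_eq_square) (simp add: algebra_simps)
    qed
    finally show ?thesis using schur_doubleton [OF assms(5)] schur_doubleton [OF assms(6)]
      by (simp add: schur_pair_def)
  qed
  then show ?thesis unfolding e by (simp add: mult_ac)
qed

text \<open>
  The sixth powers are the cubes of the squares, at which the Schur functions are evaluated.
\<close>

definition generic :: "complex list \<Rightarrow> bool" where
  "generic zs \<longleftrightarrow> 0 \<notin> set zs \<and> distinct (map (\<lambda>z. z ^ 6) zs)"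

lemma generic_inj:
  assumes "generic zs"
  shows "inj_on (\<lambda>w. w ^ 3) ((\<lambda>z. z\<^sup>2) ` set zs)" "inj_on (\<lambda>z. z\<^sup>2) (set zs)" "distinct zs"
proof -
  have *: "inj_on (\<lambda>z. z ^ 6) (set zs)" and d: "distinct zs"
    using assms by (auto simp: generic_def distinct_map)
  have "(z\<^sup>2) ^ 3 = z ^ 6" for z :: complex by (simp only: power_mult [symmetric]) simp
  then have "inj_on ((\<lambda>w. w ^ 3) \<circ> (\<lambda>z. z\<^sup>2)) (set zs)" using * by (simp add: comp_def)
  then show "inj_on (\<lambda>w. w ^ 3) ((\<lambda>z. z\<^sup>2) ` set zs)" "inj_on (\<lambda>z. z\<^sup>2) (set zs)"
    by (rule inj_on_imageI, rule inj_on_imageI2)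
  show "distinct zs" by (rule d)
qed

lemma generic_squares:
  assumes "generic zs"
  shows "(\<Prod>k\<in>(\<lambda>z. z\<^sup>2) ` set zs. f k) = prod_list (map (\<lambda>z. f (z\<^sup>2)) zs)"
    "card ((\<lambda>z. z\<^sup>2) ` set zs) = length zs"
  using generic_inj [OF assms]
  by (simp_all add: prod.reindex card_image distinct_card prod.distinct_set_conv_list)

lemma generic_mset:
  assumes "generic xs" "mset xs = mset ys"
  shows "generic ys"
proof -
  have "mset (map (\<lambda>z. z ^ 6) xs) = mset (map (\<lambda>z. z ^ 6) ys)" using assms(2) by simp
  then show ?thesis using assms mset_eq_setD [OF assms(2)] mset_eq_imp_distinct_iff
    unfolding generic_def by metis
qed

text \<open>
  The left-hand side of the closed formula at an interpolation point, evaluated by freezing and the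
  formula for the next smaller size.
\<close>

lemma half_turn_even_at_root:
  assumes a: "a\<^sup>2 = a - 1" "b = a \<or> b = inverse a"
    and len: "length ys = Suc (Suc (length xs))" and v: "v \<in> set ys"
    and g: "generic (x # xs @ ys)" "generic (y # xs @ ys)"
    and IH: "\<And>us. length us = Suc (length xs) \<Longrightarrow> generic (x # xs @ us) \<Longrightarrow> generic (y # xs @ us) \<Longrightarrow>
       (x + y) * prod_list (xs @ us) ^ (2 * length xs + 1) * (x * y) ^ Suc (length xs) * half_turn_even a xs x y us
       = sigma (a\<^sup>2) * a * (-3) ^ length xs * (x + a * y) * schur_pair (Suc (length xs)) x y ((\<lambda>z. z\<^sup>2) ` set (xs @ us))"
  shows "(x + y) * (v / b * prod_list (xs @ ys)) ^ (2 * length xs + 3) * (x * y) ^ Suc (Suc (length xs))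
         * half_turn_even a ((v / b) # xs) x y ys
       = sigma (a\<^sup>2) * a * (-3) ^ Suc (length xs) * (x + a * y) * (v\<^sup>2 / b)
         * ((b\<^sup>2 * v\<^sup>2 - x\<^sup>2) * (b\<^sup>2 * v\<^sup>2 - y\<^sup>2) * (prod_list (map (\<lambda>z. b\<^sup>2 * v\<^sup>2 - z\<^sup>2) (xs @ remove1 v ys)))\<^sup>2)
         * schur_pair (Suc (length xs)) x y ((\<lambda>z. z\<^sup>2) ` set (xs @ remove1 v ys))"
proof -
  note a' = sixth_root_facts [OF a(1)]
  have b: "b\<^sup>2 = b - 1" using a a'(4) by auto
  note b' = sixth_root_facts [OF b]
  obtain us ws where ys: "ys = us @ v # ws" and "v \<notin> set us" using v by (meson split_list_first)
  then have rem: "remove1 v ys = us @ ws" by (simp add: remove1_append)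
  define zs where "zs = xs @ us @ ws"
  have nz: "x \<noteq> 0" "y \<noteq> 0" "v \<noteq> 0" "0 \<notin> set zs" using g ys by (auto simp: generic_def zs_def)
  have gm: "generic (x # zs)" "generic (y # zs)" "v \<notin> set zs"
    using g ys by (auto simp: generic_def zs_def)
  have lenzs: "length zs = 2 * length xs + 1" using len ys by (simp add: zs_def)
  \<comment> \<open>genericity allows the column with parameter \<open>v\<close> to be moved to the front\<close>
  have u: "sigma (a\<^sup>2 * v / u) \<noteq> 0" if "u \<in> set us" for u
  proof
    assume 0: "sigma (a\<^sup>2 * v / u) = 0"
    have u0: "u \<noteq> 0" using that nz by (auto simp: zs_def)
    let ?t = "a\<^sup>2 * v / u"
    have "?t \<noteq> 0" using u0 nz a' by simp
    then have "?t\<^sup>2 = 1" using 0 by (simp add: sigma_def field_simps power2_eq_square)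
    then have "(?t\<^sup>2) ^ 3 = 1" by simp
    moreover have "(?t\<^sup>2) ^ 3 = (a ^ 6)\<^sup>2 * v ^ 6 / u ^ 6"
      by (simp add: power_mult_distrib power_divide flip: power_mult)
    ultimately have "v ^ 6 = u ^ 6" using u0 a'(7) by simp
    then show False using g(1) that ys by (auto simp: generic_def)
  qed
  have "half_turn_even a ((v / b) # xs) x y ys = half_turn_even a ((v / b) # xs) x y (v # us @ ws)"
    unfolding ys by (rule half_turn_even_move_to_front) (use a' b' nz u len ys in \<open>auto simp: zs_def\<close>)
  also have "\<dots> = - 3 * (sigma (b * v / x) * sigma (b * v / y)) * (prod_list (map (\<lambda>z. sigma (b * v / z)) zs))\<^sup>2
      * half_turn_even a xs x y (us @ ws)"
    unfolding zs_def by (rule half_turn_even_freeze_sixth_root) (use a nz len ys in auto)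
  finally have E: "half_turn_even a ((v / b) # xs) x y ys = \<dots>" .
  have sig: "sigma (b * v / z) = (b\<^sup>2 * v\<^sup>2 - z\<^sup>2) / (b * v * z)" if "z \<noteq> 0" for z
    using that nz b'(1) by (simp add: sigma_def field_simps power2_eq_square)
  have prod: "prod_list (map (\<lambda>z. sigma (b * v / z)) zs)
      = prod_list (map (\<lambda>z. b\<^sup>2 * v\<^sup>2 - z\<^sup>2) zs) / ((b * v) ^ (2 * length xs + 1) * prod_list zs)"
    unfolding lenzs [symmetric] using nz(4)
    by (induction zs) (auto simp: sig)
  define p P F where "p = prod_list zs" and "P = prod_list (map (\<lambda>z. b\<^sup>2 * v\<^sup>2 - z\<^sup>2) zs)"
    and "F = half_turn_even a xs x y (us @ ws)"
  have p0: "p \<noteq> 0" using nz(4) by (simp add: p_def prod_list_zero_iff)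
  have vp: "prod_list (xs @ ys) = v * p" by (simp add: ys p_def zs_def mult_ac)
  let ?m = "length xs"
  have b6: "b ^ (6 * k) = 1" for k by (simp add: power_mult b'(7))
  have "(x + y) * (v / b * prod_list (xs @ ys)) ^ (2 * ?m + 3) * (x * y) ^ Suc (Suc ?m) * half_turn_even a ((v / b) # xs) x y ys
     = ((x + y) * p ^ (2 * ?m + 1) * (x * y) ^ Suc ?m * F) * (- 3) * (v\<^sup>2 / b)
        * ((b\<^sup>2 * v\<^sup>2 - x\<^sup>2) * (b\<^sup>2 * v\<^sup>2 - y\<^sup>2) * P\<^sup>2)"
  proof -
    define pm vm bm xm where "pm = p ^ (2 * ?m + 1)" and "vm = v ^ (2 * ?m + 1)"
      and "bm = b ^ (2 * ?m + 1)" and "xm = (x * y) ^ Suc ?m"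
    have nz': "pm \<noteq> 0" "vm \<noteq> 0" "bm \<noteq> 0" "xm \<noteq> 0"
      using p0 nz b'(1) by (simp_all add: pm_def vm_def bm_def xm_def)
    have "b ^ (4 * ?m + 3) * b ^ (2 * ?m + 3) = 1"
      using b6 [of "Suc ?m"] unfolding power_add [symmetric] by (simp add: algebra_simps)
    moreover have "b ^ (4 * ?m + 3) = bm\<^sup>2 * b"
    proof -
      have "4 * ?m + 3 = (2 * ?m + 1) * 2 + 1" by simp
      then show ?thesis by (simp only: bm_def power_add power_mult power_one_right)
    qed
    ultimately have "1 / b ^ (2 * ?m + 3) = bm\<^sup>2 * b"
      using b'(1) by (simp add: field_simps)
    moreover have "(v * (v * p)) ^ (2 * ?m + 3) = (pm * p\<^sup>2) * (vm\<^sup>2 * v ^ 4)"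
      by (simp add: pm_def vm_def power_mult_distrib flip: power_mult)
        (simp add: power_add [symmetric] mult_ac add.assoc numeral_eq_Suc power_mult_distrib flip: power_mult)
    moreover have "(v / b * (v * p)) ^ (2 * ?m + 3) = (v * (v * p)) ^ (2 * ?m + 3) * (1 / b ^ (2 * ?m + 3))"
      by (simp add: power_divide)
    ultimately have A: "(v / b * (v * p)) ^ (2 * ?m + 3) = (pm * p\<^sup>2) * (vm\<^sup>2 * v ^ 4) * (bm\<^sup>2 * b)"
      by (simp only:)
    have B: "(b * v) ^ (2 * ?m + 1) = bm * vm" by (simp add: bm_def vm_def power_mult_distrib)
    have C: "(x * y) ^ Suc (Suc ?m) = xm * (x * y)" by (simp add: xm_def)
    show ?thesis
      unfolding E prod vp p_def [symmetric] P_def [symmetric] F_def [symmetric] A B C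
        sig [OF nz(1)] sig [OF nz(2)] pm_def [symmetric] xm_def [symmetric]
      using nz p0 nz' b'(1) by (simp add: field_simps power2_eq_square numeral_eq_Suc)
  qed
  also have "(x + y) * p ^ (2 * ?m + 1) * (x * y) ^ Suc ?m * F
     = sigma (a\<^sup>2) * a * (-3) ^ ?m * (x + a * y) * schur_pair (Suc ?m) x y ((\<lambda>z. z\<^sup>2) ` set (xs @ us @ ws))"
    unfolding p_def zs_def F_def
    by (rule IH) (use gm len ys in \<open>auto simp: zs_def\<close>)
  finally show ?thesis
    by (simp add: rem P_def zs_def mult_ac)
qed

text \<open>
  The right-hand side of the closed formula as a polynomial in one of the squares, and its value at the
  interpolation points \<open>w / b\<^sup>2\<close>. Since \<open>b\<^sup>3 = - 1\<close>, the number
  \<open>1 / b\<^sup>2 = - b\<close> is a primitive cube root of unity.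
\<close>

lemma schur_pair_polynomial:
  assumes "card W = 2 * n" "finite W" "x\<^sup>2 \<notin> W" "y\<^sup>2 \<notin> W"
    and "inj_on (\<lambda>w. w ^ 3) (insert (x\<^sup>2) W)" "inj_on (\<lambda>w. w ^ 3) (insert (y\<^sup>2) W)"
  obtains q where "degree q \<le> 2 * n + 1"
    "\<And>t. t ^ 3 \<notin> (\<lambda>w. w ^ 3) ` (insert (x\<^sup>2) (insert (y\<^sup>2) W)) \<Longrightarrow> schur_pair (Suc n) x y (insert t W) = poly q t"
    "\<And>w b. w \<in> W \<Longrightarrow> w \<noteq> 0 \<Longrightarrow> b\<^sup>2 = b - 1 \<Longrightarrow>
       poly q (w / b\<^sup>2) = w / b * ((b\<^sup>2 * w - x\<^sup>2) * (b\<^sup>2 * w - y\<^sup>2) * (\<Prod>j\<in>W - {w}. b\<^sup>2 * w - j)\<^sup>2)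
         * schur_pair n x y (W - {w})"
proof -
  let ?X = "insert (x\<^sup>2) W" and ?Y = "insert (y\<^sup>2) W"
  have fX: "finite ?X" and fY: "finite ?Y" using assms by auto
  have cX: "card ?X = 2 * n + 1" and cY: "card ?Y = 2 * n + 1" using assms by auto
  obtain f1 where f1: "degree f1 \<le> n + 1 - 1"
    "\<And>t. t ^ 3 \<notin> (\<lambda>w. w ^ 3) ` ?X \<Longrightarrow> schur 1 (Suc n) (insert t ?X) = poly f1 t"
    "\<And>k \<zeta>. k \<in> ?X \<Longrightarrow> \<zeta>\<^sup>2 + \<zeta> + 1 = 0 \<Longrightarrow> (\<zeta> - 1) * k * poly f1 (\<zeta> * k)
       = (-1) ^ n * (\<zeta> ^ 1 - 1) * k ^ 1 * (\<Prod>j\<in>?X - {k}. \<zeta>\<^sup>2 * k - j) * schur 1 n (?X - {k})"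
    using schur_polynomial [OF fX cX assms(5)] by blast
  obtain f2 where f2: "degree f2 \<le> n + 2 - 1"
    "\<And>t. t ^ 3 \<notin> (\<lambda>w. w ^ 3) ` ?X \<Longrightarrow> schur 2 (Suc n) (insert t ?X) = poly f2 t"
    "\<And>k \<zeta>. k \<in> ?X \<Longrightarrow> \<zeta>\<^sup>2 + \<zeta> + 1 = 0 \<Longrightarrow> (\<zeta> - 1) * k * poly f2 (\<zeta> * k)
       = (-1) ^ n * (\<zeta> ^ 2 - 1) * k ^ 2 * (\<Prod>j\<in>?X - {k}. \<zeta>\<^sup>2 * k - j) * schur 2 n (?X - {k})"
    using schur_polynomial [OF fX cX assms(5)] by blast
  obtain g1 where g1: "degree g1 \<le> n + 1 - 1"
    "\<And>t. t ^ 3 \<notin> (\<lambda>w. w ^ 3) ` ?Y \<Longrightarrow> schur 1 (Suc n) (insert t ?Y) = poly g1 t"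
    "\<And>k \<zeta>. k \<in> ?Y \<Longrightarrow> \<zeta>\<^sup>2 + \<zeta> + 1 = 0 \<Longrightarrow> (\<zeta> - 1) * k * poly g1 (\<zeta> * k)
       = (-1) ^ n * (\<zeta> ^ 1 - 1) * k ^ 1 * (\<Prod>j\<in>?Y - {k}. \<zeta>\<^sup>2 * k - j) * schur 1 n (?Y - {k})"
    using schur_polynomial [OF fY cY assms(6)] by blast
  obtain g2 where g2: "degree g2 \<le> n + 2 - 1"
    "\<And>t. t ^ 3 \<notin> (\<lambda>w. w ^ 3) ` ?Y \<Longrightarrow> schur 2 (Suc n) (insert t ?Y) = poly g2 t"
    "\<And>k \<zeta>. k \<in> ?Y \<Longrightarrow> \<zeta>\<^sup>2 + \<zeta> + 1 = 0 \<Longrightarrow> (\<zeta> - 1) * k * poly g2 (\<zeta> * k)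
       = (-1) ^ n * (\<zeta> ^ 2 - 1) * k ^ 2 * (\<Prod>j\<in>?Y - {k}. \<zeta>\<^sup>2 * k - j) * schur 2 n (?Y - {k})"
    using schur_polynomial [OF fY cY assms(6)] by blast
  show ?thesis
  proof (rule that [of "smult x (f1 * g2) + smult y (f2 * g1)"])
    have "degree (f1 * g2) \<le> 2 * n + 1" "degree (f2 * g1) \<le> 2 * n + 1"
      using degree_mult_le [of f1 g2] degree_mult_le [of f2 g1] f1(1) f2(1) g1(1) g2(1) by auto
    then show "degree (smult x (f1 * g2) + smult y (f2 * g1)) \<le> 2 * n + 1"
      by (intro degree_add_le) (auto intro: order_trans [OF degree_smult_le])
    show "schur_pair (Suc n) x y (insert t W) = poly (smult x (f1 * g2) + smult y (f2 * g1)) t"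
      if "t ^ 3 \<notin> (\<lambda>w. w ^ 3) ` (insert (x\<^sup>2) (insert (y\<^sup>2) W))" for t
      using f1(2) [of t] f2(2) [of t] g1(2) [of t] g2(2) [of t] that
      by (simp add: schur_pair_def insert_commute)
    show "poly (smult x (f1 * g2) + smult y (f2 * g1)) (w / b\<^sup>2)
        = w / b * ((b\<^sup>2 * w - x\<^sup>2) * (b\<^sup>2 * w - y\<^sup>2) * (\<Prod>j\<in>W - {w}. b\<^sup>2 * w - j)\<^sup>2)
         * schur_pair n x y (W - {w})"
      if w: "w \<in> W" "w \<noteq> 0" and b: "b\<^sup>2 = b - 1" for w b
    proof -
      note b' = sixth_root_facts [OF b]
      let ?P = "\<Prod>j\<in>W - {w}. b\<^sup>2 * w - j"
      have t: "w / b\<^sup>2 = - b * w"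
      proof -
        have "(- b * w) * b\<^sup>2 = - (b ^ 3) * w" by (simp add: power2_eq_square power3_eq_cube)
        then show ?thesis using b'(1,2) by (simp add: nonzero_divide_eq_eq)
      qed
      have root: "(- b)\<^sup>2 + - b + 1 = 0" using b by simp
      have nz: "- b - 1 \<noteq> 0"
      proof
        assume "- b - 1 = 0"
        then have "b = - 1" by (simp add: eq_neg_iff_add_eq_0 add.commute minus_equation_iff)
        then show False using b by simp
      qed
      have sq: "(- b) ^ 2 - 1 = (- b - 1) * (1 - b)" by (simp add: power2_eq_square algebra_simps)
      have X: "?X - {w} = insert (x\<^sup>2) (W - {w})" and Y: "?Y - {w} = insert (y\<^sup>2) (W - {w})"
        using w assms(3,4) by auto
      have PX: "(\<Prod>j\<in>insert (x\<^sup>2) (W - {w}). (- b)\<^sup>2 * w - j) = (b\<^sup>2 * w - x\<^sup>2) * ?P"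
        and PY: "(\<Prod>j\<in>insert (y\<^sup>2) (W - {w}). (- b)\<^sup>2 * w - j) = (b\<^sup>2 * w - y\<^sup>2) * ?P"
        using assms(2-4) by simp_all
      have cancel: "poly h (- b * w) = c" if "(- b - 1) * w * poly h (- b * w) = (- b - 1) * w * c" for h c
        using that nz w(2) by (simp only: mult_cancel_left) auto
      have f1w: "poly f1 (- b * w) = (-1) ^ n * ((b\<^sup>2 * w - x\<^sup>2) * ?P) * schur 1 n (insert (x\<^sup>2) (W - {w}))"
        by (rule cancel, subst f1(3) [of w "- b", OF _ root, unfolded X PX power_one_right]) (use w in simp, simp only: mult_ac)
      have g1w: "poly g1 (- b * w) = (-1) ^ n * ((b\<^sup>2 * w - y\<^sup>2) * ?P) * schur 1 n (insert (y\<^sup>2) (W - {w}))"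
        by (rule cancel, subst g1(3) [of w "- b", OF _ root, unfolded Y PY power_one_right]) (use w in simp, simp only: mult_ac)
      have f2w: "poly f2 (- b * w) = (-1) ^ n * (1 - b) * w * ((b\<^sup>2 * w - x\<^sup>2) * ?P) * schur 2 n (insert (x\<^sup>2) (W - {w}))"
        by (rule cancel, subst f2(3) [of w "- b", OF _ root, unfolded X PX sq power2_eq_square [of w]]) (use w in simp, simp only: mult_ac)
      have g2w: "poly g2 (- b * w) = (-1) ^ n * (1 - b) * w * ((b\<^sup>2 * w - y\<^sup>2) * ?P) * schur 2 n (insert (y\<^sup>2) (W - {w}))"
        by (rule cancel, subst g2(3) [of w "- b", OF _ root, unfolded Y PY sq power2_eq_square [of w]]) (use w in simp, simp only: mult_ac)
      have wb: "w / b = w * (1 - b)" using b'(3) by (simp add: divide_inverse)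
      have "(-1) ^ n * (-1) ^ n = (1::complex)" by (simp flip: power_mult_distrib)
      then have sign: "((-1) ^ n * c) * ((-1) ^ n * d) = c * d" for c d :: complex
        by (metis mult.assoc mult.left_commute mult_1)
      show ?thesis
        unfolding t schur_pair_def poly_add poly_smult poly_mult f1w f2w g1w g2w wb mult.assoc sign
        by (simp add: power2_eq_square algebra_simps)
    qed
  qed
qed

text \<open>
  The closed formula, by induction on the size. As functions of the square of the first row parameter,
  both sides are polynomials of degree at most \<open>2 N - 1\<close> that agree at \<open>2 N\<close>
  points. The factor \<open>(-3) ^ length xs\<close> comes from the two vertices of weight \<open>sigma
  (a\<^sup>2)\<close> in which the frozen column meets the two outer rows.
\<close>

theorem half_turn_even_schur:
  assumes a: "a\<^sup>2 = a - 1" and "length ys = Suc (length xs)"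
    and "generic (x # xs @ ys)" "generic (y # xs @ ys)"
  shows "(x + y) * prod_list (xs @ ys) ^ (2 * length xs + 1) * (x * y) ^ Suc (length xs) * half_turn_even a xs x y ys
       = sigma (a\<^sup>2) * a * (-3) ^ length xs * (x + a * y) * schur_pair (Suc (length xs)) x y ((\<lambda>z. z\<^sup>2) ` set (xs @ ys))"
  using assms(2-4)
proof (induction xs arbitrary: ys)
  case Nil
  then obtain v where ys: "ys = [v]" by (auto simp: length_Suc_conv)
  have "(t\<^sup>2) ^ 3 = t ^ 6" for t :: complex by (simp only: power_mult [symmetric]) simp
  then show ?case using half_turn_even_base [OF a, of x y v] Nil.prems
    by (simp add: ys generic_def)
next
  case (Cons z xs)
  let ?m = "length xs"
  let ?W = "(\<lambda>z. z\<^sup>2) ` set (xs @ ys)"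
  note a' = sixth_root_facts [OF a]
  have len: "length ys = Suc (Suc ?m)" using Cons.prems by simp
  have sq3: "(t\<^sup>2) ^ 3 = t ^ 6" for t :: complex by (simp only: power_mult [symmetric]) simp
  have g: "generic (x # xs @ ys)" "generic (y # xs @ ys)" using Cons.prems by (auto simp: generic_def)
  have gW: "generic (xs @ ys)" using g by (simp add: generic_def)
  have nz: "x \<noteq> 0" "y \<noteq> 0" "z \<noteq> 0" "0 \<notin> set xs" "0 \<notin> set ys" using Cons.prems by (auto simp: generic_def)
  have cardW: "card ?W = 2 * Suc ?m" using generic_squares(2) [OF gW] len by simp
  have notin: "t\<^sup>2 \<notin> ?W" if "generic (t # xs @ ys)" for t
  proof
    assume "t\<^sup>2 \<in> ?W"
    then obtain u where u: "u \<in> set (xs @ ys)" "t\<^sup>2 = u\<^sup>2" by auto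
    then have "t ^ 6 = u ^ 6" using sq3 [of t] sq3 [of u] by simp
    then show False using that u(1) by (auto simp: generic_def)
  qed
  have inj: "inj_on (\<lambda>w. w ^ 3) (insert (t\<^sup>2) ?W)" if "generic (t # xs @ ys)" for t
    using generic_inj(1) [OF that] by simp
  obtain q where q: "degree q \<le> 2 * Suc ?m + 1"
    "\<And>t. t ^ 3 \<notin> (\<lambda>w. w ^ 3) ` (insert (x\<^sup>2) (insert (y\<^sup>2) ?W)) \<Longrightarrow> schur_pair (Suc (Suc ?m)) x y (insert t ?W) = poly q t"
    "\<And>w b. w \<in> ?W \<Longrightarrow> w \<noteq> 0 \<Longrightarrow> b\<^sup>2 = b - 1 \<Longrightarrow>
       poly q (w / b\<^sup>2) = w / b * ((b\<^sup>2 * w - x\<^sup>2) * (b\<^sup>2 * w - y\<^sup>2) * (\<Prod>j\<in>?W - {w}. b\<^sup>2 * w - j)\<^sup>2)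
         * schur_pair (Suc ?m) x y (?W - {w})"
    using schur_pair_polynomial [OF cardW _ notin [OF g(1)] notin [OF g(2)] inj [OF g(1)] inj [OF g(2)]] by blast
  obtain p where p: "p \<noteq> 0 \<longrightarrow> int (degree p) \<le> 2 * int (length ys) - 1"
    "\<And>t. t \<noteq> 0 \<Longrightarrow> t powi (2 * int (length ys) - 1) * half_turn_even a (t # xs) x y ys = poly p (t\<^sup>2)"
    using laurent_width_half_turn_even [OF a'(1) nz(5) len, of x y] by (auto simp: laurent_width_def)
  have e: "2 * int (length ys) - 1 = int (2 * ?m + 3)" using len by simp
  have p_deg: "degree p \<le> 2 * ?m + 3" using p(1) unfolding e by (cases "p = 0") auto
  have p_eval: "poly p (t\<^sup>2) = t ^ (2 * ?m + 3) * half_turn_even a (t # xs) x y ys" if "t \<noteq> 0" for t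
    using p(2) [OF that] unfolding e power_int_of_nat by simp
  define L where "L = smult ((x + y) * prod_list (xs @ ys) ^ (2 * ?m + 3) * (x * y) ^ Suc (Suc ?m)) p"
  define R where "R = smult (sigma (a\<^sup>2) * a * (-3) ^ Suc ?m * (x + a * y)) q"
  \<comment> \<open>the interpolation points: two for each column\<close>
  define A where "A = (\<lambda>(b, v). (v / b)\<^sup>2) ` ({a, inverse a} \<times> set ys)"
  have "L = R"
  proof (rule poly_eqI_degree [where A = A])
    fix t assume "t \<in> A"
    then obtain b v where b: "b = a \<or> b = inverse a" and v: "v \<in> set ys" and t: "t = (v / b)\<^sup>2"
      by (auto simp: A_def)
    have b2: "b\<^sup>2 = b - 1" using b a a'(4) by auto
    have v0: "v \<noteq> 0" using v nz by auto
    have b0: "b \<noteq> 0" using b a' by auto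
    define zs where "zs = xs @ remove1 v ys"
    have ms: "mset (xs @ ys) = mset (v # zs)" using v by (simp add: zs_def)
    have gz: "generic (v # zs)" using generic_mset [OF gW ms] .
    then have gz': "generic zs" by (simp add: generic_def)
    have W: "?W = insert (v\<^sup>2) ((\<lambda>z. z\<^sup>2) ` set zs)" using mset_eq_setD [OF ms] by simp
    have "v\<^sup>2 \<notin> (\<lambda>z. z\<^sup>2) ` set zs" using generic_inj(2) [OF gz] generic_inj(3) [OF gz] by (auto simp: inj_on_def)
    then have W': "?W - {v\<^sup>2} = (\<lambda>z. z\<^sup>2) ` set zs" unfolding W by auto
    have "poly L t = (x + y) * (v / b * prod_list (xs @ ys)) ^ (2 * ?m + 3) * (x * y) ^ Suc (Suc ?m)
         * half_turn_even a ((v / b) # xs) x y ys"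
      using v0 b0 unfolding L_def t poly_smult by (subst p_eval) (simp_all only: power_mult_distrib mult_ac divide_eq_0_iff simp_thms)
    also have "\<dots> = sigma (a\<^sup>2) * a * (-3) ^ Suc ?m * (x + a * y) * (v\<^sup>2 / b)
         * ((b\<^sup>2 * v\<^sup>2 - x\<^sup>2) * (b\<^sup>2 * v\<^sup>2 - y\<^sup>2) * (prod_list (map (\<lambda>z. b\<^sup>2 * v\<^sup>2 - z\<^sup>2) zs))\<^sup>2)
         * schur_pair (Suc ?m) x y ((\<lambda>z. z\<^sup>2) ` set zs)"
      unfolding zs_def by (rule half_turn_even_at_root [OF a b len v g Cons.IH])
    also have "\<dots> = poly R t"
      using q(3) [of "v\<^sup>2" b] v v0 b2
      unfolding R_def t poly_smult power_divide W' generic_squares(1) [OF gz'] by (simp add: mult_ac)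
    finally show "poly L t = poly R t" .
  next
    have "inj_on (\<lambda>(b, v). (v / b)\<^sup>2) ({a, inverse a} \<times> set ys)"
    proof (rule inj_onI, clarify)
      fix b v b' v' assume b: "b \<in> {a, inverse a}" "b' \<in> {a, inverse a}" and v: "v \<in> set ys" "v' \<in> set ys"
        and eq: "(v / b)\<^sup>2 = (v' / b')\<^sup>2"
      have b2: "b\<^sup>2 = b - 1" "b'\<^sup>2 = b' - 1" using b a a'(4) by auto
      have "v ^ 6 = ((v / b)\<^sup>2) ^ 3" unfolding sq3 by (simp add: power_divide sixth_root_facts(7) [OF b2(1)])
      also have "\<dots> = v' ^ 6" unfolding eq sq3 by (simp add: power_divide sixth_root_facts(7) [OF b2(2)])
      finally have "v = v'" using gW v by (auto simp: generic_def distinct_map inj_on_def)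
      moreover have "v \<noteq> 0" "b \<noteq> 0" "b' \<noteq> 0" using v nz b a'(1) by auto
      ultimately have "b\<^sup>2 = b'\<^sup>2" using eq by (simp add: power_divide)
      then show "b = b' \<and> v = v'" using b2 \<open>v = v'\<close> by simp
    qed
    then have "card A = card {a, inverse a} * card (set ys)"
      unfolding A_def by (simp add: card_image card_cartesian_product)
    moreover have "a \<noteq> inverse a"
    proof
      assume "a = inverse a"
      then have "a * a = 1" using a'(1) by (metis right_inverse)
      then have "a = 2" using a by (simp add: power2_eq_square)
      then show False using \<open>a * a = 1\<close> by simp
    qed
    ultimately have "card A = 2 * ?m + 4"
      using generic_inj(3) [OF gW] len by (simp add: distinct_card)
    moreover have "degree L \<le> 2 * ?m + 3" "degree R \<le> 2 * ?m + 3"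
      unfolding L_def R_def using p_deg q(1) by (auto intro: order_trans [OF degree_smult_le])
    ultimately show "degree L < card A" "degree R < card A" by auto
  qed
  have "poly q (z\<^sup>2) = schur_pair (Suc (Suc ?m)) x y (insert (z\<^sup>2) ?W)"
  proof (rule q(2) [symmetric], rule notI)
    assume "(z\<^sup>2) ^ 3 \<in> (\<lambda>w. w ^ 3) ` insert (x\<^sup>2) (insert (y\<^sup>2) ?W)"
    then have "z ^ 6 \<in> (\<lambda>z. z ^ 6) ` (insert x (insert y (set (xs @ ys))))"
      unfolding image_insert image_image sq3 by simp
    then show False using Cons.prems by (auto simp: generic_def)
  qed
  then have "poly R (z\<^sup>2) = sigma (a\<^sup>2) * a * (-3) ^ Suc ?m * (x + a * y) * schur_pair (Suc (Suc ?m)) x y ((\<lambda>z. z\<^sup>2) ` set ((z # xs) @ ys))"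
    by (simp add: R_def)
  moreover have "poly L (z\<^sup>2) = (x + y) * prod_list ((z # xs) @ ys) ^ (2 * ?m + 3) * (x * y) ^ Suc (Suc ?m) * half_turn_even a (z # xs) x y ys"
    unfolding L_def poly_smult p_eval [OF nz(3)] by (simp add: power_mult_distrib mult_ac)
  ultimately show ?case
    unfolding \<open>L = R\<close> by (simp add: eval_nat_numeral)
qed

lemma prod_list_mset_cong:
  assumes "mset xs = mset ys" shows "prod_list (map f xs) = prod_list (map (f :: complex \<Rightarrow> complex) ys)"
proof -
  have "prod_mset (image_mset f (mset xs)) = prod_mset (image_mset f (mset ys))" using assms by simp
  then show ?thesis by (simp flip: prod_mset_prod_list)
qed

lemma half_turn_even_mset_generic:
  assumes "a\<^sup>2 = a - 1" "length ys = Suc (length xs)" "length xs' = length xs" "mset (xs @ ys) = mset (xs' @ ys')"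
    and "generic (x # xs @ ys)" "generic (y # xs @ ys)" "x + y \<noteq> 0"
  shows "half_turn_even a xs x y ys = half_turn_even a xs' x y ys'"
proof -
  have "size (mset (xs @ ys)) = size (mset (xs' @ ys'))" using assms(4) by simp
  then have len: "length ys' = Suc (length xs')" using assms(2,3) by simp
  have g: "generic (x # xs' @ ys')" "generic (y # xs' @ ys')"
    using generic_mset [OF assms(5), of "x # xs' @ ys'"] generic_mset [OF assms(6), of "y # xs' @ ys'"] assms(4)
    by simp_all
  have set: "set (xs @ ys) = set (xs' @ ys')" by (rule mset_eq_setD [OF assms(4)])
  have prod: "prod_list (xs @ ys) = prod_list (xs' @ ys')"
    using prod_list_mset_cong [OF assms(4), of id] by (simp only: list.map_id)
  let ?c = "(x + y) * prod_list (xs @ ys) ^ (2 * length xs + 1) * (x * y) ^ Suc (length xs)"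
  have "?c * half_turn_even a xs x y ys = ?c * half_turn_even a xs' x y ys'"
    using half_turn_even_schur [OF assms(1,2,5,6)] half_turn_even_schur [OF assms(1) len g]
    by (simp only: set prod assms(3))
  moreover have "?c \<noteq> 0" using assms(5-7) by (auto simp: generic_def prod_list_zero_iff)
  ultimately show ?thesis by simp
qed

text \<open>
  For \<open>x = y\<close> the two terms of \<open>schur_pair\<close> coincide and \<open>x\<close> joins
  the other variables.
\<close>

lemma half_turn_even_coincident:
  assumes "a\<^sup>2 = a - 1" "length ys = Suc (length xs)" "generic (x # xs @ ys)"
  shows "prod_list (x # xs @ ys) ^ (2 * length xs + 1) * half_turn_even a xs x x ys
    = sigma (a\<^sup>2) * a * (-3) ^ length xs * (1 + a)
      * (schur 1 (Suc (length xs)) ((\<lambda>z. z\<^sup>2) ` set (x # xs @ ys)) * schur 2 (Suc (length xs)) ((\<lambda>z. z\<^sup>2) ` set (x # xs @ ys)))"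
proof -
  let ?P = "prod_list (xs @ ys)" and ?m = "length xs"
  let ?S = "schur 1 (Suc ?m) ((\<lambda>z. z\<^sup>2) ` set (x # xs @ ys)) * schur 2 (Suc ?m) ((\<lambda>z. z\<^sup>2) ` set (x # xs @ ys))"
  have x: "x \<noteq> 0" using assms(3) by (auto simp: generic_def)
  have pair: "schur_pair (Suc ?m) x x ((\<lambda>z. z\<^sup>2) ` set (xs @ ys)) = 2 * x * ?S"
    by (simp add: schur_pair_def)
  have pow: "(x * x) ^ Suc ?m = x * x ^ (2 * ?m + 1)" by (simp add: power_mult_distrib power_add mult_2)
  \<comment> \<open>the factor \<open>2 x\<^sup>2\<close> is common to both sides of the closed formula and cancels\<close>
  have "2 * x * x * (prod_list (x # xs @ ys) ^ (2 * ?m + 1) * half_turn_even a xs x x ys)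
     = (x + x) * ?P ^ (2 * ?m + 1) * (x * x) ^ Suc ?m * half_turn_even a xs x x ys"
    by (simp only: pow prod_list.Cons append_Cons power_mult_distrib [of x ?P]) (simp add: algebra_simps)
  also have "\<dots> = 2 * x * x * (sigma (a\<^sup>2) * a * (-3) ^ ?m * (1 + a) * ?S)"
    unfolding half_turn_even_schur [OF assms(1-3,3)] pair by (simp add: algebra_simps)
  finally show ?thesis using x by simp
qed

lemma half_turn_even_coincident_mset:
  assumes "a\<^sup>2 = a - 1" "length ys = Suc (length xs)" "length xs' = length xs"
    and "mset (x # xs @ ys) = mset (x' # xs' @ ys')" "generic (x # xs @ ys)"
  shows "half_turn_even a xs x x ys = half_turn_even a xs' x' x' ys'"
proof -
  have "size (mset (x # xs @ ys)) = size (mset (x' # xs' @ ys'))" using assms(4) by simp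
  then have len: "length ys' = Suc (length xs')" using assms(2,3) by simp
  have g: "generic (x' # xs' @ ys')" using generic_mset [OF assms(5,4)] .
  have set: "set (x # xs @ ys) = set (x' # xs' @ ys')" by (rule mset_eq_setD [OF assms(4)])
  have prod: "prod_list (x # xs @ ys) = prod_list (x' # xs' @ ys')"
    using prod_list_mset_cong [OF assms(4), of id] by (simp only: list.map_id)
  let ?c = "prod_list (x # xs @ ys) ^ (2 * length xs + 1)"
  have "?c * half_turn_even a xs x x ys = ?c * half_turn_even a xs' x' x' ys'"
    using half_turn_even_coincident [OF assms(1,2,5)] half_turn_even_coincident [OF assms(1) len g]
    by (simp only: set prod assms(3))
  moreover have "?c \<noteq> 0" using assms(5) by (auto simp: generic_def prod_list_zero_iff)
  ultimately show ?thesis by simp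
qed

section \<open>Ice states as horizontal and vertical flows\<close>

text \<open>
  A product of matrices as a sum over paths, which is the form in which the sum over ice states arises.
\<close>

lemma transfer_paths:
  assumes "finite S" "s \<in> S" "t \<in> S"
  shows "transfer f S xs s t
    = (\<Sum>p | p \<in> PiE {..length xs} (\<lambda>_. S) \<and> p 0 = s \<and> p (length xs) = t. \<Prod>i<length xs. f (xs ! i) (p i) (p (Suc i)))"
  using assms(3)
proof (induction xs arbitrary: t rule: rev_induct)
  case Nil
  have "{p. p \<in> PiE {..0::nat} (\<lambda>_. S) \<and> p 0 = s \<and> p 0 = t} = (if s = t then {\<lambda>i\<in>{..0}. s} else {})"
    using assms(2) by (auto simp: PiE_iff extensional_def fun_eq_iff)
  then show ?case by simp
next
  case (snoc x xs)
  let ?n = "length xs"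
  let ?P = "\<lambda>n t. {p. p \<in> PiE {..n} (\<lambda>_. S) \<and> p 0 = s \<and> p n = t}"
  have fin: "finite (?P ?n m)" for m
    by (rule finite_subset [of _ "PiE {..?n} (\<lambda>_. S)"]) (auto simp: assms(1) intro: finite_PiE)
  have "transfer f S (xs @ [x]) s t = (\<Sum>m\<in>S. \<Sum>p\<in>?P ?n m. (\<Prod>i<?n. f (xs ! i) (p i) (p (Suc i))) * f x m t)"
    using snoc assms by (simp add: transfer_snoc sum_distrib_right)
  also have "\<dots> = (\<Sum>(m, p)\<in>Sigma S (?P ?n). (\<Prod>i<?n. f (xs ! i) (p i) (p (Suc i))) * f x m t)"
    by (rule sum.Sigma) (use assms(1) fin in auto)
  also have "\<dots> = (\<Sum>p\<in>?P (Suc ?n) t. \<Prod>i<Suc ?n. f ((xs @ [x]) ! i) (p i) (p (Suc i)))"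
  proof (rule sum.reindex_bij_witness [where i = "\<lambda>p. (p ?n, restrict p {..?n})" and j = "\<lambda>(m, p). p(Suc ?n := t)"])
    fix p assume p: "p \<in> ?P (Suc ?n) t"
    show "(case (p ?n, restrict p {..?n}) of (m, p) \<Rightarrow> p(Suc ?n := t)) = p"
      using p by (auto simp: fun_eq_iff PiE_iff extensional_def)
    show "(p ?n, restrict p {..?n}) \<in> Sigma S (?P ?n)"
      using p by (auto simp: PiE_iff)
  next
    fix mp assume "mp \<in> Sigma S (?P ?n)"
    then obtain m p where mp: "mp = (m, p)" "m \<in> S" "p \<in> ?P ?n m" by auto
    show "((case mp of (m, p) \<Rightarrow> p(Suc ?n := t)) ?n, restrict (case mp of (m, p) \<Rightarrow> p(Suc ?n := t)) {..?n}) = mp"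
      using mp by (auto simp: fun_eq_iff PiE_iff extensional_def)
    show "(case mp of (m, p) \<Rightarrow> p(Suc ?n := t)) \<in> ?P (Suc ?n) t"
      using mp snoc.prems by (auto simp: PiE_iff extensional_def)
    have "(\<Prod>i<?n. f ((xs @ [x]) ! i) ((p(Suc ?n := t)) i) ((p(Suc ?n := t)) (Suc i))) = (\<Prod>i<?n. f (xs ! i) (p i) (p (Suc i)))"
      by (rule prod.cong) (auto simp: nth_append)
    then show "(\<Prod>i<Suc ?n. f ((xs @ [x]) ! i) ((case mp of (m, p) \<Rightarrow> p(Suc ?n := t)) i) ((case mp of (m, p) \<Rightarrow> p(Suc ?n := t)) (Suc i)))
      = (case mp of (m, p) \<Rightarrow> (\<Prod>i<?n. f (xs ! i) (p i) (p (Suc i))) * f x m t)"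
      using mp by simp
  qed
  finally show ?case by simp
qed

definition vertical_paths :: "nat \<Rightarrow> bool \<Rightarrow> bool \<Rightarrow> (nat \<Rightarrow> bool) set" where
  "vertical_paths n b u = {q. q \<in> PiE {..n} (\<lambda>_. UNIV) \<and> q 0 = b \<and> q n = u}"

definition horizontal_paths :: "nat \<Rightarrow> nat \<Rightarrow> bool list \<Rightarrow> bool list \<Rightarrow> (nat \<Rightarrow> bool list) set" where
  "horizontal_paths N n l h = {p. p \<in> PiE {..N} (\<lambda>_. bool_lists n) \<and> p 0 = l \<and> p N = h}"

lemma finite_vertical_paths [simp, intro]: "finite (vertical_paths n b u)"
  unfolding vertical_paths_def
  by (rule finite_subset [of _ "PiE {..n} (\<lambda>_. UNIV)"]) (auto intro: finite_PiE)

lemma finite_horizontal_paths [simp, intro]: "finite (horizontal_paths N n l h)"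
  unfolding horizontal_paths_def
  by (rule finite_subset [of _ "PiE {..N} (\<lambda>_. bool_lists n)"]) (auto intro: finite_PiE)

lemma column_paths:
  assumes "length ls = length rs" "length hs = length rs"
  shows "column a y rs ls hs b u
    = (\<Sum>q\<in>vertical_paths (length rs) b u. \<Prod>i<length rs. ice_weight a (rs ! i / y) (ls ! i) (hs ! i) (q i) (q (Suc i)))"
proof -
  have "length (zip rs (zip ls hs)) = length rs" using assms by simp
  then show ?thesis
    unfolding column_def vertical_paths_def
    by (subst transfer_paths) (auto intro!: sum.cong prod.cong simp: assms)
qed

lemma columns_paths:
  assumes "length l = length rs" "length h = length rs"
  shows "columns a rs ys l h
    = (\<Sum>p\<in>horizontal_paths (length ys) (length rs) l h.
       \<Sum>q\<in>PiE {..<length ys} (\<lambda>_. vertical_paths (length rs) False True).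
       \<Prod>j<length ys. \<Prod>i<length rs. ice_weight a (rs ! i / ys ! j) (p j ! i) (p (Suc j) ! i) (q j i) (q j (Suc i)))"
proof -
  have "columns a rs ys l h
     = (\<Sum>p\<in>horizontal_paths (length ys) (length rs) l h. \<Prod>j<length ys. column a (ys ! j) rs (p j) (p (Suc j)) False True)"
    unfolding columns_def horizontal_paths_def by (rule transfer_paths) (use assms in auto)
  also have "\<dots> = (\<Sum>p\<in>horizontal_paths (length ys) (length rs) l h. \<Prod>j<length ys.
       \<Sum>q\<in>vertical_paths (length rs) False True. \<Prod>i<length rs. ice_weight a (rs ! i / ys ! j) (p j ! i) (p (Suc j) ! i) (q i) (q (Suc i)))"
    by (intro sum.cong prod.cong refl column_paths) (auto simp: horizontal_paths_def PiE_iff)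
  finally show ?thesis by (simp add: prod_sum_PiE)
qed

lemma side_sets:
  "A = {LeftS, RightS} \<longleftrightarrow> LeftS \<in> A \<and> RightS \<in> A \<and> BottomS \<notin> A \<and> TopS \<notin> A"
  "A = {BottomS, TopS} \<longleftrightarrow> LeftS \<notin> A \<and> RightS \<notin> A \<and> BottomS \<in> A \<and> TopS \<in> A"
  "A = {RightS, BottomS} \<longleftrightarrow> LeftS \<notin> A \<and> RightS \<in> A \<and> BottomS \<in> A \<and> TopS \<notin> A"
  "A = {LeftS, TopS} \<longleftrightarrow> LeftS \<in> A \<and> RightS \<notin> A \<and> BottomS \<notin> A \<and> TopS \<in> A"
  "A = {LeftS, BottomS} \<longleftrightarrow> LeftS \<in> A \<and> RightS \<notin> A \<and> BottomS \<in> A \<and> TopS \<notin> A"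
  "A = {RightS, TopS} \<longleftrightarrow> LeftS \<notin> A \<and> RightS \<in> A \<and> BottomS \<notin> A \<and> TopS \<in> A"
proof -
  have all: "(\<forall>d. P d) \<longleftrightarrow> P LeftS \<and> P RightS \<and> P BottomS \<and> P TopS" for P
    by (metis side.exhaust)
  show "A = {LeftS, RightS} \<longleftrightarrow> LeftS \<in> A \<and> RightS \<in> A \<and> BottomS \<notin> A \<and> TopS \<notin> A"
    "A = {BottomS, TopS} \<longleftrightarrow> LeftS \<notin> A \<and> RightS \<notin> A \<and> BottomS \<in> A \<and> TopS \<in> A"
    "A = {RightS, BottomS} \<longleftrightarrow> LeftS \<notin> A \<and> RightS \<in> A \<and> BottomS \<in> A \<and> TopS \<notin> A"
    "A = {LeftS, TopS} \<longleftrightarrow> LeftS \<in> A \<and> RightS \<notin> A \<and> BottomS \<notin> A \<and> TopS \<in> A"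
    "A = {LeftS, BottomS} \<longleftrightarrow> LeftS \<in> A \<and> RightS \<notin> A \<and> BottomS \<in> A \<and> TopS \<notin> A"
    "A = {RightS, TopS} \<longleftrightarrow> LeftS \<notin> A \<and> RightS \<in> A \<and> BottomS \<notin> A \<and> TopS \<in> A"
    unfolding set_eq_iff all by auto
qed

lemma vertex_weight_eq:
  "vertex_weight a t A = ice_weight a t (LeftS \<in> A) (RightS \<notin> A) (BottomS \<in> A) (TopS \<notin> A)"
  unfolding vertex_weight_def side_sets ice_weight_def by auto

text \<open>
  Half-edge sets that violate the ice rule contribute nothing, so the ice rule may be dropped from the
  summation.
\<close>

lemma vertex_weight_card:
  assumes "card A \<noteq> 2" shows "vertex_weight a t A = 0"
  using assms unfolding vertex_weight_def by auto

definition orientations :: "ice_graph \<Rightarrow> half_edge set set" where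
  "orientations G = {S. S \<subseteq> vertices G \<times> UNIV
     \<and> (\<forall>(e, e') \<in> internal_edges G. e \<in> S \<longleftrightarrow> e' \<notin> S)
     \<and> boundary_in G \<subseteq> S \<and> boundary_out G \<inter> S = {}}"

lemma partition_function_orientations:
  assumes "finite (vertices G)"
  shows "partition_function a G t = (\<Sum>S\<in>orientations G. \<Prod>v\<in>vertices G. ice_weight a (t v)
    ((v, LeftS) \<in> S) ((v, RightS) \<notin> S) ((v, BottomS) \<in> S) ((v, TopS) \<notin> S))"
proof -
  have "finite (UNIV :: side set)"
    by (rule finite_subset [of _ "{LeftS, RightS, BottomS, TopS}"]) (auto intro: side.exhaust)
  then have "finite (vertices G \<times> (UNIV :: side set))" using assms by simp
  moreover have "orientations G \<subseteq> Pow (vertices G \<times> UNIV)" by (auto simp: orientations_def)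
  ultimately have fin: "finite (orientations G)" using finite_subset by blast
  have "partition_function a G t = (\<Sum>S\<in>orientations G. \<Prod>v\<in>vertices G. vertex_weight a (t v) (incoming_sides S v))"
    unfolding partition_function_def
  proof (rule sum.mono_neutral_left [OF fin])
    show "ice_states G \<subseteq> orientations G" by (auto simp: ice_states_def orientations_def)
    show "\<forall>S\<in>orientations G - ice_states G. (\<Prod>v\<in>vertices G. vertex_weight a (t v) (incoming_sides S v)) = 0"
    proof
      fix S assume "S \<in> orientations G - ice_states G"
      then obtain v where "v \<in> vertices G" "card (incoming_sides S v) \<noteq> 2"
        by (auto simp: ice_states_def orientations_def)
      then show "(\<Prod>v\<in>vertices G. vertex_weight a (t v) (incoming_sides S v)) = 0"
        using assms vertex_weight_card by (intro prod_zero) auto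
    qed
  qed
  then show ?thesis by (simp add: vertex_weight_eq incoming_sides_def)
qed

text \<open>
  Whether the edge between columns \<open>j\<close> and \<open>j + 1\<close> in row \<open>i + 1\<close>
  flows to the right. Rows are counted from 0 here, as in lists; for \<open>j = 0\<close> this is the left
  boundary.
\<close>

definition rightward :: "half_edge set \<Rightarrow> nat \<Rightarrow> nat \<Rightarrow> bool" where
  "rightward S j i \<longleftrightarrow> j = 0 \<or> ((j, Suc i), RightS) \<notin> S"

text \<open>
  Whether the edge of column \<open>j + 1\<close> between rows \<open>i\<close> and \<open>i + 1\<close>
  flows upwards. Columns are counted from 0 here; for \<open>i = 0\<close> this is the bottom boundary.
\<close>

definition upward :: "half_edge set \<Rightarrow> nat \<Rightarrow> nat \<Rightarrow> bool" where
  "upward S j i \<longleftrightarrow> i \<noteq> 0 \<and> ((Suc j, i), TopS) \<notin> S"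

definition row_states :: "half_edge set \<Rightarrow> nat \<Rightarrow> nat \<Rightarrow> nat \<Rightarrow> bool list" where
  "row_states S N n = (\<lambda>j\<in>{..N}. map (rightward S j) [0..<n])"

definition column_states :: "half_edge set \<Rightarrow> nat \<Rightarrow> nat \<Rightarrow> nat \<Rightarrow> nat \<Rightarrow> bool" where
  "column_states S N n = (\<lambda>j\<in>{..<N}. \<lambda>i\<in>{..n}. upward S j i)"

text \<open>
  The orientation with given horizontal and vertical flows, in the indexing of \<open>rightward\<close>
  and \<open>upward\<close>.
\<close>

definition flow_orientation :: "vertex set \<Rightarrow> (nat \<Rightarrow> nat \<Rightarrow> bool) \<Rightarrow> (nat \<Rightarrow> nat \<Rightarrow> bool) \<Rightarrow> half_edge set" where
  "flow_orientation V h v = {((j, k), d) | j k d. (j, k) \<in> V \<and>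
     (case d of LeftS \<Rightarrow> h (j - 1) (k - 1) | RightS \<Rightarrow> \<not> h j (k - 1) | BottomS \<Rightarrow> v (j - 1) (k - 1) | TopS \<Rightarrow> \<not> v (j - 1) k)}"

lemma flow_orientation_iff:
  "((j, k), LeftS) \<in> flow_orientation V h v \<longleftrightarrow> (j, k) \<in> V \<and> h (j - 1) (k - 1)"
  "((j, k), RightS) \<in> flow_orientation V h v \<longleftrightarrow> (j, k) \<in> V \<and> \<not> h j (k - 1)"
  "((j, k), BottomS) \<in> flow_orientation V h v \<longleftrightarrow> (j, k) \<in> V \<and> v (j - 1) (k - 1)"
  "((j, k), TopS) \<in> flow_orientation V h v \<longleftrightarrow> (j, k) \<in> V \<and> \<not> v (j - 1) k"
  by (auto simp: flow_orientation_def)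

lemma half_edge_set_eqI:
  assumes "\<And>j k. ((j, k), LeftS) \<in> S \<longleftrightarrow> ((j, k), LeftS) \<in> T" "\<And>j k. ((j, k), RightS) \<in> S \<longleftrightarrow> ((j, k), RightS) \<in> T"
    "\<And>j k. ((j, k), BottomS) \<in> S \<longleftrightarrow> ((j, k), BottomS) \<in> T" "\<And>j k. ((j, k), TopS) \<in> S \<longleftrightarrow> ((j, k), TopS) \<in> (T :: half_edge set)"
  shows "S = T"
proof (rule set_eqI)
  fix e :: half_edge
  obtain j k d where "e = ((j, k), d)" by (metis prod.exhaust)
  then show "e \<in> S \<longleftrightarrow> e \<in> T" using assms by (cases d) auto
qed

lemma edge_conditions:
  "(\<forall>(e, e')\<in>{(f j k, g j k) | j k. P j k}. Q e e') \<longleftrightarrow> (\<forall>j k. P j k \<longrightarrow> Q (f j k) (g j k))"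
  "(\<forall>(e, e')\<in>{(f' k, g' k) | k. P' k}. Q e e') \<longleftrightarrow> (\<forall>k. P' k \<longrightarrow> Q (f' k) (g' k))"
  "{f'' k | k. P' k} \<subseteq> S \<longleftrightarrow> (\<forall>k. P' k \<longrightarrow> f'' k \<in> S)"
  "{f'' k | k. P' k} \<inter> S = {} \<longleftrightarrow> (\<forall>k. P' k \<longrightarrow> f'' k \<notin> S)"
  by blast+

lemma even_orientations_iff:
  "S \<in> orientations (even_graph N) \<longleftrightarrow> S \<subseteq> even_vertices N \<times> UNIV
    \<and> (\<forall>j k. 1 \<le> j \<and> j < N \<and> 1 \<le> k \<and> k \<le> 2 * N \<longrightarrow> (((j, k), RightS) \<in> S \<longleftrightarrow> ((Suc j, k), LeftS) \<notin> S))
    \<and> (\<forall>j k. 1 \<le> j \<and> j \<le> N \<and> 1 \<le> k \<and> k < 2 * N \<longrightarrow> (((j, k), TopS) \<in> S \<longleftrightarrow> ((j, Suc k), BottomS) \<notin> S))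
    \<and> (\<forall>k. 1 \<le> k \<and> k \<le> N \<longrightarrow> (((N, k), RightS) \<in> S \<longleftrightarrow> ((N, 2 * N + 1 - k), RightS) \<notin> S))
    \<and> (\<forall>k. 1 \<le> k \<and> k \<le> 2 * N \<longrightarrow> ((1, k), LeftS) \<in> S)
    \<and> (\<forall>j. 1 \<le> j \<and> j \<le> N \<longrightarrow> ((j, 1), BottomS) \<notin> S)
    \<and> (\<forall>j. 1 \<le> j \<and> j \<le> N \<longrightarrow> ((j, 2 * N), TopS) \<notin> S)"
proof -
  have edges: "(j, k) \<in> even_vertices N \<and> (j + 1, k) \<in> even_vertices N \<longleftrightarrow> 1 \<le> j \<and> j < N \<and> 1 \<le> k \<and> k \<le> 2 * N"
    "(j, k) \<in> even_vertices N \<and> (j, k + 1) \<in> even_vertices N \<longleftrightarrow> 1 \<le> j \<and> j \<le> N \<and> 1 \<le> k \<and> k < 2 * N" for j k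
    by (auto simp: even_vertices_def)
  show ?thesis
    unfolding orientations_def even_graph_def grid_edges_def mem_Collect_eq ice_graph.simps ball_Un
      edge_conditions edges Int_Un_distrib2 Un_empty atLeastAtMost_iff conj_assoc Suc_eq_plus1
    by (rule refl)
qed

text \<open>
  An orientation corresponds to its horizontal flows \<open>p\<close> and its vertical flows
  \<open>q\<close>. The boundary conditions become conditions on the ends of the paths \<open>p\<close>
  and \<open>q\<close>, and the edges joining the right sides say that the last horizontal state has the
  form \<open>g @ rev (map Not g)\<close>.
\<close>

lemma sum_even_orientations:
  assumes "N \<ge> 1"
  shows "(\<Sum>S\<in>orientations (even_graph N). F (row_states S N (2 * N)) (column_states S N (2 * N)))
    = (\<Sum>g\<in>bool_lists N. \<Sum>p\<in>horizontal_paths N (2 * N) (replicate (2 * N) True) (g @ rev (map Not g)).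
        \<Sum>q\<in>PiE {..<N} (\<lambda>_. vertical_paths (2 * N) False True). (F p q :: complex))"
proof -
  let ?n = "2 * N" and ?V = "even_vertices N"
  let ?h = "row_states" and ?v = "column_states"
  let ?H = "\<lambda>g. horizontal_paths N ?n (replicate ?n True) (g @ rev (map Not g))"
  let ?Q = "PiE {..<N} (\<lambda>_. vertical_paths ?n False True)"
  let ?T = "SIGMA g:bool_lists N. ?H g \<times> ?Q"
  have finQ: "finite ?Q" by (intro finite_PiE) auto
  have "(\<Sum>S\<in>orientations (even_graph N). F (?h S N ?n) (?v S N ?n)) = (\<Sum>(g, p, q)\<in>?T. F p q)"
  proof (rule sum.reindex_bij_witness [where j = "\<lambda>S. (take N (?h S N ?n N), ?h S N ?n, ?v S N ?n)"
        and i = "\<lambda>(g, p, q). flow_orientation ?V (\<lambda>j i. p j ! i) q"])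
    fix S assume "S \<in> orientations (even_graph N)"
    note S = this [unfolded even_orientations_iff]
    have V: "(j, k) \<in> ?V" if "((j, k), d) \<in> S" for j k d using S that by blast
    have S_row: "((j, k), RightS) \<in> S \<longleftrightarrow> ((Suc j, k), LeftS) \<notin> S" if "1 \<le> j" "j < N" "1 \<le> k" "k \<le> ?n" for j k
      using S that by blast
    have S_column: "((j, k), TopS) \<in> S \<longleftrightarrow> ((j, Suc k), BottomS) \<notin> S" if "1 \<le> j" "j \<le> N" "1 \<le> k" "k < ?n" for j k
      using S that by blast
    have S_turn: "((N, k), RightS) \<in> S \<longleftrightarrow> ((N, ?n + 1 - k), RightS) \<notin> S" if "1 \<le> k" "k \<le> N" for k
      using S that by blast
    have S_left: "((1, k), LeftS) \<in> S" if "1 \<le> k" "k \<le> ?n" for k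
      using S that by blast
    have S_bottom: "((j, 1), BottomS) \<notin> S" and S_top: "((j, ?n), TopS) \<notin> S" if "1 \<le> j" "j \<le> N" for j
      using S that by simp_all
    have h: "?h S N ?n j ! i = rightward S j i" if "j \<le> N" "i < ?n" for i j
      using that by (simp add: row_states_def)
    have v: "?v S N ?n j i = upward S j i" if "j < N" "i \<le> ?n" for i j
      using that by (simp add: column_states_def)
    show "(case (take N (?h S N ?n N), ?h S N ?n, ?v S N ?n) of (g, p, q) \<Rightarrow> flow_orientation ?V (\<lambda>j i. p j ! i) q) = S"
      unfolding prod.case
    proof (rule half_edge_set_eqI)
      fix j k
      show "((j, k), LeftS) \<in> flow_orientation ?V (\<lambda>j i. ?h S N ?n j ! i) (?v S N ?n) \<longleftrightarrow> ((j, k), LeftS) \<in> S"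
      proof (cases "(j, k) \<in> ?V")
        case True
        then have jk: "1 \<le> j" "j \<le> N" "1 \<le> k" "k \<le> ?n" by (auto simp: even_vertices_def)
        then obtain j' k' where "j = Suc j'" "k = Suc k'" by (metis Suc_le_D One_nat_def)
        then show ?thesis using S_left [of k] S_row [of j' k] True jk
          by (cases "j' = 0") (simp_all add: flow_orientation_iff h rightward_def)
      qed (use V in \<open>auto simp: flow_orientation_iff\<close>)
      show "((j, k), BottomS) \<in> flow_orientation ?V (\<lambda>j i. ?h S N ?n j ! i) (?v S N ?n) \<longleftrightarrow> ((j, k), BottomS) \<in> S"
      proof (cases "(j, k) \<in> ?V")
        case True
        then have jk: "1 \<le> j" "j \<le> N" "1 \<le> k" "k \<le> ?n" by (auto simp: even_vertices_def)
        then obtain j' k' where "j = Suc j'" "k = Suc k'" by (metis Suc_le_D One_nat_def)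
        then show ?thesis using S_bottom [of j] S_column [of j k'] True jk
          by (cases "k' = 0") (simp_all add: flow_orientation_iff v upward_def)
      qed (use V in \<open>auto simp: flow_orientation_iff\<close>)
      show "((j, k), RightS) \<in> flow_orientation ?V (\<lambda>j i. ?h S N ?n j ! i) (?v S N ?n) \<longleftrightarrow> ((j, k), RightS) \<in> S"
        using V [of j k RightS] by (auto simp: flow_orientation_iff h rightward_def even_vertices_def)
      show "((j, k), TopS) \<in> flow_orientation ?V (\<lambda>j i. ?h S N ?n j ! i) (?v S N ?n) \<longleftrightarrow> ((j, k), TopS) \<in> S"
        using V [of j k TopS] by (auto simp: flow_orientation_iff v upward_def even_vertices_def)
    qed
    have "?h S N ?n N = take N (?h S N ?n N) @ rev (map Not (take N (?h S N ?n N)))"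
    proof (rule nth_equalityI)
      fix i assume "i < length (?h S N ?n N)"
      then have i: "i < ?n" by (simp add: row_states_def)
      show "?h S N ?n N ! i = (take N (?h S N ?n N) @ rev (map Not (take N (?h S N ?n N)))) ! i"
      proof (cases "i < N")
        case False
        then have "Suc (N - Suc (i - N)) = ?n - i" "N - Suc (i - N) < N" using i by auto
        moreover have "((N, ?n - i), RightS) \<in> S \<longleftrightarrow> ((N, Suc i), RightS) \<notin> S"
        proof -
          have "?n + 1 - (?n - i) = Suc i" "1 \<le> ?n - i" "?n - i \<le> N" using i False by auto
          then show ?thesis using S_turn [of "?n - i"] by simp
        qed
        ultimately show ?thesis using i False assms
          by (simp add: nth_append row_states_def rev_nth rightward_def)
      qed (simp add: nth_append row_states_def)
    qed (simp add: row_states_def)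
    moreover have "?h S N ?n 0 = replicate ?n True"
      by (rule nth_equalityI) (simp_all add: row_states_def rightward_def)
    moreover have "?h S N ?n \<in> PiE {..N} (\<lambda>_. bool_lists ?n)"
      by (auto simp: row_states_def)
    ultimately have "?h S N ?n \<in> ?H (take N (?h S N ?n N))"
      unfolding horizontal_paths_def mem_Collect_eq by blast
    moreover have "length (take N (?h S N ?n N)) = N"
      by (simp add: row_states_def)
    moreover have "?v S N ?n \<in> ?Q"
      using assms S_top by (simp add: PiE_iff vertical_paths_def column_states_def upward_def)
    ultimately show "(take N (?h S N ?n N), ?h S N ?n, ?v S N ?n) \<in> ?T"
      by (simp only: mem_Sigma_iff bool_lists_iff simp_thms)
    show "(case (take N (?h S N ?n N), ?h S N ?n, ?v S N ?n) of (g, p, q) \<Rightarrow> F p q) = F (?h S N ?n) (?v S N ?n)" by simp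
  next
    fix x assume "x \<in> ?T"
    then obtain g p q where x: "x = (g, p, q)" and g: "length g = N" and p: "p \<in> ?H g" and q: "q \<in> ?Q" by auto
    let ?S = "flow_orientation ?V (\<lambda>j i. p j ! i) q"
    have p0: "p 0 = replicate ?n True" and pN: "p N = g @ rev (map Not g)"
      and pl: "\<And>j. j \<le> N \<Longrightarrow> length (p j) = ?n" and pe: "\<And>j. \<not> j \<le> N \<Longrightarrow> p j = undefined"
      using p by (auto simp: horizontal_paths_def PiE_iff extensional_def)
    have q0: "\<And>j. j < N \<Longrightarrow> \<not> q j 0" and qn: "\<And>j. j < N \<Longrightarrow> q j ?n"
      and qe: "\<And>j. \<not> j < N \<Longrightarrow> q j = undefined" "\<And>j i. j < N \<Longrightarrow> \<not> i \<le> ?n \<Longrightarrow> q j i = undefined"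
      using q by (auto simp: vertical_paths_def PiE_iff extensional_def)
    have anti: "p N ! (k - 1) \<longleftrightarrow> \<not> p N ! (?n + 1 - k - 1)" if "1 \<le> k" "k \<le> N" for k
    proof -
      have "N - Suc (?n - k - N) = k - 1" "k - 1 < N" "?n - k - N < N" using that by auto
      then show ?thesis using that by (simp add: pN nth_append g rev_nth)
    qed
    have "?h ?S N ?n = p"
    proof
      fix j show "?h ?S N ?n j = p j"
        using p0 pl pe by (cases "j = 0"; cases "j \<le> N")
          (auto simp: row_states_def rightward_def flow_orientation_iff even_vertices_def intro!: nth_equalityI)
    qed
    moreover have "?v ?S N ?n = q"
    proof (intro ext)
      fix j i show "?v ?S N ?n j i = q j i"
        using q0 [of j] qe by (cases "i = 0")
          (auto simp: column_states_def upward_def flow_orientation_iff even_vertices_def)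
    qed
    ultimately show "(\<lambda>S. (take N (?h S N ?n N), ?h S N ?n, ?v S N ?n)) (case x of (g, p, q) \<Rightarrow> flow_orientation ?V (\<lambda>j i. p j ! i) q) = x"
      by (simp only: x prod.case pN) (simp add: g)
    show "(case x of (g, p, q) \<Rightarrow> flow_orientation ?V (\<lambda>j i. p j ! i) q) \<in> orientations (even_graph N)"
      unfolding even_orientations_iff x prod.case flow_orientation_iff
    proof (intro conjI allI impI)
      show "?S \<subseteq> ?V \<times> UNIV" by (auto simp: flow_orientation_def)
      show "((j, k) \<in> ?V \<and> \<not> p j ! (k - 1)) = (\<not> ((Suc j, k) \<in> ?V \<and> p (Suc j - 1) ! (k - 1)))"
        if "1 \<le> j \<and> j < N \<and> 1 \<le> k \<and> k \<le> ?n" for j k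
        using that by (simp add: even_vertices_def)
      show "((j, k) \<in> ?V \<and> \<not> q (j - 1) k) = (\<not> ((j, Suc k) \<in> ?V \<and> q (j - 1) (Suc k - 1)))"
        if "1 \<le> j \<and> j \<le> N \<and> 1 \<le> k \<and> k < ?n" for j k
        using that by (simp add: even_vertices_def)
      show "((N, k) \<in> ?V \<and> \<not> p N ! (k - 1)) = (\<not> ((N, ?n + 1 - k) \<in> ?V \<and> \<not> p N ! (?n + 1 - k - 1)))"
        if k: "1 \<le> k \<and> k \<le> N" for k
      proof -
        have "(N, k) \<in> ?V" "(N, ?n + 1 - k) \<in> ?V" using k assms by (auto simp: even_vertices_def)
        then show ?thesis using anti [of k] k by (simp only: simp_thms)
      qed
      show "(1, k) \<in> ?V" if "1 \<le> k \<and> k \<le> ?n" for k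
        using that assms by (simp add: even_vertices_def)
      show "p (1 - 1) ! (k - 1)" if "1 \<le> k \<and> k \<le> ?n" for k
      proof -
        have "k - 1 < ?n" using that by linarith
        then show ?thesis by (simp only: p0 diff_self_eq_0 nth_replicate)
      qed
      show "\<not> ((j, 1) \<in> ?V \<and> q (j - 1) (1 - 1))" if "1 \<le> j \<and> j \<le> N" for j
      proof -
        have "j - 1 < N" using that by linarith
        then show ?thesis using q0 by (simp only: diff_self_eq_0 simp_thms)
      qed
      show "\<not> ((j, ?n) \<in> ?V \<and> \<not> q (j - 1) ?n)" if "1 \<le> j \<and> j \<le> N" for j
      proof -
        have "j - 1 < N" using that by linarith
        then show ?thesis using qn by (simp only: simp_thms)
      qed
    qed
  qed
  also have "\<dots> = (\<Sum>g\<in>bool_lists N. \<Sum>(p, q)\<in>?H g \<times> ?Q. F p q)"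
    by (rule sum.Sigma [symmetric]) (simp_all add: finQ)
  also have "\<dots> = (\<Sum>g\<in>bool_lists N. \<Sum>p\<in>?H g. \<Sum>q\<in>?Q. F p q)"
    by (simp only: sum.cartesian_product)
  finally show ?thesis .
qed

lemma even_orientation_flow:
  assumes "S \<in> orientations (even_graph N)" "j < N" "i < 2 * N"
  shows "((Suc j, Suc i), LeftS) \<in> S \<longleftrightarrow> rightward S j i" "((Suc j, Suc i), RightS) \<notin> S \<longleftrightarrow> rightward S (Suc j) i"
    "((Suc j, Suc i), BottomS) \<in> S \<longleftrightarrow> upward S j i" "((Suc j, Suc i), TopS) \<notin> S \<longleftrightarrow> upward S j (Suc i)"
proof -
  note S = assms(1) [unfolded even_orientations_iff]
  have "((1, Suc i), LeftS) \<in> S" using S assms(3) by simp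
  moreover have "((j, Suc i), RightS) \<in> S \<longleftrightarrow> ((Suc j, Suc i), LeftS) \<notin> S" if "j \<noteq> 0"
    using S assms(2,3) that by simp
  ultimately show "((Suc j, Suc i), LeftS) \<in> S \<longleftrightarrow> rightward S j i"
    by (cases "j = 0") (simp_all add: rightward_def)
  have "((Suc j, 1), BottomS) \<notin> S" using S assms(2) by simp
  moreover have "((Suc j, i), TopS) \<in> S \<longleftrightarrow> ((Suc j, Suc i), BottomS) \<notin> S" if "i \<noteq> 0"
    using S assms(2,3) that by simp
  ultimately show "((Suc j, Suc i), BottomS) \<in> S \<longleftrightarrow> upward S j i"
    by (cases "i = 0") (simp_all add: upward_def)
qed (simp_all add: rightward_def upward_def)

lemma even_row_nth:
  assumes "N \<ge> 1" "i < 2 * N"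
  shows "(map xs [1..<N] @ [x, y] @ rev (map xs [1..<N])) ! i = even_row N xs x y (Suc i)"
proof -
  consider "i < N - 1" | "i = N - 1" | "i = N" | "N < i" by linarith
  then show ?thesis
  proof cases
    case 4
    then have e: "i - (N - Suc 0) = Suc (Suc (i - Suc N))" and "i - Suc N < N - 1" "Suc (N - 1 - Suc (i - Suc N)) = 2 * N + 1 - Suc i"
      "N - 1 - Suc (i - Suc N) < N - 1" "\<not> i < N - 1" "Suc 0 + (N - Suc (Suc (i - Suc N))) < N"
      using assms by auto
    then show ?thesis using 4 by (simp add: nth_append rev_nth even_row_def e)
  qed (use assms in \<open>auto simp: nth_append even_row_def\<close>)
qed

theorem ZHT_even_eq:
  assumes "N \<ge> 1"
  shows "ZHT_even a N xs (x, y) ys = half_turn_even a (map xs [1..<N]) x y (map ys [1..<Suc N])"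
proof -
  let ?n = "2 * N" and ?rs = "map xs [1..<N] @ [x, y] @ rev (map xs [1..<N])" and ?ys = "map ys [1..<Suc N]"
  define F where "F = (\<lambda>p q. \<Prod>j<N. \<Prod>i<?n. ice_weight a (?rs ! i / ?ys ! j) (p j ! i) (p (Suc j) ! i) (q j i) (q j (Suc i)))"
  have "ZHT_even a N xs (x, y) ys = (\<Sum>S\<in>orientations (even_graph N). F (row_states S N ?n) (column_states S N ?n))"
    unfolding ZHT_even_def
  proof (subst partition_function_orientations)
    show "(\<Sum>S\<in>orientations (even_graph N). \<Prod>v\<in>vertices (even_graph N). ice_weight a
         (case v of (j, k) \<Rightarrow> even_row N xs (fst (x, y)) (snd (x, y)) k * (1 / ys j))
         ((v, LeftS) \<in> S) ((v, RightS) \<notin> S) ((v, BottomS) \<in> S) ((v, TopS) \<notin> S))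
      = (\<Sum>S\<in>orientations (even_graph N). F (row_states S N ?n) (column_states S N ?n))"
    proof (intro sum.cong refl)
      fix S assume S: "S \<in> orientations (even_graph N)"
      let ?f = "\<lambda>j k. ice_weight a (even_row N xs x y k / ys j)
         (((j, k), LeftS) \<in> S) (((j, k), RightS) \<notin> S) (((j, k), BottomS) \<in> S) (((j, k), TopS) \<notin> S)"
      have "(\<Prod>v\<in>vertices (even_graph N). ice_weight a
         (case v of (j, k) \<Rightarrow> even_row N xs (fst (x, y)) (snd (x, y)) k * (1 / ys j))
         ((v, LeftS) \<in> S) ((v, RightS) \<notin> S) ((v, BottomS) \<in> S) ((v, TopS) \<notin> S))
        = (\<Prod>j\<in>{1..N}. \<Prod>k\<in>{1..?n}. ?f j k)"
        by (simp add: even_graph_def even_vertices_def prod.cartesian_product split_beta)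
      also have "\<dots> = (\<Prod>j<N. \<Prod>i<?n. ?f (Suc j) (Suc i))"
        by (simp only: One_nat_def prod.atLeast1_atMost_eq)
      also have "\<dots> = F (row_states S N ?n) (column_states S N ?n)"
        unfolding F_def
        by (intro prod.cong refl)
          (simp add: even_orientation_flow [OF S] even_row_nth [OF assms, unfolded One_nat_def] row_states_def column_states_def
             del: append_Cons append_Nil upt_Suc)
      finally show "(\<Prod>v\<in>vertices (even_graph N). ice_weight a
         (case v of (j, k) \<Rightarrow> even_row N xs (fst (x, y)) (snd (x, y)) k * (1 / ys j))
         ((v, LeftS) \<in> S) ((v, RightS) \<notin> S) ((v, BottomS) \<in> S) ((v, TopS) \<notin> S))
        = F (row_states S N ?n) (column_states S N ?n)" .
    qed
  qed (simp add: even_graph_def even_vertices_def)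
  also have "\<dots> = (\<Sum>g\<in>bool_lists N. \<Sum>p\<in>horizontal_paths N ?n (replicate ?n True) (g @ rev (map Not g)).
        \<Sum>q\<in>PiE {..<N} (\<lambda>_. vertical_paths ?n False True). F p q)"
    by (rule sum_even_orientations [OF assms])
  also have "\<dots> = half_turn_even a (map xs [1..<N]) x y ?ys"
  proof -
    have len: "length ?rs = ?n" "length ?ys = N" using assms by auto
    show ?thesis
      unfolding half_turn_even_def len(2)
    proof (intro sum.cong refl)
      fix g :: "bool list" assume "g \<in> bool_lists N"
      then have "length (replicate ?n True) = length ?rs" "length (g @ rev (map Not g)) = length ?rs"
        using len by simp_all
      from columns_paths [OF this, of a ?ys, unfolded len]
      show "(\<Sum>p\<in>horizontal_paths N ?n (replicate ?n True) (g @ rev (map Not g)).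
        \<Sum>q\<in>PiE {..<N} (\<lambda>_. vertical_paths ?n False True). F p q) = columns a ?rs ?ys (replicate ?n True) (g @ rev (map Not g))"
        unfolding F_def by (rule sym)
    qed
  qed
  finally show ?thesis .
qed

lemma odd_orientations_iff:
  "S \<in> orientations (odd_graph N) \<longleftrightarrow> S \<subseteq> odd_vertices N \<times> UNIV
    \<and> (\<forall>j k. 1 \<le> j \<and> 1 \<le> k \<and> (j < N \<and> k \<le> 2 * N + 1 \<or> j = N \<and> k \<le> N) \<longrightarrow> (((j, k), RightS) \<in> S \<longleftrightarrow> ((Suc j, k), LeftS) \<notin> S))
    \<and> (\<forall>j k. 1 \<le> j \<and> 1 \<le> k \<and> (j \<le> N \<and> k < 2 * N + 1 \<or> j = Suc N \<and> k < N) \<longrightarrow> (((j, k), TopS) \<in> S \<longleftrightarrow> ((j, Suc k), BottomS) \<notin> S))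
    \<and> (\<forall>k. 1 \<le> k \<and> k \<le> N \<longrightarrow> (((Suc N, k), RightS) \<in> S \<longleftrightarrow> ((N, 2 * N + 2 - k), RightS) \<notin> S))
    \<and> (((Suc N, N), TopS) \<in> S \<longleftrightarrow> ((N, Suc N), RightS) \<notin> S)
    \<and> (\<forall>k. 1 \<le> k \<and> k \<le> 2 * N + 1 \<longrightarrow> ((1, k), LeftS) \<in> S)
    \<and> (\<forall>j. 1 \<le> j \<and> j \<le> Suc N \<longrightarrow> ((j, 1), BottomS) \<notin> S)
    \<and> (\<forall>j. 1 \<le> j \<and> j \<le> N \<longrightarrow> ((j, 2 * N + 1), TopS) \<notin> S)"
proof -
  have edges: "(j, k) \<in> odd_vertices N \<and> (j + 1, k) \<in> odd_vertices N
      \<longleftrightarrow> 1 \<le> j \<and> 1 \<le> k \<and> (j < N \<and> k \<le> 2 * N + 1 \<or> j = N \<and> k \<le> N)"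
    "(j, k) \<in> odd_vertices N \<and> (j, k + 1) \<in> odd_vertices N
      \<longleftrightarrow> 1 \<le> j \<and> 1 \<le> k \<and> (j \<le> N \<and> k < 2 * N + 1 \<or> j = N + 1 \<and> k < N)" for j k
    by (auto simp: odd_vertices_def)
  have single: "(\<forall>(e, e')\<in>{(u, u')}. Q e e') \<longleftrightarrow> Q u u'" for Q and u u' :: half_edge by simp
  show ?thesis
    unfolding orientations_def odd_graph_def grid_edges_def mem_Collect_eq ice_graph.simps ball_Un
      edge_conditions edges single Int_Un_distrib2 Un_empty atLeastAtMost_iff conj_assoc Suc_eq_plus1
    by (rule refl)
qed

lemma odd_orientation_flow:
  assumes "S \<in> orientations (odd_graph N)" "(Suc j, Suc i) \<in> odd_vertices N"
  shows "((Suc j, Suc i), LeftS) \<in> S \<longleftrightarrow> rightward S j i" "((Suc j, Suc i), RightS) \<notin> S \<longleftrightarrow> rightward S (Suc j) i"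
    "((Suc j, Suc i), BottomS) \<in> S \<longleftrightarrow> upward S j i" "((Suc j, Suc i), TopS) \<notin> S \<longleftrightarrow> upward S j (Suc i)"
proof -
  note S = assms(1) [unfolded odd_orientations_iff]
  have V: "j < N \<and> i < 2 * N + 1 \<or> j = N \<and> i < N" using assms(2) by (auto simp: odd_vertices_def)
  have "((1, Suc i), LeftS) \<in> S" using S V by auto
  moreover have "((j, Suc i), RightS) \<in> S \<longleftrightarrow> ((Suc j, Suc i), LeftS) \<notin> S" if "j \<noteq> 0"
  proof -
    have "1 \<le> j \<and> 1 \<le> Suc i \<and> (j < N \<and> Suc i \<le> 2 * N + 1 \<or> j = N \<and> Suc i \<le> N)" using V that by auto
    then show ?thesis using S by blast
  qed
  ultimately show "((Suc j, Suc i), LeftS) \<in> S \<longleftrightarrow> rightward S j i"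
    by (cases "j = 0") (simp_all add: rightward_def)
  have "((Suc j, 1), BottomS) \<notin> S"
  proof -
    have "1 \<le> Suc j \<and> Suc j \<le> Suc N" using V by auto
    then show ?thesis using S by blast
  qed
  moreover have "((Suc j, i), TopS) \<in> S \<longleftrightarrow> ((Suc j, Suc i), BottomS) \<notin> S" if "i \<noteq> 0"
  proof -
    have "1 \<le> Suc j \<and> 1 \<le> i \<and> (Suc j \<le> N \<and> i < 2 * N + 1 \<or> Suc j = Suc N \<and> i < N)" using V that by auto
    then show ?thesis using S by blast
  qed
  ultimately show "((Suc j, Suc i), BottomS) \<in> S \<longleftrightarrow> upward S j i"
    by (cases "i = 0") (simp_all add: upward_def)
qed (simp_all add: rightward_def upward_def)

text \<open>
  The analogue for the odd model, with \<open>h\<close> and \<open>r\<close> for the flows on the right of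
  and inside the short column.
\<close>

lemma sum_odd_orientations:
  assumes "N \<ge> 1"
  shows "(\<Sum>S\<in>orientations (odd_graph N). F (row_states S N (2 * N + 1)) (column_states S N (2 * N + 1))
        (map (rightward S (Suc N)) [0..<N]) (\<lambda>i\<in>{..N}. upward S N i))
    = (\<Sum>h\<in>bool_lists N. \<Sum>c\<in>UNIV. \<Sum>g\<in>bool_lists N.
        \<Sum>p\<in>horizontal_paths N (2 * N + 1) (replicate (2 * N + 1) True) (g @ [\<not> c] @ rev (map Not h)).
        \<Sum>q\<in>PiE {..<N} (\<lambda>_. vertical_paths (2 * N + 1) False True).
        \<Sum>r\<in>vertical_paths N False c. (F p q h r :: complex))"
proof -
  let ?n = "2 * N + 1" and ?V = "odd_vertices N"
  let ?rows = "\<lambda>S. row_states S N ?n" and ?cols = "\<lambda>S. column_states S N ?n"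
  let ?out = "\<lambda>S. map (rightward S (Suc N)) [0..<N]" and ?last = "\<lambda>S. \<lambda>i\<in>{..N}. upward S N i"
  let ?H = "\<lambda>h c g. horizontal_paths N ?n (replicate ?n True) (g @ [\<not> c] @ rev (map Not h))"
  let ?Q = "PiE {..<N} (\<lambda>_. vertical_paths ?n False True)"
  let ?R = "\<lambda>c. vertical_paths N False c"
  let ?T = "SIGMA (h, c, g):bool_lists N \<times> UNIV \<times> bool_lists N. ?H h c g \<times> ?Q \<times> ?R c"
  let ?flow = "\<lambda>p q h r. flow_orientation ?V (\<lambda>j i. if j = Suc N then h ! i else p j ! i) (\<lambda>j. if j = N then r else q j)"
  have finQ: "finite ?Q" by (intro finite_PiE) auto
  have "(\<Sum>S\<in>orientations (odd_graph N). F (?rows S) (?cols S) (?out S) (?last S))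
     = (\<Sum>((h, c, g), p, q, r)\<in>?T. F p q h r)"
  proof (rule sum.reindex_bij_witness [where j = "\<lambda>S. ((?out S, upward S N N, take N (?rows S N)), ?rows S, ?cols S, ?last S)"
        and i = "\<lambda>((h, c, g), p, q, r). ?flow p q h r"])
    fix S assume orient: "S \<in> orientations (odd_graph N)"
    note S = orient [unfolded odd_orientations_iff]
    note flow = odd_orientation_flow [OF orient]
    have V: "(j, k) \<in> ?V" if "((j, k), d) \<in> S" for j k d using S that by blast
    have rows: "(if j = Suc N then ?out S ! i else ?rows S j ! i) = rightward S j i"
      if "j \<le> N \<and> i < ?n \<or> j = Suc N \<and> i < N" for i j
      using that by (auto simp: row_states_def simp del: upt_Suc)
    have cols: "(if j = N then ?last S else ?cols S j) i = upward S j i"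
      if "j < N \<and> i \<le> ?n \<or> j = N \<and> i \<le> N" for i j
      using that by (auto simp: column_states_def)
    have "?flow (?rows S) (?cols S) (?out S) (?last S) = S"
    proof (rule half_edge_set_eqI)
      fix j k
      let ?S = "?flow (?rows S) (?cols S) (?out S) (?last S)"
      have "(((j, k), LeftS) \<in> ?S \<longleftrightarrow> ((j, k), LeftS) \<in> S) \<and> (((j, k), RightS) \<in> ?S \<longleftrightarrow> ((j, k), RightS) \<in> S)
        \<and> (((j, k), BottomS) \<in> ?S \<longleftrightarrow> ((j, k), BottomS) \<in> S) \<and> (((j, k), TopS) \<in> ?S \<longleftrightarrow> ((j, k), TopS) \<in> S)"
      proof (cases "(j, k) \<in> ?V")
        case True
        then obtain j' k' where j: "j = Suc j'" "k = Suc k'"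
          by (cases j; cases k) (auto simp: odd_vertices_def)
        then have V': "j' < N \<and> k' < ?n \<or> j' = N \<and> k' < N" using True by (auto simp: odd_vertices_def)
        then have "(if j' = Suc N then ?out S ! k' else ?rows S j' ! k') = rightward S j' k'"
          "(if j = Suc N then ?out S ! k' else ?rows S j ! k') = rightward S j k'"
          "(if j' = N then ?last S else ?cols S j') k' = upward S j' k'"
          "(if j' = N then ?last S else ?cols S j') k = upward S j' k"
          by (intro rows cols; auto simp: j)+
        then show ?thesis
          using flow [of j' k'] True unfolding flow_orientation_iff j diff_Suc_1 by blast
      next
        case False
        then show ?thesis unfolding flow_orientation_iff using V by blast
      qed
      then show "((j, k), LeftS) \<in> ?S \<longleftrightarrow> ((j, k), LeftS) \<in> S" "((j, k), RightS) \<in> ?S \<longleftrightarrow> ((j, k), RightS) \<in> S"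
        "((j, k), BottomS) \<in> ?S \<longleftrightarrow> ((j, k), BottomS) \<in> S" "((j, k), TopS) \<in> ?S \<longleftrightarrow> ((j, k), TopS) \<in> S" by blast+
    qed
    then show "(\<lambda>((h, c, g), p, q, r). ?flow p q h r) ((?out S, upward S N N, take N (?rows S N)), ?rows S, ?cols S, ?last S) = S"
      by (simp only: prod.case)
    have "?rows S N = take N (?rows S N) @ [\<not> upward S N N] @ rev (map Not (?out S))"
    proof (rule nth_equalityI)
      fix i assume "i < length (?rows S N)"
      then have i: "i < ?n" by (simp add: row_states_def)
      consider "i < N" | "i = N" | "N < i" by linarith
      then show "?rows S N ! i = (take N (?rows S N) @ [\<not> upward S N N] @ rev (map Not (?out S))) ! i"
      proof cases
        case 1 then show ?thesis by (simp add: nth_append row_states_def)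
      next
        case 2
        have "((Suc N, N), TopS) \<in> S \<longleftrightarrow> ((N, Suc N), RightS) \<notin> S" using S by blast
        then show ?thesis using 2 assms by (simp add: nth_append row_states_def rightward_def upward_def)
      next
        case 3
        then have e: "i - N = Suc (i - Suc N)" "N - Suc (i - Suc N) < N" "Suc (N - Suc (i - Suc N)) = ?n - i"
          "1 \<le> ?n - i" "?n - i \<le> N" "2 * N + 2 - (?n - i) = Suc i" "i - Suc N < N" using i assms by auto
        then have "((Suc N, ?n - i), RightS) \<in> S \<longleftrightarrow> ((N, Suc i), RightS) \<notin> S"
          using S by metis
        then show ?thesis using 3 i e assms
          by (simp add: nth_append row_states_def rev_nth rightward_def del: upt_Suc)
      qed
    qed (simp add: row_states_def)
    moreover have "?rows S 0 = replicate ?n True"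
      by (rule nth_equalityI) (simp_all add: row_states_def rightward_def del: upt_Suc replicate_Suc)
    moreover have "?rows S \<in> PiE {..N} (\<lambda>_. bool_lists ?n)"
      by (auto simp: row_states_def)
    ultimately have "?rows S \<in> ?H (?out S) (upward S N N) (take N (?rows S N))"
      unfolding horizontal_paths_def mem_Collect_eq by blast
    moreover have "length (take N (?rows S N)) = N" "length (?out S) = N"
      by (simp_all add: row_states_def)
    moreover have "?cols S \<in> ?Q"
    proof -
      have "((Suc j, ?n), TopS) \<notin> S" if "j < N" for j
      proof -
        have "1 \<le> Suc j \<and> Suc j \<le> N" using that by simp
        then show ?thesis using S by blast
      qed
      then show ?thesis by (simp add: PiE_iff vertical_paths_def column_states_def upward_def)
    qed
    moreover have "?last S \<in> ?R (upward S N N)"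
      by (simp add: vertical_paths_def upward_def)
    ultimately show "((?out S, upward S N N, take N (?rows S N)), ?rows S, ?cols S, ?last S) \<in> ?T"
      by (simp only: mem_Sigma_iff prod.case bool_lists_iff UNIV_I simp_thms)
    show "(\<lambda>((h, c, g), p, q, r). F p q h r) ((?out S, upward S N N, take N (?rows S N)), ?rows S, ?cols S, ?last S)
        = F (?rows S) (?cols S) (?out S) (?last S)" by (simp only: prod.case)
  next
    fix x assume "x \<in> ?T"
    then obtain h c g p q r where x: "x = ((h, c, g), p, q, r)" and g: "length g = N" and h: "length h = N"
      and p: "p \<in> ?H h c g" and q: "q \<in> ?Q" and r: "r \<in> ?R c" by auto
    let ?S = "?flow p q h r"
    have p0: "p 0 = replicate ?n True" and pN: "p N = g @ [\<not> c] @ rev (map Not h)"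
      and pl: "\<And>j. j \<le> N \<Longrightarrow> length (p j) = ?n" and pe: "\<And>j. \<not> j \<le> N \<Longrightarrow> p j = undefined"
      using p by (auto simp: horizontal_paths_def PiE_iff extensional_def)
    have q0: "\<And>j. j < N \<Longrightarrow> \<not> q j 0" and qn: "\<And>j. j < N \<Longrightarrow> q j ?n"
      and qe: "\<And>j. \<not> j < N \<Longrightarrow> q j = undefined" "\<And>j i. j < N \<Longrightarrow> \<not> i \<le> ?n \<Longrightarrow> q j i = undefined"
      using q by (auto simp: vertical_paths_def PiE_iff extensional_def)
    have r0: "\<not> r 0" and rN: "r N = c" and re: "\<And>i. \<not> i \<le> N \<Longrightarrow> r i = undefined"
      using r by (auto simp: vertical_paths_def PiE_iff extensional_def)
    have Suc_V: "(Suc j, Suc i) \<in> ?V \<longleftrightarrow> j < N \<and> i < ?n \<or> j = N \<and> i < N" for i j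
      by (auto simp: odd_vertices_def)
    have R: "rightward ?S j i = (if j = Suc N then h ! i else p j ! i)" if "j \<le> N \<and> i < ?n \<or> j = Suc N \<and> i < N" for j i
    proof (cases j)
      case 0
      then show ?thesis using p0 that by (simp add: rightward_def del: replicate_Suc)
    next
      case (Suc j')
      then have "(j, Suc i) \<in> ?V" using that unfolding Suc Suc_V by auto
      then show ?thesis unfolding rightward_def flow_orientation_iff diff_Suc_1 using Suc by blast
    qed
    have U: "upward ?S j i = (if j = N then r else q j) i" if "j < N \<and> i \<le> ?n \<or> j = N \<and> i \<le> N" for j i
    proof (cases i)
      case 0
      then show ?thesis using q0 r0 that by (auto simp: upward_def)
    next
      case (Suc i')
      then have "(Suc j, i) \<in> ?V" using that unfolding Suc Suc_V by auto
      then show ?thesis unfolding upward_def flow_orientation_iff diff_Suc_1 using Suc by blast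
    qed
    have "?rows ?S j = p j" for j
    proof (cases "j \<le> N")
      case True
      then show ?thesis using R [of j] pl [of j]
        by (intro nth_equalityI) (simp_all add: row_states_def del: upt_Suc)
    qed (simp add: row_states_def pe)
    then have 1: "?rows ?S = p" by (rule ext)
    have "?cols ?S j i = q j i" for j i
      using U [of j i] qe by (simp add: column_states_def)
    then have 2: "?cols ?S = q" by (intro ext)
    have "?last ?S i = r i" for i
      using U [of N i] re by simp
    then have 3: "?last ?S = r" by (rule ext)
    have 4: "?out ?S = h"
      using R [of "Suc N"] h by (intro nth_equalityI) simp_all
    have 5: "upward ?S N N = c"
      using U [of N N] rN by simp
    have 6: "take N (p N) = g" by (simp add: pN g)
    show "(\<lambda>S. ((?out S, upward S N N, take N (?rows S N)), ?rows S, ?cols S, ?last S))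
        ((\<lambda>((h, c, g), p, q, r). ?flow p q h r) x) = x"
      by (simp only: x prod.case 1 2 3 4 5 6)
    show "((\<lambda>((h, c, g), p, q, r). ?flow p q h r) x) \<in> orientations (odd_graph N)"
      unfolding odd_orientations_iff x prod.case flow_orientation_iff
    proof (intro conjI allI impI)
      show "?S \<subseteq> ?V \<times> UNIV" by (auto simp: flow_orientation_def)
      show "((j, k) \<in> ?V \<and> \<not> (if j = Suc N then h ! (k - 1) else p j ! (k - 1)))
          = (\<not> ((Suc j, k) \<in> ?V \<and> (if Suc j - 1 = Suc N then h ! (k - 1) else p (Suc j - 1) ! (k - 1))))"
        if "1 \<le> j \<and> 1 \<le> k \<and> (j < N \<and> k \<le> 2 * N + 1 \<or> j = N \<and> k \<le> N)" for j k
      proof -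
        have "(j, k) \<in> ?V" "(Suc j, k) \<in> ?V" using that by (auto simp: odd_vertices_def)
        then show ?thesis by simp
      qed
      show "((j, k) \<in> ?V \<and> \<not> (if j - 1 = N then r else q (j - 1)) k)
          = (\<not> ((j, Suc k) \<in> ?V \<and> (if j - 1 = N then r else q (j - 1)) (Suc k - 1)))"
        if "1 \<le> j \<and> 1 \<le> k \<and> (j \<le> N \<and> k < 2 * N + 1 \<or> j = Suc N \<and> k < N)" for j k
      proof -
        have "(j, k) \<in> ?V" "(j, Suc k) \<in> ?V" using that by (auto simp: odd_vertices_def)
        then show ?thesis by simp
      qed
      show "((Suc N, k) \<in> ?V \<and> \<not> (if Suc N = Suc N then h ! (k - 1) else p (Suc N) ! (k - 1)))
          = (\<not> ((N, 2 * N + 2 - k) \<in> ?V \<and> \<not> (if N = Suc N then h ! (2 * N + 2 - k - 1) else p N ! (2 * N + 2 - k - 1))))"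
        if k: "1 \<le> k \<and> k \<le> N" for k
      proof -
        have V: "(Suc N, k) \<in> ?V" "(N, 2 * N + 2 - k) \<in> ?V" using k assms by (auto simp: odd_vertices_def)
        have e: "2 * N + 2 - k - 1 - N = Suc (N - k)" "N - Suc (N - k) = k - 1" "N - k < N" "k - 1 < N"
          "\<not> 2 * N + 2 - k - 1 < N" using k by auto
        have "p N ! (2 * N + 2 - k - 1) \<longleftrightarrow> \<not> h ! (k - 1)"
          unfolding pN nth_append g using e by (simp add: rev_nth h)
        then show ?thesis using V by simp
      qed
      show "((Suc N, N) \<in> ?V \<and> \<not> (if Suc N - 1 = N then r else q (Suc N - 1)) N)
          = (\<not> ((N, Suc N) \<in> ?V \<and> \<not> (if N = Suc N then h ! (Suc N - 1) else p N ! (Suc N - 1))))"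
      proof -
        have "(Suc N, N) \<in> ?V" "(N, Suc N) \<in> ?V" using assms by (auto simp: odd_vertices_def)
        moreover have "p N ! N \<longleftrightarrow> \<not> c" by (simp add: pN nth_append g)
        ultimately show ?thesis using rN by simp
      qed
      show "(1, k) \<in> ?V" if "1 \<le> k \<and> k \<le> 2 * N + 1" for k
        using that assms by (simp add: odd_vertices_def)
      show "if 1 - 1 = Suc N then h ! (k - 1) else p (1 - 1) ! (k - 1)" if "1 \<le> k \<and> k \<le> 2 * N + 1" for k
      proof -
        have "k - 1 < ?n" using that by linarith
        then show ?thesis by (simp add: p0 del: replicate_Suc)
      qed
      show "\<not> ((j, 1) \<in> ?V \<and> (if j - 1 = N then r else q (j - 1)) (1 - 1))" if "1 \<le> j \<and> j \<le> Suc N" for j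
      proof -
        have "j - 1 < N \<or> j - 1 = N" using that by linarith
        then show ?thesis using q0 [of "j - 1"] r0 by auto
      qed
      show "\<not> ((j, 2 * N + 1) \<in> ?V \<and> \<not> (if j - 1 = N then r else q (j - 1)) (2 * N + 1))" if "1 \<le> j \<and> j \<le> N" for j
      proof -
        have "j - 1 < N" using that by linarith
        then show ?thesis using qn [of "j - 1"] by auto
      qed
    qed
  qed
  also have "\<dots> = (\<Sum>(h, c, g)\<in>bool_lists N \<times> UNIV \<times> bool_lists N. \<Sum>(p, q, r)\<in>?H h c g \<times> ?Q \<times> ?R c. F p q h r)"
    unfolding split_beta by (subst sum.Sigma) (auto intro!: finite_cartesian_product finite_PiE simp: split_beta)
  also have "\<dots> = (\<Sum>h\<in>bool_lists N. \<Sum>c\<in>UNIV. \<Sum>g\<in>bool_lists N. \<Sum>p\<in>?H h c g. \<Sum>q\<in>?Q. \<Sum>r\<in>?R c. F p q h r)"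
    by (simp only: sum.cartesian_product prod.case)
  finally show ?thesis .
qed


lemma odd_row_nth:
  assumes "i < 2 * N + 1"
  shows "(map xs [1..<Suc N] @ [x] @ rev (map xs [1..<Suc N])) ! i = odd_row N xs x (Suc i)"
proof -
  consider "i < N" | "i = N" | "N < i" by linarith
  then show ?thesis
  proof cases
    case 3
    then have "i - N = Suc (i - Suc N)" "i - Suc N < N" "Suc 0 + (N - Suc (i - Suc N)) = 2 * N + 2 - Suc i"
      "N - Suc (i - Suc N) < N" "Suc 0 + (N - Suc (i - Suc N)) < Suc N"
      using assms by auto
    then show ?thesis using 3 by (simp add: nth_append rev_nth odd_row_def del: upt_Suc)
  qed (auto simp: nth_append odd_row_def simp del: upt_Suc)
qed

theorem ZHT_odd_eq:
  assumes "N \<ge> 1"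
  shows "ZHT_odd a N xs (x, y) ys = half_turn_odd a (map xs [1..<Suc N]) x y (map ys [1..<Suc N])"
proof -
  let ?n = "2 * N + 1" and ?xs = "map xs [1..<Suc N]" and ?ys = "map ys [1..<Suc N]"
  let ?rs = "?xs @ [x] @ rev ?xs"
  define A where "A = (\<lambda>p q. \<Prod>j<N. \<Prod>i<?n. ice_weight a (?rs ! i / ?ys ! j) (p j ! i) (p (Suc j) ! i) (q j i) (q j (Suc i)))"
  define B where "B = (\<lambda>g h r. \<Prod>i<N. ice_weight a (?xs ! i / y) (g ! i) (h ! i) (r i) (r (Suc i)))"
  have ys: "?ys ! j = ys (Suc j)" and xs: "?xs ! j = xs (Suc j)" if "j < N" for j
    using that by (simp_all del: upt_Suc)
  have "ZHT_odd a N xs (x, y) ys = (\<Sum>S\<in>orientations (odd_graph N).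
      A (row_states S N ?n) (column_states S N ?n)
      * B (row_states S N ?n N) (map (rightward S (Suc N)) [0..<N]) (\<lambda>i\<in>{..N}. upward S N i))"
    unfolding ZHT_odd_def
  proof (subst partition_function_orientations)
    show "(\<Sum>S\<in>orientations (odd_graph N). \<Prod>v\<in>vertices (odd_graph N). ice_weight a
         (case v of (j, k) \<Rightarrow> if j \<le> N then odd_row N xs (fst (x, y)) k * (1 / ys j) else xs k * (1 / snd (x, y)))
         ((v, LeftS) \<in> S) ((v, RightS) \<notin> S) ((v, BottomS) \<in> S) ((v, TopS) \<notin> S))
      = (\<Sum>S\<in>orientations (odd_graph N). A (row_states S N ?n) (column_states S N ?n)
      * B (row_states S N ?n N) (map (rightward S (Suc N)) [0..<N]) (\<lambda>i\<in>{..N}. upward S N i))"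
    proof (intro sum.cong refl)
      fix S assume S: "S \<in> orientations (odd_graph N)"
      let ?f = "\<lambda>t j k. ice_weight a t
         (((j, k), LeftS) \<in> S) (((j, k), RightS) \<notin> S) (((j, k), BottomS) \<in> S) (((j, k), TopS) \<notin> S)"
      let ?g = "\<lambda>v. ice_weight a
         (case v of (j, k) \<Rightarrow> if j \<le> N then odd_row N xs (fst (x, y)) k * (1 / ys j) else xs k * (1 / snd (x, y)))
         ((v, LeftS) \<in> S) ((v, RightS) \<notin> S) ((v, BottomS) \<in> S) ((v, TopS) \<notin> S)"
      have V: "(Suc j, Suc i) \<in> odd_vertices N" if "j < N \<and> i < ?n \<or> j = N \<and> i < N" for i j
        using that by (auto simp: odd_vertices_def)
      have "(\<Prod>v\<in>vertices (odd_graph N). ?g v) = (\<Prod>v\<in>{1..N} \<times> {1..?n}. ?g v) * (\<Prod>v\<in>{N + 1} \<times> {1..N}. ?g v)"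
        by (simp only: odd_graph_def ice_graph.simps odd_vertices_def, rule prod.union_disjoint) auto
      also have "(\<Prod>v\<in>{N + 1} \<times> {1..N}. ?g v) = (\<Prod>k\<in>{1..N}. ?f (xs k / y) (Suc N) k)"
      proof -
        have "(\<Prod>v\<in>{N + 1} \<times> {1..N}. ?g v) = (\<Prod>j\<in>{N + 1}. \<Prod>k\<in>{1..N}. ?g (j, k))"
          by (simp only: prod.cartesian_product case_prod_unfold prod.collapse fst_conv snd_conv)
        then show ?thesis by simp
      qed
      also have "\<dots> = (\<Prod>i<N. ?f (xs (Suc i) / y) (Suc N) (Suc i))"
        by (simp only: One_nat_def prod.atLeast1_atMost_eq)
      also have "\<dots> = B (row_states S N ?n N) (map (rightward S (Suc N)) [0..<N]) (\<lambda>i\<in>{..N}. upward S N i)"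
        unfolding B_def
        by (intro prod.cong refl)
          (simp add: odd_orientation_flow [OF S] V xs [unfolded One_nat_def] row_states_def del: upt_Suc)
      also have "(\<Prod>v\<in>{1..N} \<times> {1..?n}. ?g v) = (\<Prod>j\<in>{1..N}. \<Prod>k\<in>{1..?n}. ?g (j, k))"
        by (simp only: prod.cartesian_product case_prod_unfold prod.collapse fst_conv snd_conv)
      also have "\<dots> = (\<Prod>j\<in>{1..N}. \<Prod>k\<in>{1..?n}. ?f (odd_row N xs x k / ys j) j k)"
        by (intro prod.cong refl) simp
      also have "\<dots> = (\<Prod>j<N. \<Prod>i<?n. ?f (odd_row N xs x (Suc i) / ys (Suc j)) (Suc j) (Suc i))"
        by (simp only: One_nat_def prod.atLeast1_atMost_eq)
      also have "\<dots> = A (row_states S N ?n) (column_states S N ?n)"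
        unfolding A_def
        by (intro prod.cong refl)
          (simp add: odd_orientation_flow [OF S] V odd_row_nth [unfolded One_nat_def] ys [unfolded One_nat_def]
             row_states_def column_states_def del: append_Cons append_Nil upt_Suc)
      finally show "(\<Prod>v\<in>vertices (odd_graph N). ?g v) = A (row_states S N ?n) (column_states S N ?n)
        * B (row_states S N ?n N) (map (rightward S (Suc N)) [0..<N]) (\<lambda>i\<in>{..N}. upward S N i)" .
    qed
  qed (simp add: odd_graph_def odd_vertices_def)
  also have "\<dots> = (\<Sum>h\<in>bool_lists N. \<Sum>c\<in>UNIV. \<Sum>g\<in>bool_lists N.
        \<Sum>p\<in>horizontal_paths N ?n (replicate ?n True) (g @ [\<not> c] @ rev (map Not h)).
        \<Sum>q\<in>PiE {..<N} (\<lambda>_. vertical_paths ?n False True).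
        \<Sum>r\<in>vertical_paths N False c. A p q * B (p N) h r)"
    by (rule sum_odd_orientations [OF assms])
  also have "\<dots> = half_turn_odd a ?xs x y ?ys"
  proof -
    have len: "length ?rs = ?n" "length ?ys = N" "length ?xs = N" by auto
    have n: "Suc (2 * N) = ?n" by simp
    show ?thesis
      unfolding half_turn_odd_def len n
    proof (intro sum.cong refl)
      fix h c g assume h: "h \<in> bool_lists N" and g: "g \<in> bool_lists N"
      have l: "length (replicate ?n True) = length ?rs" "length (g @ [\<not> c] @ rev (map Not h)) = length ?rs"
        using len h g by simp_all
      have l': "length g = length ?xs" "length h = length ?xs" using len h g by simp_all
      let ?H = "horizontal_paths N ?n (replicate ?n True) (g @ [\<not> c] @ rev (map Not h))"
      have "B (p N) h r = B g h r" if "p \<in> ?H" for p r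
      proof -
        have "p N = g @ [\<not> c] @ rev (map Not h)" using that by (simp add: horizontal_paths_def)
        then show ?thesis using g unfolding B_def
          by (intro prod.cong refl) (simp add: nth_append)
      qed
      then have "(\<Sum>p\<in>?H. \<Sum>q\<in>PiE {..<N} (\<lambda>_. vertical_paths ?n False True). \<Sum>r\<in>vertical_paths N False c. A p q * B (p N) h r)
        = (\<Sum>p\<in>?H. \<Sum>q\<in>PiE {..<N} (\<lambda>_. vertical_paths ?n False True). A p q) * (\<Sum>r\<in>vertical_paths N False c. B g h r)"
        by (simp add: sum_distrib_left [symmetric] sum_distrib_right [symmetric])
      also have "(\<Sum>p\<in>?H. \<Sum>q\<in>PiE {..<N} (\<lambda>_. vertical_paths ?n False True). A p q)
        = columns a ?rs ?ys (replicate ?n True) (g @ [\<not> c] @ rev (map Not h))"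
        using columns_paths [OF l, of a ?ys, unfolded len] unfolding A_def by (rule sym)
      also have "(\<Sum>r\<in>vertical_paths N False c. B g h r) = column a y ?xs g h False c"
        using column_paths [OF l', of a y False c, unfolded len] unfolding B_def by (rule sym)
      finally show "(\<Sum>p\<in>?H. \<Sum>q\<in>PiE {..<N} (\<lambda>_. vertical_paths ?n False True). \<Sum>r\<in>vertical_paths N False c. A p q * B (p N) h r)
        = columns a ?rs ?ys (replicate ?n True) (g @ [\<not> c] @ rev (map Not h)) * column a y ?xs g h False c" .
    qed
  qed
  finally show ?thesis .
qed

section \<open>Symmetry by passage to the limit\<close>

lemma tendsto_partition_function:
  assumes "\<And>v. v \<in> vertices G \<Longrightarrow> ((\<lambda>e. t e v) \<longlongrightarrow> t0 v) F" "\<And>v. v \<in> vertices G \<Longrightarrow> t0 v \<noteq> 0" "a \<noteq> 0"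
  shows "((\<lambda>e. partition_function a G (t e)) \<longlongrightarrow> partition_function a G t0) F"
proof -
  have "((\<lambda>e. vertex_weight a (t e v) A) \<longlongrightarrow> vertex_weight a (t0 v) A) F" if "v \<in> vertices G" for v A
    unfolding vertex_weight_def sigma_def
    using assms(1) [OF that] assms(2) [OF that] assms(3) by (auto intro!: tendsto_intros)
  then show ?thesis
    unfolding partition_function_def by (intro tendsto_sum tendsto_prod)
qed

lemma tendsto_ZHT_even:
  assumes "a \<noteq> 0" "\<And>k. 1 \<le> k \<Longrightarrow> k < N \<Longrightarrow> ((\<lambda>e. xs e k) \<longlongrightarrow> xs0 k) F \<and> xs0 k \<noteq> 0"
    and "\<And>j. 1 \<le> j \<Longrightarrow> j \<le> N \<Longrightarrow> ((\<lambda>e. ys e j) \<longlongrightarrow> ys0 j) F \<and> ys0 j \<noteq> 0"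
    and "(x \<longlongrightarrow> x0) F" "(y \<longlongrightarrow> y0) F" "x0 \<noteq> 0" "y0 \<noteq> 0"
  shows "((\<lambda>e. ZHT_even a N (xs e) (x e, y e) (ys e)) \<longlongrightarrow> ZHT_even a N xs0 (x0, y0) ys0) F"
  unfolding ZHT_even_def
proof (rule tendsto_partition_function [OF _ _ assms(1)], safe)
  fix j k assume "(j, k) \<in> vertices (even_graph N)"
  then have jk: "1 \<le> j" "j \<le> N" "1 \<le> k" "k \<le> 2 * N" by (auto simp: even_graph_def even_vertices_def)
  have row: "((\<lambda>e. even_row N (xs e) (x e) (y e) k) \<longlongrightarrow> even_row N xs0 x0 y0 k) F \<and> even_row N xs0 x0 y0 k \<noteq> 0"
    unfolding even_row_def using assms(2) [of k] assms(2) [of "2 * N + 1 - k"] assms(4-7) jk by auto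
  then show "((\<lambda>e. even_row N (xs e) (fst (x e, y e)) (snd (x e, y e)) k * (1 / ys e j))
      \<longlongrightarrow> even_row N xs0 (fst (x0, y0)) (snd (x0, y0)) k * (1 / ys0 j)) F"
    unfolding fst_conv snd_conv using assms(3) [OF jk(1,2)] by (intro tendsto_intros) auto
  show "even_row N xs0 (fst (x0, y0)) (snd (x0, y0)) k * (1 / ys0 j) = 0 \<Longrightarrow> False"
    unfolding fst_conv snd_conv using row assms(3) [OF jk(1,2)] by auto
qed

lemma tendsto_ZHT_odd:
  assumes "a \<noteq> 0" "\<And>k. 1 \<le> k \<Longrightarrow> k \<le> N \<Longrightarrow> ((\<lambda>e. xs e k) \<longlongrightarrow> xs0 k) F \<and> xs0 k \<noteq> 0"
    and "\<And>j. 1 \<le> j \<Longrightarrow> j \<le> N \<Longrightarrow> ((\<lambda>e. ys e j) \<longlongrightarrow> ys0 j) F \<and> ys0 j \<noteq> 0"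
    and "(x \<longlongrightarrow> x0) F" "(y \<longlongrightarrow> y0) F" "x0 \<noteq> 0" "y0 \<noteq> 0"
  shows "((\<lambda>e. ZHT_odd a N (xs e) (x e, y e) (ys e)) \<longlongrightarrow> ZHT_odd a N xs0 (x0, y0) ys0) F"
  unfolding ZHT_odd_def
proof (rule tendsto_partition_function [OF _ _ assms(1)], safe)
  fix j k assume "(j, k) \<in> vertices (odd_graph N)"
  then have jk: "1 \<le> j" "1 \<le> k" "j \<le> N \<and> k \<le> 2 * N + 1 \<or> j = Suc N \<and> k \<le> N" by (auto simp: odd_graph_def odd_vertices_def)
  have row: "((\<lambda>e. odd_row N (xs e) (x e) k) \<longlongrightarrow> odd_row N xs0 x0 k) F \<and> odd_row N xs0 x0 k \<noteq> 0"
  proof -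
    have "1 \<le> 2 * N + 2 - k \<and> 2 * N + 2 - k \<le> N" if "\<not> k \<le> N" "k \<noteq> N + 1" using that jk by auto
    then show ?thesis
      unfolding odd_row_def using assms(2) [of k] assms(2) [of "2 * N + 2 - k"] assms(4,6) jk(2) by auto
  qed
  show "((\<lambda>e. if j \<le> N then odd_row N (xs e) (fst (x e, y e)) k * (1 / ys e j) else xs e k * (1 / snd (x e, y e)))
      \<longlongrightarrow> (if j \<le> N then odd_row N xs0 (fst (x0, y0)) k * (1 / ys0 j) else xs0 k * (1 / snd (x0, y0)))) F"
    unfolding fst_conv snd_conv using assms(2) [of k] assms(3) [OF jk(1)] assms(5,7) row jk
    by (cases "j \<le> N") (auto intro!: tendsto_intros)
  show "(if j \<le> N then odd_row N xs0 (fst (x0, y0)) k * (1 / ys0 j) else xs0 k * (1 / snd (x0, y0))) = 0 \<Longrightarrow> False"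
    unfolding fst_conv snd_conv using assms(2) [of k] assms(3) [OF jk(1)] assms(7) row jk by (auto split: if_splits)
qed

text \<open>
  Identities for generic parameters extend to all nonzero parameters because both sides are continuous
  along a line through the given point.
\<close>

lemma limits_eqI:
  fixes f g :: "complex \<Rightarrow> complex"
  assumes "eventually (\<lambda>e. f e = g e) (at 0)" "(f \<longlongrightarrow> l) (at 0)" "(g \<longlongrightarrow> m) (at 0)"
  shows "m = l"
proof (rule tendsto_unique [OF at_neq_bot assms(3)])
  show "(g \<longlongrightarrow> l) (at 0)" using assms(1,2) tendsto_cong by blast
qed

lemma sigma_eq_0D: "sigma t = 0 \<Longrightarrow> t \<noteq> 0 \<Longrightarrow> t\<^sup>2 = 1"
  by (simp add: sigma_def field_simps power2_eq_square)

lemma eventually_poly_nonzero: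
  fixes P :: "complex poly"
  assumes "P \<noteq> 0" shows "eventually (\<lambda>e. poly P e \<noteq> 0) (at 0)"
proof -
  have "finite ({e. poly P e = 0} - {0})" using poly_roots_finite [OF assms] by simp
  then have "open (- ({e. poly P e = 0} - {0}))" by (intro open_Compl finite_imp_closed)
  then show ?thesis
    unfolding eventually_at_topological by (intro exI [of _ "- ({e. poly P e = 0} - {0})"]) auto
qed

text \<open>
  Moving the variables with different speeds separates their sixth powers: the leading coefficients in
  \<open>e\<close> differ.
\<close>

lemma eventually_perturb_sixth_powers:
  assumes "i \<noteq> j"
  shows "eventually (\<lambda>e::complex. (u + e * of_nat i) ^ 6 \<noteq> (v + e * of_nat j) ^ 6) (at 0)"
proof -
  have lead: "coeff ([:w, of_nat k:] ^ 6) 6 = (of_nat k :: complex) ^ 6" for w k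
  proof (cases "k = 0")
    case True
    have "[:w, of_nat k:] ^ 6 = [:w ^ 6:]" using True by (simp add: poly_const_pow)
    then show ?thesis using True by (simp add: numeral_eq_Suc)
  next
    case False
    then have "degree ([:w, of_nat k :: complex:] ^ 6) = 6" by (simp add: degree_power_eq)
    then show ?thesis using lead_coeff_power [of "[:w, of_nat k :: complex:]" 6] False by simp
  qed
  have "[:u, of_nat i:] ^ 6 - [:v, of_nat j:] ^ 6 \<noteq> 0"
  proof
    assume "[:u, of_nat i:] ^ 6 - [:v, of_nat j:] ^ 6 = 0"
    then have "(of_nat i :: complex) ^ 6 = of_nat j ^ 6" using lead [of u i] lead [of v j] by simp
    then have "i ^ 6 = j ^ 6" by (metis of_nat_eq_iff of_nat_power)
    then show False using assms by (simp add: power_eq_iff_eq_base)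
  qed
  from eventually_poly_nonzero [OF this] show ?thesis by (simp add: mult.commute)
qed

lemma eventually_perturb_nonzero:
  assumes "u \<noteq> 0 \<or> k \<noteq> 0" shows "eventually (\<lambda>e::complex. u + e * of_nat k \<noteq> 0) (at 0)"
proof -
  have "[:u, of_nat k:] \<noteq> 0" using assms by auto
  from eventually_poly_nonzero [OF this] show ?thesis by (simp add: mult.commute)
qed

lemma tendsto_perturb: "((\<lambda>e::complex. u + e * of_nat k) \<longlongrightarrow> u) (at 0)"
  by (rule tendsto_eq_intros refl)+ simp

lemma eventually_generic:
  assumes "distinct (map fst us)" "\<And>u. u \<in> set us \<Longrightarrow> fst u \<noteq> 0"
  shows "eventually (\<lambda>e. generic (map (\<lambda>q. snd q + e * of_nat (fst q)) us)) (at 0)"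
  using assms
proof (induction us)
  case Nil
  show ?case by (simp add: generic_def)
next
  case (Cons p us)
  obtain k u where p: "p = (k, u)" by (cases p)
  have "eventually (\<lambda>e. \<forall>q\<in>set us. (u + e * of_nat k) ^ 6 \<noteq> (snd q + e * of_nat (fst q)) ^ 6) (at 0)"
  proof (rule eventually_ball_finite, simp, rule ballI)
    fix q assume "q \<in> set us"
    then have "k \<noteq> fst q" using Cons.prems(1) p by force
    then show "eventually (\<lambda>e. (u + e * of_nat k) ^ 6 \<noteq> (snd q + e * of_nat (fst q)) ^ 6) (at 0)"
      by (rule eventually_perturb_sixth_powers)
  qed
  moreover have "eventually (\<lambda>e. u + e * of_nat k \<noteq> 0) (at 0)"
    using Cons.prems(2) [of p] p by (intro eventually_perturb_nonzero) auto
  moreover have "eventually (\<lambda>e. generic (map (\<lambda>q. snd q + e * of_nat (fst q)) us)) (at 0)"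
    using Cons by auto
  ultimately show ?case
    by eventually_elim (auto simp: generic_def p comp_def)
qed


lemma half_turn_even_lists:
  assumes "length ys = Suc (length xs)"
  shows "half_turn_even a xs x y ys = ZHT_even a (length ys) (\<lambda>k. xs ! (k - 1)) (x, y) (\<lambda>j. ys ! (j - 1))"
proof -
  have "map (\<lambda>k. zs ! (k - 1)) [1..<Suc (length zs)] = zs" for zs :: "complex list"
    by (rule nth_equalityI) (simp_all del: upt_Suc)
  from this [of xs] this [of ys] show ?thesis
    using assms by (subst ZHT_even_eq) (simp_all del: upt_Suc)
qed

text \<open>
  Symmetry of the even model in all variables except \<open>x\<close> and \<open>y\<close>. Nongeneric
  parameters have to be included, since the odd model arises at \<open>x = v / a\<close> for one of the
  other variables \<open>v\<close>.
\<close>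

lemma half_turn_even_mset:
  assumes "a\<^sup>2 = a - 1" "length ys = Suc (length xs)" "length xs' = length xs" "mset (xs @ ys) = mset (xs' @ ys')"
    and "0 \<notin> set (xs @ ys)" "x \<noteq> 0" "y \<noteq> 0"
  shows "half_turn_even a xs x y ys = half_turn_even a xs' x y ys'"
proof -
  define n M where "n = length xs" and "M = length (xs @ ys)"
  have M: "M = 2 * n + 1" using assms(2) by (simp add: n_def M_def)
  have "size (mset (xs @ ys)) = size (mset (xs' @ ys'))" using assms(4) by simp
  then have len: "length ys = Suc n" "length ys' = Suc n" "length xs = n" "length xs' = n"
    using assms(2,3) by (simp_all add: n_def)
  obtain p where p: "p permutes {..<M}" and perm: "permute_list p (xs @ ys) = xs' @ ys'"
    using mset_eq_permutation [OF assms(4) [symmetric]] M_def by blast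
  define Z where "Z = (\<lambda>e. map (\<lambda>i. (xs @ ys) ! i + e * of_nat (Suc i)) [0..<M])"
  define Z' where "Z' = (\<lambda>e. permute_list p (Z e))"
  \<comment> \<open>one speed suffices for \<open>x\<close> and \<open>y\<close>, which are never compared with each other\<close>
  define X Y where "X = (\<lambda>e. x + e * of_nat (M + 1))" and "Y = (\<lambda>e. y + e * of_nat (M + 1))"
  have lenZ: "length (Z e) = M" "length (Z' e) = M" for e by (simp_all add: Z_def Z'_def)
  have mset: "mset (Z e) = mset (Z' e)" for e
    unfolding Z'_def using p by (intro mset_permute_list [symmetric]) (simp add: lenZ)
  have tends: "((\<lambda>e. Z e ! i) \<longlongrightarrow> (xs @ ys) ! i) (at 0)" if "i < M" for i
  proof -
    have "Z e ! i = (xs @ ys) ! i + e * of_nat (Suc i)" for e using that by (simp add: Z_def)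
    then show ?thesis by (simp only: tendsto_perturb)
  qed
  have tends': "((\<lambda>e. Z' e ! i) \<longlongrightarrow> (xs' @ ys') ! i) (at 0)" if "i < M" for i
  proof -
    have "p i < M" using p that permutes_in_image by fastforce
    moreover have "Z' e ! i = Z e ! p i" "(xs' @ ys') ! i = (xs @ ys) ! p i" for e
      unfolding Z'_def perm [symmetric] using that p by (simp_all add: permute_list_nth lenZ M_def)
    ultimately show ?thesis using tends by simp
  qed
  have nz: "(xs @ ys) ! i \<noteq> 0" "(xs' @ ys') ! i \<noteq> 0" if "i < M" for i
  proof -
    have "(xs @ ys) ! i \<in> set (xs @ ys)" using that unfolding M_def by (rule nth_mem)
    then show "(xs @ ys) ! i \<noteq> 0" using assms(5) by metis
    have "i < length (xs' @ ys')" using that len M by simp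
    then have "(xs' @ ys') ! i \<in> set (xs' @ ys')" by (rule nth_mem)
    then show "(xs' @ ys') ! i \<noteq> 0" using assms(5) mset_eq_setD [OF assms(4)] by metis
  qed
  have limit: "((\<lambda>e. half_turn_even a (take n (L e)) (X e) (Y e) (drop n (L e))) \<longlongrightarrow> half_turn_even a us x y vs) (at 0)"
    if L: "\<And>e. length (L e) = M" "\<And>i. i < M \<Longrightarrow> ((\<lambda>e. L e ! i) \<longlongrightarrow> (us @ vs) ! i) (at 0)"
      "\<And>i. i < M \<Longrightarrow> (us @ vs) ! i \<noteq> 0" and l: "length us = n" "length vs = Suc n" for L us vs
  proof -
    have E: "half_turn_even a (take n (L e)) (X e) (Y e) (drop n (L e))
        = ZHT_even a (Suc n) (\<lambda>k. take n (L e) ! (k - 1)) (X e, Y e) (\<lambda>j. drop n (L e) ! (j - 1))" for e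
      by (subst half_turn_even_lists) (simp_all add: L(1) M)
    have E0: "half_turn_even a us x y vs = ZHT_even a (Suc n) (\<lambda>k. us ! (k - 1)) (x, y) (\<lambda>j. vs ! (j - 1))"
      by (subst half_turn_even_lists) (simp_all add: l)
    show ?thesis
      unfolding E E0
    proof (rule tendsto_ZHT_even)
      show "a \<noteq> 0" by (rule sixth_root_facts(1) [OF assms(1)])
      show "((\<lambda>e. take n (L e) ! (k - 1)) \<longlongrightarrow> us ! (k - 1)) (at 0) \<and> us ! (k - 1) \<noteq> 0" if "1 \<le> k" "k < Suc n" for k
      proof -
        have "k - 1 < n" using that by auto
        then show ?thesis using L(2,3) [of "k - 1"] l M by (simp add: nth_append)
      qed
      show "((\<lambda>e. drop n (L e) ! (j - 1)) \<longlongrightarrow> vs ! (j - 1)) (at 0) \<and> vs ! (j - 1) \<noteq> 0" if j: "1 \<le> j" "j \<le> Suc n" for j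
      proof -
        obtain i where "j = Suc i" "i < Suc n" using j by (cases j) auto
        then show ?thesis using L(2,3) [of "n + i"] l M L(1) by (simp add: nth_append)
      qed
      show "(X \<longlongrightarrow> x) (at 0)" "(Y \<longlongrightarrow> y) (at 0)" unfolding X_def Y_def by (rule tendsto_perturb)+
    qed (use assms in auto)
  qed
  have lim: "((\<lambda>e. half_turn_even a (take n (Z e)) (X e) (Y e) (drop n (Z e))) \<longlongrightarrow> half_turn_even a xs x y ys) (at 0)"
    by (rule limit [OF lenZ(1) tends nz(1) len(3,1)])
  have lim': "((\<lambda>e. half_turn_even a (take n (Z' e)) (X e) (Y e) (drop n (Z' e))) \<longlongrightarrow> half_turn_even a xs' x y ys') (at 0)"
    by (rule limit [OF lenZ(2) tends' nz(2) len(4,2)])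
  have gen: "eventually (\<lambda>e. generic ((w + e * of_nat (M + 1)) # Z e)) (at 0)" if "w \<noteq> 0" for w
  proof -
    let ?us = "(M + 1, w) # map (\<lambda>i. (Suc i, (xs @ ys) ! i)) [0..<M]"
    have "eventually (\<lambda>e. generic (map (\<lambda>q. snd q + e * of_nat (fst q)) ?us)) (at 0)"
    proof (rule eventually_generic)
      have "inj_on Suc {0..<M}" by simp
      then show "distinct (map fst ?us)" by (auto simp: comp_def distinct_map)
      show "fst u \<noteq> 0" if "u \<in> set ?us" for u using that by auto
    qed
    then show ?thesis by (simp add: Z_def comp_def)
  qed
  have "eventually (\<lambda>e. (x + y) + e * of_nat (2 * (M + 1)) \<noteq> 0) (at 0)"
    by (rule eventually_perturb_nonzero) simp
  then have sum: "eventually (\<lambda>e. X e + Y e \<noteq> 0) (at 0)"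
    by eventually_elim (simp add: X_def Y_def algebra_simps)
  have ev: "eventually (\<lambda>e. half_turn_even a (take n (Z e)) (X e) (Y e) (drop n (Z e))
      = half_turn_even a (take n (Z' e)) (X e) (Y e) (drop n (Z' e))) (at 0)"
    using gen [OF assms(6)] gen [OF assms(7)] sum
  proof eventually_elim
    case (elim e)
    then show ?case
      by (intro half_turn_even_mset_generic [OF assms(1)]) (use mset [of e] in \<open>simp_all add: lenZ M X_def Y_def\<close>)
  qed
  from limits_eqI [OF ev lim lim'] show ?thesis ..
qed

lemma mset_permuted_upt:
  assumes "p permutes {1..M}"
  shows "mset (map (z \<circ> p) [1..<Suc M]) = mset (map z [1..<Suc M])"
proof -
  have "mset [1..<Suc M] = mset_set {1..M}" by (simp add: atLeastLessThanSuc_atLeastAtMost del: upt_Suc)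
  moreover have "image_mset (z \<circ> p) (mset_set {1..M}) = image_mset z (mset_set {1..M})"
    by (metis assms multiset.map_comp permutes_image_mset)
  ultimately show ?thesis by (simp only: mset_map)
qed

lemma map_upt_two_blocks: "map z [1..<Suc N] @ map (\<lambda>j. z (N + j)) [1..<Suc N] = map z [1..<Suc (2 * N)]"
  by (rule nth_equalityI) (auto simp: nth_append simp del: upt_Suc)

lemma generic_perturbed:
  "eventually (\<lambda>e. generic (map (\<lambda>i. z i + e * of_nat i) [1..<Suc M])) (at 0)"
proof -
  have "eventually (\<lambda>e. generic (map (\<lambda>q. snd q + e * of_nat (fst q)) (map (\<lambda>i. (i, z i)) [1..<Suc M]))) (at 0)"
    by (rule eventually_generic) (auto simp: comp_def simp del: upt_Suc)
  then show ?thesis by (simp add: comp_def del: upt_Suc)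
qed

lemma ZHT_even_symmetric:
  assumes a: "a\<^sup>2 = a - 1" and N: "N \<ge> 1"
  shows "symmetric_in (2 * N) (\<lambda>z. ZHT_even a N z (z N, z N) (\<lambda>j. z (N + j)))"
  unfolding symmetric_in_def
proof (intro allI impI)
  fix z :: "nat \<Rightarrow> complex" and p
  assume "(\<forall>i\<in>{1..2 * N}. z i \<noteq> 0) \<and> p permutes {1..2 * N}"
  then have z: "\<And>i. 1 \<le> i \<Longrightarrow> i \<le> 2 * N \<Longrightarrow> z i \<noteq> 0" and p: "p permutes {1..2 * N}" by auto
  have zp: "(z \<circ> p) i \<noteq> 0" if "1 \<le> i" "i \<le> 2 * N" for i
    using z permutes_in_image [OF p, of i] that by auto
  define F where "F = (\<lambda>z. ZHT_even a N z (z N, z N) (\<lambda>j. z (N + j)))"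
  define w where "w = (\<lambda>e i. z i + e * of_nat i :: complex)"
  have F: "F w = half_turn_even a (map w [1..<N]) (w N) (w N) (map (\<lambda>j. w (N + j)) [1..<Suc N])" for w
    unfolding F_def by (rule ZHT_even_eq [OF N])
  have ms: "mset (w N # map w [1..<N] @ map (\<lambda>j. w (N + j)) [1..<Suc N]) = mset (map w [1..<Suc (2 * N)])" for w :: "nat \<Rightarrow> complex"
  proof -
    have "mset (map w [1..<Suc N]) = mset (w N # map w [1..<N])" using N by (simp add: upt_Suc_append)
    then show ?thesis unfolding map_upt_two_blocks [symmetric] by (simp del: upt_Suc)
  qed
  have lim: "((\<lambda>e. F (v e)) \<longlongrightarrow> F v0) (at 0)"
    if "\<And>i. 1 \<le> i \<Longrightarrow> i \<le> 2 * N \<Longrightarrow> ((\<lambda>e. v e i) \<longlongrightarrow> v0 i) (at 0) \<and> v0 i \<noteq> 0" for v v0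
    unfolding F_def
    by (rule tendsto_ZHT_even) (use that N sixth_root_facts(1) [OF a] in auto)
  have w: "((\<lambda>e. w e i) \<longlongrightarrow> z i) (at 0)" for i unfolding w_def by (rule tendsto_perturb)
  have "eventually (\<lambda>e. F (w e) = F (w e \<circ> p)) (at 0)"
    using generic_perturbed [of z "2 * N"]
  proof eventually_elim
    case (elim e)
    have "mset (map (w e) [1..<Suc (2 * N)]) = mset (w e N # map (w e) [1..<N] @ map (\<lambda>j. w e (N + j)) [1..<Suc N])"
      by (rule ms [symmetric])
    from generic_mset [OF _ this] have g: "generic (w e N # map (w e) [1..<N] @ map (\<lambda>j. w e (N + j)) [1..<Suc N])"
      using elim by (simp add: w_def del: upt_Suc)
    show ?case
      unfolding F
    proof (rule half_turn_even_coincident_mset [OF a _ _ _ g])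
      show "mset (w e N # map (w e) [1..<N] @ map (\<lambda>j. w e (N + j)) [1..<Suc N])
        = mset ((w e \<circ> p) N # map (w e \<circ> p) [1..<N] @ map (\<lambda>j. (w e \<circ> p) (N + j)) [1..<Suc N])"
        unfolding ms mset_permuted_upt [OF p] ..
    qed (use N in auto)
  qed
  moreover have "((\<lambda>e. F (w e)) \<longlongrightarrow> F z) (at 0)"
    by (rule lim) (use w z in auto)
  moreover have "((\<lambda>e. F (w e \<circ> p)) \<longlongrightarrow> F (z \<circ> p)) (at 0)"
    by (rule lim) (use w zp in auto)
  ultimately have "F (z \<circ> p) = F z"
    by (rule limits_eqI)
  then show "ZHT_even a N (z \<circ> p) ((z \<circ> p) N, (z \<circ> p) N) (\<lambda>j. (z \<circ> p) (N + j)) = ZHT_even a N z (z N, z N) (\<lambda>j. z (N + j))"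
    by (simp add: F_def)
qed

text \<open>
  The prefactor that relates the odd to the even model is symmetric in the remaining variables; it can be
  cancelled where it does not vanish.
\<close>

lemma half_turn_odd_mset:
  assumes a: "a\<^sup>2 = a - 1" and len: "length ys = length xs" "length xs' = length xs" and ms: "mset (xs @ ys) = mset (xs' @ ys')"
    and nz: "0 \<notin> set (xs @ ys)" "x \<noteq> 0" "y \<noteq> 0"
    and reg: "\<And>z. z \<in> set (x # xs @ ys) \<Longrightarrow> sigma (a * y / z) \<noteq> 0"
  shows "half_turn_odd a xs x y ys = half_turn_odd a xs' x y ys'"
proof -
  note a' = sixth_root_facts [OF a]
  have "size (mset (xs @ ys)) = size (mset (xs' @ ys'))" using ms by simp
  then have len': "length ys' = length xs'" using len by simp
  have set: "set (xs @ ys) = set (xs' @ ys')" by (rule mset_eq_setD [OF ms])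
  let ?f = "\<lambda>z. sigma (a * y / z)"
  have turn: "half_turn_even a us (y / a) x (y # vs)
      = sigma (a\<^sup>2) * ?f x * prod_list (map ?f (us @ vs)) * half_turn_odd a us x y vs"
    if "length vs = length us" "0 \<notin> set (us @ vs)" for us vs
    using half_turn_even_turn [OF that(1) a'(1) nz(3), of x] that(2)
    by (simp only: sigma_sixth_root [OF a]) (simp add: mult_ac)
  let ?c = "sigma (a\<^sup>2) * ?f x * prod_list (map ?f (xs @ ys))"
  have "?c * half_turn_odd a xs x y ys = half_turn_even a xs (y / a) x (y # ys)"
    by (rule turn [symmetric]) (use len nz in auto)
  also have "\<dots> = half_turn_even a xs' (y / a) x (y # ys')"
    by (rule half_turn_even_mset [OF a]) (use len ms nz a'(1) in auto)
  also have "\<dots> = ?c * half_turn_odd a xs' x y ys'"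
    using turn [OF len'] set nz(1) prod_list_mset_cong [OF ms, of ?f] by simp
  finally have "?c * half_turn_odd a xs x y ys = ?c * half_turn_odd a xs' x y ys'" .
  moreover have "?c \<noteq> 0" using a'(6) reg by (auto simp: prod_list_zero_iff)
  ultimately show ?thesis by simp
qed

lemma ZHT_odd_symmetric:
  assumes a: "a\<^sup>2 = a - 1" and N: "N \<ge> 1" and xy: "x \<noteq> 0" "y \<noteq> 0"
  shows "symmetric_in (2 * N) (\<lambda>z. ZHT_odd a N z (x, y) (\<lambda>j. z (N + j)))"
  unfolding symmetric_in_def
proof (intro allI impI)
  fix z :: "nat \<Rightarrow> complex" and p
  assume "(\<forall>i\<in>{1..2 * N}. z i \<noteq> 0) \<and> p permutes {1..2 * N}"
  then have z: "\<And>i. 1 \<le> i \<Longrightarrow> i \<le> 2 * N \<Longrightarrow> z i \<noteq> 0" and p: "p permutes {1..2 * N}" by auto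
  have zp: "(z \<circ> p) i \<noteq> 0" if "1 \<le> i" "i \<le> 2 * N" for i
    using z permutes_in_image [OF p, of i] that by auto
  note a' = sixth_root_facts [OF a]
  define F where "F = (\<lambda>x z. ZHT_odd a N z (x, y) (\<lambda>j. z (N + j)))"
  \<comment> \<open>the point \<open>x\<close> has to be moved as well, because \<open>sigma (a y / x)\<close> may vanish\<close>
  define w where "w = (\<lambda>e i. z i + e * of_nat i :: complex)"
  define X where "X = (\<lambda>e. x + e * of_nat 1 :: complex)"
  have F: "F x w = half_turn_odd a (map w [1..<Suc N]) x y (map (\<lambda>j. w (N + j)) [1..<Suc N])" for w x
    unfolding F_def by (rule ZHT_odd_eq [OF N])
  have lim: "((\<lambda>e. F (X e) (v e)) \<longlongrightarrow> F x v0) (at 0)"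
    if "\<And>i. 1 \<le> i \<Longrightarrow> i \<le> 2 * N \<Longrightarrow> ((\<lambda>e. v e i) \<longlongrightarrow> v0 i) (at 0) \<and> v0 i \<noteq> 0" for v v0
    unfolding F_def
    by (rule tendsto_ZHT_odd) (use that N xy a'(1) tendsto_perturb [of x 1] in \<open>auto simp: X_def\<close>)
  have w: "((\<lambda>e. w e i) \<longlongrightarrow> z i) (at 0)" for i unfolding w_def by (rule tendsto_perturb)
  have regular: "eventually (\<lambda>e. u + e * of_nat k \<noteq> 0 \<and> sigma (a * y / (u + e * of_nat k)) \<noteq> 0) (at 0)" if k: "k \<noteq> 0" for u k
  proof -
    have 1: "eventually (\<lambda>e::complex. u + e * of_nat k \<noteq> 0) (at 0)"
      by (rule eventually_perturb_nonzero) (simp add: k)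
    have 2: "eventually (\<lambda>e::complex. (u + e * of_nat k) ^ 6 \<noteq> (a * y + e * of_nat 0) ^ 6) (at 0)"
      by (rule eventually_perturb_sixth_powers) (simp add: k)
    from 1 2 show ?thesis
    proof eventually_elim
      case (elim e)
      let ?u = "u + e * of_nat k"
      have "sigma (a * y / ?u) \<noteq> 0"
      proof
        assume "sigma (a * y / ?u) = 0"
        then have "(a * y / ?u)\<^sup>2 = 1"
          using elim(1) a'(1) xy by (intro sigma_eq_0D) auto
        then have "(a * y)\<^sup>2 = ?u\<^sup>2"
          unfolding power_divide using elim(1) by simp
        then have "((a * y)\<^sup>2) ^ 3 = (?u\<^sup>2) ^ 3" by (rule arg_cong)
        then show False using elim(2) by (simp flip: power_mult)
      qed
      then show ?case using elim by simp
    qed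
  qed
  have "eventually (\<lambda>e. \<forall>i\<in>{1..2 * N}. w e i \<noteq> 0 \<and> sigma (a * y / w e i) \<noteq> 0) (at 0)"
    by (intro eventually_ball_finite ballI) (auto simp: w_def intro: regular)
  moreover have "eventually (\<lambda>e. X e \<noteq> 0 \<and> sigma (a * y / X e) \<noteq> 0) (at 0)"
    unfolding X_def by (rule regular) simp
  ultimately have "eventually (\<lambda>e. F (X e) (w e) = F (X e) (w e \<circ> p)) (at 0)"
  proof eventually_elim
    case (elim e)
    show ?case
      unfolding F
    proof (rule half_turn_odd_mset [OF a])
      show "mset (map (w e) [1..<Suc N] @ map (\<lambda>j. w e (N + j)) [1..<Suc N])
          = mset (map (w e \<circ> p) [1..<Suc N] @ map (\<lambda>j. (w e \<circ> p) (N + j)) [1..<Suc N])"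
        unfolding map_upt_two_blocks mset_permuted_upt [OF p] ..
      have "set (map (w e) [1..<Suc N] @ map (\<lambda>j. w e (N + j)) [1..<Suc N]) = w e ` {1..2 * N}"
        unfolding map_upt_two_blocks by (simp add: atLeastLessThanSuc_atLeastAtMost del: upt_Suc)
      then show "0 \<notin> set (map (w e) [1..<Suc N] @ map (\<lambda>j. w e (N + j)) [1..<Suc N])"
        "\<And>u. u \<in> set (X e # map (w e) [1..<Suc N] @ map (\<lambda>j. w e (N + j)) [1..<Suc N]) \<Longrightarrow> sigma (a * y / u) \<noteq> 0"
        using elim by (auto simp del: upt_Suc set_append)
    qed (use elim xy in auto)
  qed
  moreover have "((\<lambda>e. F (X e) (w e)) \<longlongrightarrow> F x z) (at 0)"
    by (rule lim) (use w z in auto)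
  moreover have "((\<lambda>e. F (X e) (w e \<circ> p)) \<longlongrightarrow> F x (z \<circ> p)) (at 0)"
    by (rule lim) (use w zp in auto)
  ultimately have "F x (z \<circ> p) = F x z"
    by (rule limits_eqI)
  then show "ZHT_odd a N (z \<circ> p) (x, y) (\<lambda>j. (z \<circ> p) (N + j)) = ZHT_odd a N z (x, y) (\<lambda>j. z (N + j))"
    by (simp add: F_def)
qed

theorem theorem7:
  fixes N :: nat and a :: complex
  assumes "N \<ge> 1"
    and "a = exp (\<i> * complex_of_real pi / 3)"
  shows "symmetric_in (2*N) (\<lambda>z. ZHT_even a N z (z N, z N) (\<lambda>j. z (N + j)))
    \<and> (\<forall>x y. x \<noteq> 0 \<and> y \<noteq> 0 \<longrightarrow>
         symmetric_in (2*N) (\<lambda>z. ZHT_odd a N z (x, y) (\<lambda>j. z (N + j))))"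
proof -
  \<comment> \<open>the hypothesis on \<open>a\<close> enters only through the quadratic equation of the primitive sixth roots of unity\<close>
  have "a = cis (pi / 3)"
    by (simp add: assms(2) cis_conv_exp)
  then have "a = Complex (1 / 2) (sqrt 3 / 2)"
    by (simp add: complex_eq_iff cos_60 sin_60)
  moreover have "(Complex (1 / 2) (sqrt 3 / 2))\<^sup>2 = Complex (1 / 2) (sqrt 3 / 2) - 1"
    by (simp add: complex_eq_iff power2_eq_square)
  ultimately have "a\<^sup>2 = a - 1" by simp
  then show ?thesis
    using ZHT_even_symmetric ZHT_odd_symmetric assms(1) by blast
qed

end
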